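(* Let $Y$ be a compact hyperbolic Riemann surface and let $\ell\subset Y$ be a closed geodesic. There exists a constant $C'_\ell>0$ such that for every eigenfunction $\phi_i$ of the Laplace-Beltrami operator on $Y$ with $\|\phi_i\|_{L^2(Y)}=1$ and eigenvalue $\mu_i>0$, $$p^\ell(\phi_i)=\int_\ell|\phi_i|^2\,d\ell\leq C'_\ell\cdot\mu_i^{\frac14}.$$
   Context: $Y$ is a compact connected Riemann surface with a Riemannian metric of constant curvature $-1$ and volume element $dv$; $\Delta\ge0$ is the non-negative Laplace-Beltrami operator, $\Delta\phi_i=\mu_i\phi_i$, and $\phi_i$ has norm one in $L^2(Y,dv)$. Here $d\ell$ is the line element (arc length) along $\ell$. *)

theory Defs
  imports "HOL-Complex_Analysis.Complex_Analysis"
begin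

definition partial_x :: "(complex \<Rightarrow> 'b::real_normed_vector) \<Rightarrow> complex \<Rightarrow> 'b" where
  "partial_x f z = frechet_derivative f (at z) 1"

definition partial_y :: "(complex \<Rightarrow> 'b::real_normed_vector) \<Rightarrow> complex \<Rightarrow> 'b" where
  "partial_y f z = frechet_derivative f (at z) \<i>"

fun C_k_on :: "nat \<Rightarrow> complex set \<Rightarrow> (complex \<Rightarrow> 'b::real_normed_vector) \<Rightarrow> bool" where
  "C_k_on 0 S f \<longleftrightarrow> continuous_on S f"
| "C_k_on (Suc k) S f \<longleftrightarrow>
     f differentiable_on S \<and> C_k_on k S (partial_x f) \<and> C_k_on k S (partial_y f)"

text \<open>Only meant for open sets.\<close>

definition smooth_on :: "complex set \<Rightarrow> (complex \<Rightarrow> 'b::real_normed_vector) \<Rightarrow> bool" where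
  "smooth_on S f \<longleftrightarrow> (\<forall>k. C_k_on k S f)"

definition flat_laplacian :: "(complex \<Rightarrow> 'b::real_normed_vector) \<Rightarrow> complex \<Rightarrow> 'b" where
  "flat_laplacian f z = partial_x (partial_x f) z + partial_y (partial_y f) z"

text \<open>
  A complex chart together with the local expression of a Riemannian metric compatible with
  the complex structure: on the image of the chart the metric is \<open>\<rho>(z)\<^sup>2 (dx\<^sup>2 + dy\<^sup>2)\<close>,
  where \<open>\<rho>\<close> is the field \<open>conf_factor\<close>.
\<close>

record 'a metric_chart =
  chart_dom :: "'a set"
  coord :: "'a \<Rightarrow> complex"
  conf_factor :: "complex \<Rightarrow> real"

definition chart_img :: "'a metric_chart \<Rightarrow> complex set" where
  "chart_img \<kappa> = coord \<kappa> ` chart_dom \<kappa>"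

definition param :: "'a metric_chart \<Rightarrow> complex \<Rightarrow> 'a" where
  "param \<kappa> = inv_into (chart_dom \<kappa>) (coord \<kappa>)"

definition transition :: "'a metric_chart \<Rightarrow> 'a metric_chart \<Rightarrow> complex \<Rightarrow> complex" where
  "transition \<kappa> \<kappa>' = coord \<kappa>' \<circ> param \<kappa>"

text \<open>The Gaussian curvature of the metric \<open>\<rho>\<^sup>2 (dx\<^sup>2 + dy\<^sup>2)\<close> is \<open>- (\<Delta>\<^sub>0 log \<rho>) / \<rho>\<^sup>2\<close>,
  with \<open>\<Delta>\<^sub>0 = \<partial>\<^sub>x\<^sup>2 + \<partial>\<^sub>y\<^sup>2\<close>.\<close>

definition gauss_curvature :: "(complex \<Rightarrow> real) \<Rightarrow> complex \<Rightarrow> real" where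
  "gauss_curvature \<rho> z = - flat_laplacian (\<lambda>w. ln (\<rho> w)) z / (\<rho> z)\<^sup>2"

locale compact_riemann_surface =
  fixes Y :: "'a::t2_space set" and A :: "'a metric_chart set"
  assumes compact: "compact Y"
    and connected: "connected Y"
    and nonempty: "Y \<noteq> {}"
    and cover: "(\<Union>\<kappa>\<in>A. chart_dom \<kappa>) = Y"
    and dom_open: "\<kappa> \<in> A \<Longrightarrow> openin (top_of_set Y) (chart_dom \<kappa>)"
    and img_open: "\<kappa> \<in> A \<Longrightarrow> open (chart_img \<kappa>)"
    and chart_homeomorphism:
      "\<kappa> \<in> A \<Longrightarrow> homeomorphism (chart_dom \<kappa>) (chart_img \<kappa>) (coord \<kappa>) (param \<kappa>)"
    and transition_holomorphic:
      "\<kappa> \<in> A \<Longrightarrow> \<kappa>' \<in> A \<Longrightarrow>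
        transition \<kappa> \<kappa>' holomorphic_on coord \<kappa> ` (chart_dom \<kappa> \<inter> chart_dom \<kappa>')"

text \<open>The condition \<open>conf_factor_transition\<close> says that the local expressions
  \<open>\<rho>\<^sup>2 (dx\<^sup>2 + dy\<^sup>2)\<close> agree on overlaps, i.e. define one metric on \<open>Y\<close>.\<close>

locale compact_hyperbolic_surface = compact_riemann_surface +
  assumes conf_factor_smooth: "\<kappa> \<in> A \<Longrightarrow> smooth_on (chart_img \<kappa>) (conf_factor \<kappa>)"
    and conf_factor_pos: "\<kappa> \<in> A \<Longrightarrow> z \<in> chart_img \<kappa> \<Longrightarrow> conf_factor \<kappa> z > 0"
    and conf_factor_transition:
      "\<kappa> \<in> A \<Longrightarrow> \<kappa>' \<in> A \<Longrightarrow> p \<in> chart_dom \<kappa> \<inter> chart_dom \<kappa>' \<Longrightarrow>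
        conf_factor \<kappa> (coord \<kappa> p) =
        conf_factor \<kappa>' (coord \<kappa>' p) * cmod (deriv (transition \<kappa> \<kappa>') (coord \<kappa> p))"
    and curvature: "\<kappa> \<in> A \<Longrightarrow> z \<in> chart_img \<kappa> \<Longrightarrow> gauss_curvature (conf_factor \<kappa>) z = -1"

text \<open>
  The volume element \<open>dv\<close>. Each chart contributes the image of \<open>\<rho>\<^sup>2 dx dy\<close>, a Borel measure
  on \<open>Y\<close> concentrated on the chart domain. Since these agree on overlaps, their supremum in
  the lattice of measures on \<open>Y\<close> (not to be confused with their sum) is the measure that
  restricts to each of them on the respective chart domain.
\<close>

definition chart_volume :: "'a::t2_space set \<Rightarrow> 'a metric_chart \<Rightarrow> 'a measure" where
  "chart_volume Y \<kappa> =
     distr (density (restrict_space lborel (chart_img \<kappa>)) (\<lambda>z. ennreal ((conf_factor \<kappa> z)\<^sup>2)))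
           (restrict_space borel Y) (param \<kappa>)"

definition volume :: "'a::t2_space set \<Rightarrow> 'a metric_chart set \<Rightarrow> 'a measure" where
  "volume Y A = (SUP \<kappa>\<in>A. chart_volume Y \<kappa>)"

definition L2_norm_on ::
    "'a::t2_space set \<Rightarrow> 'a metric_chart set \<Rightarrow> ('a \<Rightarrow> complex) \<Rightarrow> real" where
  "L2_norm_on Y A f = sqrt (\<integral>p. (cmod (f p))\<^sup>2 \<partial>volume Y A)"

text \<open>The non-negative Laplace-Beltrami operator \<open>- \<rho>\<^sup>-\<^sup>2 (\<partial>\<^sub>x\<^sup>2 + \<partial>\<^sub>y\<^sup>2)\<close>, read in the
  chart \<open>\<kappa>\<close>; at a point of several chart domains it does not depend on the chart.\<close>

definition laplace_beltrami ::
    "'a metric_chart \<Rightarrow> ('a \<Rightarrow> complex) \<Rightarrow> 'a \<Rightarrow> complex" where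
  "laplace_beltrami \<kappa> f p =
     - flat_laplacian (f \<circ> param \<kappa>) (coord \<kappa> p) /
       complex_of_real ((conf_factor \<kappa> (coord \<kappa> p))\<^sup>2)"

definition eigenfunction ::
    "'a metric_chart set \<Rightarrow> ('a \<Rightarrow> complex) \<Rightarrow> real \<Rightarrow> bool" where
  "eigenfunction A f \<mu> \<longleftrightarrow>
     (\<forall>\<kappa>\<in>A. smooth_on (chart_img \<kappa>) (f \<circ> param \<kappa>)) \<and>
     (\<forall>\<kappa>\<in>A. \<forall>p\<in>chart_dom \<kappa>. laplace_beltrami \<kappa> f p = complex_of_real \<mu> * f p) \<and>
     (\<exists>\<kappa>\<in>A. \<exists>p\<in>chart_dom \<kappa>. f p \<noteq> 0)"

text \<open>
  In a complex coordinate \<open>w\<close> the geodesic equation of \<open>\<rho>\<^sup>2 |dw|\<^sup>2\<close> is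
  \<open>w'' + 2 (\<partial>\<^sub>w log \<rho>) w'\<^sup>2 = 0\<close>, and \<open>2 \<partial>\<^sub>w = \<partial>\<^sub>x - \<i> \<partial>\<^sub>y\<close>.
\<close>

definition log_factor_dw :: "(complex \<Rightarrow> real) \<Rightarrow> complex \<Rightarrow> complex" where
  "log_factor_dw \<rho> z =
     (complex_of_real (partial_x (\<lambda>w. ln (\<rho> w)) z)
       - \<i> * complex_of_real (partial_y (\<lambda>w. ln (\<rho> w)) z)) / 2"

text \<open>
  A closed geodesic, given by a parametrization by arc length with period \<open>L\<close>;
  it may have self-intersections, and \<open>L\<close> need not be the least period.
\<close>

definition closed_geodesic ::
    "'a::t2_space set \<Rightarrow> 'a metric_chart set \<Rightarrow> (real \<Rightarrow> 'a) \<Rightarrow> real \<Rightarrow> bool" where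
  "closed_geodesic Y A \<gamma> L \<longleftrightarrow>
     L > 0 \<and> (\<forall>t. \<gamma> (t + L) = \<gamma> t) \<and> (\<forall>t. \<gamma> t \<in> Y) \<and> continuous_on UNIV \<gamma> \<and>
     (\<forall>\<kappa>\<in>A. \<forall>t. \<gamma> t \<in> chart_dom \<kappa> \<longrightarrow>
       (let w = coord \<kappa> \<circ> \<gamma>; w' = (\<lambda>s. vector_derivative w (at s)) in
          w differentiable (at t) \<and>
          conf_factor \<kappa> (w t) * cmod (w' t) = 1 \<and>
          (w' has_vector_derivative
             - 2 * log_factor_dw (conf_factor \<kappa>) (w t) * (w' t)\<^sup>2) (at t)))"

text \<open>For a parametrization by arc length the line element is \<open>dt\<close>.\<close>

definition geodesic_period ::
    "(real \<Rightarrow> 'a) \<Rightarrow> real \<Rightarrow> ('a \<Rightarrow> complex) \<Rightarrow> real" where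
  "geodesic_period \<gamma> L f = integral {0..L} (\<lambda>t. (cmod (f (\<gamma> t)))\<^sup>2)"

end

theory Submission
  imports Defs
begin

text \<open>
  Put \<open>g = 1 / \<rho>\<close>. Curvature -1 makes \<open>T = - g\<^sub>z\<^sub>z / g\<close> holomorphic, and \<open>2 g = \<bar>y\<^sub>2\<bar>\<^sup>2 - \<bar>y\<^sub>1\<bar>\<^sup>2\<close>
  for suitable solutions of \<open>y'' = - T y\<close>; their quotient yields a coordinate \<open>w = x + \<i> t\<close>
  in which the metric is \<open>(cos x)\<^sup>-\<^sup>2 \<bar>dw\<bar>\<^sup>2\<close> and the geodesic is \<open>x = 0\<close>, \<open>t\<close> being its
  arc length. Pulled back to a strip \<open>\<bar>x\<bar> < e\<close>, an eigenfunction becomes a function \<open>u\<close> of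
  period \<open>L\<close> in \<open>t\<close> with \<open>u\<^sub>x\<^sub>x + u\<^sub>t\<^sub>t = - \<mu> (cos x)\<^sup>-\<^sup>2 u\<close>.

  Let \<open>B(x, y)\<close> be the integral of \<open>u(x, t) u(y, t)\<close> over a period. Then
  \<open>B\<^sub>x\<^sub>x - B\<^sub>y\<^sub>y = - \<mu> ((cos x)\<^sup>-\<^sup>2 - (cos y)\<^sup>-\<^sup>2) B\<close>, a one-dimensional wave equation whose right-hand
  side is \<open>O(\<mu> h\<^sup>2)\<close> on \<open>\<bar>x\<bar>, \<bar>y\<bar> \<le> 2 h\<close>. The parallelogram identity for it bounds
  \<open>h B(0, 0)\<close>, that is \<open>h\<close> times the integral over the geodesic, by \<open>(5 + 32 \<mu> h\<^sup>4)\<close> times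
  the integral of \<open>u\<^sup>2\<close> over \<open>\<bar>x\<bar> \<le> 2 h\<close>, which the norm of the eigenfunction controls. The theorem follows with \<open>h\<close> of
  order \<open>\<mu>\<close> to the power \<open>-1/4\<close>.

  This \<open>h\<close> fits into the strip because the positive eigenvalues are bounded below: if a
  real eigenfunction \<open>f\<close> has maximum \<open>M = max \<bar>f\<bar>\<close>, the Harnack inequality for \<open>M - f \<ge> 0\<close>
  gives \<open>M - f \<le> C \<mu> M\<close> everywhere, whereas \<open>f \<le> 0\<close> at its minimum.
\<close>

section \<open>Calculus of partial derivatives\<close>

text \<open>The exponent comes from a balance. A priori nothing prevents the whole mass of an
  eigenfunction from lying in the strip of width \<open>h\<close>, so averaging over the strip costs
  \<open>1 / h\<close>; the error in the wave equation adds a term of order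
  \<open>\<mu> h^3\<close>, and the two meet when \<open>\<mu> h^4\<close> is of order 1. The error
  is that small only because the weight \<open>1 / cos^2\<close> is even in \<open>x\<close>, hence
  stationary on the geodesic, so its oscillation is quadratic in \<open>h\<close>. That the weight
  depends on \<open>x\<close> alone is what allows the \<open>t\<close>-derivatives to be integrated
  away; the strip coordinate is built to make both facts visible.

  The surface is known only through charts and the geodesic may cross itself, so the cylinder is
  merely an immersed image of the strip. Its mass is therefore never compared with the surface as a
  whole: it is cut into finitely many pieces, each inside a single chart and of mass at most 1, and
  their number enters the constant.\<close>

lemma partial_derivativesI:
  assumes "(f has_derivative (\<lambda>h. Re h *\<^sub>R a + Im h *\<^sub>R b)) (at z)"
  shows "f differentiable (at z)" "partial_x f z = a" "partial_y f z = b"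
  using assms frechet_derivative_at[OF assms, symmetric]
  by (auto simp: differentiable_def partial_x_def partial_y_def)

lemma has_derivative_partials:
  assumes "f differentiable (at z)"
  shows "(f has_derivative (\<lambda>h. Re h *\<^sub>R partial_x f z + Im h *\<^sub>R partial_y f z)) (at z)"
proof -
  have D: "(f has_derivative frechet_derivative f (at z)) (at z)"
    using assms frechet_derivative_works by blast
  interpret bounded_linear "frechet_derivative f (at z)" using D by (rule has_derivative_bounded_linear)
  have "frechet_derivative f (at z) h = Re h *\<^sub>R partial_x f z + Im h *\<^sub>R partial_y f z" for h
  proof -
    have "h = Re h *\<^sub>R 1 + Im h *\<^sub>R \<i>" by (simp add: complex_eq_iff)
    from arg_cong[OF this, of "frechet_derivative f (at z)"]
    have "frechet_derivative f (at z) h = frechet_derivative f (at z) (Re h *\<^sub>R 1 + Im h *\<^sub>R \<i>)" .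
    then show ?thesis by (simp only: add scaleR partial_x_def partial_y_def)
  qed
  then show ?thesis using D by presburger
qed

lemma partials_cong:
  assumes "open S" "z \<in> S" "\<And>w. w \<in> S \<Longrightarrow> f w = g w"
  shows "partial_x f z = partial_x g z" "partial_y f z = partial_y g z"
proof -
  have "(f has_derivative D) (at z) \<longleftrightarrow> (g has_derivative D) (at z)" for D
    using has_derivative_transform_within_open[of f D z UNIV S g, OF _ assms(1,2)]
      has_derivative_transform_within_open[of g D z UNIV S f, OF _ assms(1,2)] assms(3) by auto
  then have "frechet_derivative f (at z) = frechet_derivative g (at z)"
    unfolding frechet_derivative_def by simp
  then show "partial_x f z = partial_x g z" "partial_y f z = partial_y g z"
    by (simp_all add: partial_x_def partial_y_def)
qed

lemma differentiable_on_openD: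
  "\<lbrakk>f differentiable_on S; open S; z \<in> S\<rbrakk> \<Longrightarrow> f differentiable (at z)"
  by (simp add: differentiable_on_eq_differentiable_at)

lemma C_k_on_cong:
  assumes "open S" "\<And>w. w \<in> S \<Longrightarrow> f w = g w" "C_k_on k S f"
  shows "C_k_on k S g"
  using assms(2,3)
proof (induction k arbitrary: f g)
  case 0
  then show ?case using continuous_on_eq by force
next
  case (Suc k)
  have "g differentiable (at z)" if z: "z \<in> S" for z
  proof -
    obtain D where "(f has_derivative D) (at z)"
      using Suc.prems(2) differentiable_on_openD[OF _ assms(1) z] unfolding differentiable_def by auto
    then have "(g has_derivative D) (at z)"
      using has_derivative_transform_within_open[of f D z UNIV S g] Suc.prems(1) assms(1) z by blast
    then show ?thesis by (auto simp: differentiable_def)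
  qed
  moreover have "C_k_on k S (partial_x g)"
    by (rule Suc.IH[of "partial_x f"]) (use Suc.prems partials_cong(1)[OF assms(1)] in auto)
  moreover have "C_k_on k S (partial_y g)"
    by (rule Suc.IH[of "partial_y f"]) (use Suc.prems partials_cong(2)[OF assms(1)] in auto)
  ultimately show ?case by (auto simp: differentiable_on_eq_differentiable_at[OF assms(1)])
qed

lemma C_k_on_Suc_D: "C_k_on (Suc k) S f \<Longrightarrow> C_k_on k S f"
proof (induction k arbitrary: f)
  case 0
  then show ?case by (auto intro: differentiable_imp_continuous_on)
next
  case (Suc k)
  from Suc.prems have "f differentiable_on S" "C_k_on (Suc k) S (partial_x f)" "C_k_on (Suc k) S (partial_y f)"
    by (simp_all only: C_k_on.simps(2)[of "Suc k"])
  then show ?case using Suc.IH[of "partial_x f"] Suc.IH[of "partial_y f"] by (simp only: C_k_on.simps(2)[of k])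
qed

lemma C_k_on_mono: "C_k_on m S f \<Longrightarrow> k \<le> m \<Longrightarrow> C_k_on k S f"
  by (induction m) (auto simp: le_Suc_eq dest: C_k_on_Suc_D simp del: C_k_on.simps)

text \<open>The workhorse for the closure rules below: on an open set \<open>C_k_on\<close> depends
  only on the values there, so it is enough to name candidates for the two partial derivatives and
  to know that these are \<open>C_k_on\<close> of one order less.\<close>

lemma C_k_on_Suc_partialsI:
  assumes "open S"
    and "\<And>z. z \<in> S \<Longrightarrow> (f has_derivative (\<lambda>h. Re h *\<^sub>R a z + Im h *\<^sub>R b z)) (at z)"
    and "C_k_on k S a" "C_k_on k S b"
  shows "C_k_on (Suc k) S f"
proof -
  have "C_k_on k S (partial_x f)"
    by (rule C_k_on_cong[OF assms(1) _ assms(3)]) (simp add: partial_derivativesI(2)[OF assms(2)])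
  moreover have "C_k_on k S (partial_y f)"
    by (rule C_k_on_cong[OF assms(1) _ assms(4)]) (simp add: partial_derivativesI(3)[OF assms(2)])
  moreover have "f differentiable_on S"
    using partial_derivativesI(1)[OF assms(2)] by (simp add: differentiable_on_eq_differentiable_at[OF assms(1)])
  ultimately show ?thesis by simp
qed

lemma C_k_on_const: "open S \<Longrightarrow> C_k_on k S (\<lambda>z. c)"
proof (induction k arbitrary: c)
  case (Suc k)
  show ?case
    by (rule C_k_on_Suc_partialsI[where a = "\<lambda>_. 0" and b = "\<lambda>_. 0"]) (use Suc in auto)
qed simp

lemma C_k_on_add:
  assumes S: "open S" shows "C_k_on k S f \<Longrightarrow> C_k_on k S g \<Longrightarrow> C_k_on k S (\<lambda>z. f z + g z)"
proof (induction k arbitrary: f g)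
  case 0
  then show ?case by (auto intro: continuous_intros)
next
  case (Suc k)
  show ?case
  proof (rule C_k_on_Suc_partialsI[OF S])
    show "C_k_on k S (\<lambda>z. partial_x f z + partial_x g z)" "C_k_on k S (\<lambda>z. partial_y f z + partial_y g z)"
      using Suc by auto
    show "((\<lambda>z. f z + g z) has_derivative
        (\<lambda>h. Re h *\<^sub>R (partial_x f z + partial_x g z) + Im h *\<^sub>R (partial_y f z + partial_y g z))) (at z)"
      if "z \<in> S" for z
    proof -
      have "f differentiable (at z)" "g differentiable (at z)"
        using Suc.prems differentiable_on_openD[OF _ S that] by auto
      then show ?thesis
        by (auto intro!: derivative_eq_intros has_derivative_partials simp: algebra_simps)
    qed
  qed
qed

lemma (in bounded_linear) C_k_on_bounded_linear:
  assumes S: "open S" shows "C_k_on k S g \<Longrightarrow> C_k_on k S (\<lambda>z. f (g z))"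
proof (induction k arbitrary: g)
  case 0
  then show ?case using continuous_on by auto
next
  case (Suc k)
  show ?case
  proof (rule C_k_on_Suc_partialsI[OF S])
    show "C_k_on k S (\<lambda>z. f (partial_x g z))" "C_k_on k S (\<lambda>z. f (partial_y g z))"
      using Suc by auto
    show "((\<lambda>z. f (g z)) has_derivative
        (\<lambda>h. Re h *\<^sub>R f (partial_x g z) + Im h *\<^sub>R f (partial_y g z))) (at z)"
      if "z \<in> S" for z
    proof -
      have "g differentiable (at z)"
        using Suc.prems differentiable_on_openD[OF _ S that] by auto
      from has_derivative[OF has_derivative_partials[OF this]] show ?thesis by (simp add: add scaleR)
    qed
  qed
qed

lemma (in bounded_bilinear) C_k_on_bilinear:
  assumes S: "open S" shows "C_k_on k S f \<Longrightarrow> C_k_on k S g \<Longrightarrow> C_k_on k S (\<lambda>z. prod (f z) (g z))"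
proof (induction k arbitrary: f g)
  case 0
  then show ?case using continuous_on by auto
next
  case (Suc k)
  show ?case
  proof (rule C_k_on_Suc_partialsI[OF S])
    have fg: "C_k_on k S f" "C_k_on k S g" using Suc.prems C_k_on_Suc_D by blast+
    show "C_k_on k S (\<lambda>z. prod (f z) (partial_x g z) + prod (partial_x f z) (g z))"
      "C_k_on k S (\<lambda>z. prod (f z) (partial_y g z) + prod (partial_y f z) (g z))"
      using Suc fg by (auto intro!: C_k_on_add[OF S])
    show "((\<lambda>z. prod (f z) (g z)) has_derivative
        (\<lambda>h. Re h *\<^sub>R (prod (f z) (partial_x g z) + prod (partial_x f z) (g z))
           + Im h *\<^sub>R (prod (f z) (partial_y g z) + prod (partial_y f z) (g z)))) (at z)"
      if "z \<in> S" for z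
    proof -
      have "f differentiable (at z)" "g differentiable (at z)"
        using Suc.prems differentiable_on_openD[OF _ S that] by auto
      from FDERIV[OF has_derivative_partials[OF this(1)] has_derivative_partials[OF this(2)]]
      show ?thesis by (simp add: add_left add_right scaleR_left scaleR_right algebra_simps)
    qed
  qed
qed

lemmas C_k_on_mult = bounded_bilinear.C_k_on_bilinear[OF bounded_bilinear_mult]
lemmas C_k_on_scaleR = bounded_bilinear.C_k_on_bilinear[OF bounded_bilinear_scaleR]
lemmas C_k_on_of_real = bounded_linear.C_k_on_bounded_linear[OF bounded_linear_of_real]
lemmas C_k_on_Re = bounded_linear.C_k_on_bounded_linear[OF bounded_linear_Re]
lemmas C_k_on_Im = bounded_linear.C_k_on_bounded_linear[OF bounded_linear_Im]

lemma C_k_on_cmult: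
  fixes f :: "complex \<Rightarrow> 'b::real_normed_algebra"
  shows "open S \<Longrightarrow> C_k_on k S f \<Longrightarrow> C_k_on k S (\<lambda>z. c * f z)"
  by (rule C_k_on_mult[OF _ C_k_on_const])

lemma C_k_on_diff:
  fixes f :: "complex \<Rightarrow> 'b::real_normed_vector"
  assumes S: "open S" and "C_k_on k S f" "C_k_on k S g"
  shows "C_k_on k S (\<lambda>z. f z - g z)"
proof -
  have "C_k_on k S (\<lambda>z. f z + - g z)"
    by (intro C_k_on_add bounded_linear.C_k_on_bounded_linear[OF bounded_linear_minus[OF bounded_linear_ident]] assms)
  then show ?thesis by simp
qed

lemma C_k_on_inverse:
  fixes f :: "complex \<Rightarrow> 'b::real_normed_field"
  assumes S: "open S" and nz: "\<And>z. z \<in> S \<Longrightarrow> f z \<noteq> 0"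
  shows "C_k_on k S f \<Longrightarrow> C_k_on k S (\<lambda>z. inverse (f z))"
proof (induction k)
  case 0
  then show ?case using nz by (auto intro: continuous_intros)
next
  case (Suc k)
  show ?case
  proof (rule C_k_on_Suc_partialsI[OF S])
    have f: "C_k_on k S f" using Suc.prems C_k_on_Suc_D by blast
    show "C_k_on k S (\<lambda>z. - 1 * (inverse (f z) * (partial_x f z * inverse (f z))))"
      "C_k_on k S (\<lambda>z. - 1 * (inverse (f z) * (partial_y f z * inverse (f z))))"
      using Suc f by (intro C_k_on_cmult C_k_on_mult S; simp)+
    show "((\<lambda>z. inverse (f z)) has_derivative
        (\<lambda>h. Re h *\<^sub>R (- 1 * (inverse (f z) * (partial_x f z * inverse (f z))))
           + Im h *\<^sub>R (- 1 * (inverse (f z) * (partial_y f z * inverse (f z)))))) (at z)"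
      if "z \<in> S" for z
    proof -
      have "f differentiable (at z)"
        using Suc.prems differentiable_on_openD[OF _ S that] by auto
      from has_derivative_partials[OF this] show ?thesis
        using nz[OF that] by (auto intro!: derivative_eq_intros simp: algebra_simps)
    qed
  qed
qed

text \<open>No induction on \<open>k\<close>: the partials of \<open>ln (f z)\<close> are
  \<open>inverse (f z)\<close> times those of \<open>f\<close>, which the rules for products and
  inverses already cover.\<close>

lemma C_k_on_ln:
  fixes f :: "complex \<Rightarrow> real"
  assumes S: "open S" and pos: "\<And>z. z \<in> S \<Longrightarrow> f z > 0" and f: "C_k_on k S f"
  shows "C_k_on k S (\<lambda>z. ln (f z))"
proof (cases k)
  case 0
  then show ?thesis using f pos by (force intro!: continuous_intros)
next
  case (Suc m)
  show ?thesis unfolding Suc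
  proof (rule C_k_on_Suc_partialsI[OF S])
    have m: "C_k_on m S f" using f C_k_on_Suc_D unfolding Suc by blast
    show "C_k_on m S (\<lambda>z. inverse (f z) * partial_x f z)" "C_k_on m S (\<lambda>z. inverse (f z) * partial_y f z)"
      using f Suc m pos by (intro C_k_on_mult C_k_on_inverse S; force)+
    show "((\<lambda>z. ln (f z)) has_derivative
        (\<lambda>h. Re h *\<^sub>R (inverse (f z) * partial_x f z) + Im h *\<^sub>R (inverse (f z) * partial_y f z))) (at z)"
      if "z \<in> S" for z
    proof -
      have "f differentiable (at z)"
        using f Suc differentiable_on_openD[OF _ S that] by auto
      from has_derivative_partials[OF this] show ?thesis
        using pos[OF that] by (auto intro!: derivative_eq_intros simp: field_simps)
    qed
  qed
qed

section \<open>Composition with holomorphic maps\<close>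

lemma holomorphic_has_derivative_partials:
  assumes "F holomorphic_on S" "open S" "z \<in> S"
  shows "(F has_derivative (\<lambda>h. Re h *\<^sub>R deriv F z + Im h *\<^sub>R (\<i> * deriv F z))) (at z)"
proof -
  have "(F has_field_derivative deriv F z) (at z)"
    using assms holomorphic_derivI by blast
  then have "(F has_derivative (\<lambda>h. h * deriv F z)) (at z)"
    by (simp add: has_field_derivative_def mult.commute[of _ "deriv F z"])
  then show ?thesis by (rule has_derivative_eq_rhs) (simp add: fun_eq_iff complex_eq_iff)
qed

lemma C_k_on_holomorphic:
  assumes S: "open S" shows "F holomorphic_on S \<Longrightarrow> C_k_on k S F"
proof (induction k arbitrary: F)
  case 0
  then show ?case using holomorphic_on_imp_continuous_on by auto
next
  case (Suc k)
  have "deriv F holomorphic_on S" using Suc.prems S holomorphic_deriv by blast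
  then show ?case
    by (intro C_k_on_Suc_partialsI[OF S, where a = "deriv F" and b = "\<lambda>z. \<i> * deriv F z"]
        holomorphic_has_derivative_partials[OF Suc.prems S] Suc.IH C_k_on_cmult[OF S])
qed

lemma has_derivative_compose_holomorphic:
  assumes F: "F holomorphic_on S" "open S" "z \<in> S" and f: "f differentiable (at (F z))"
  shows "((\<lambda>z. f (F z)) has_derivative
     (\<lambda>h. Re h *\<^sub>R (Re (deriv F z) *\<^sub>R partial_x f (F z) + Im (deriv F z) *\<^sub>R partial_y f (F z))
        + Im h *\<^sub>R (Re (deriv F z) *\<^sub>R partial_y f (F z) - Im (deriv F z) *\<^sub>R partial_x f (F z)))) (at z)"
  using has_derivative_compose[OF holomorphic_has_derivative_partials[OF F] has_derivative_partials[OF f]]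
  by (simp add: algebra_simps)

lemma C_k_on_compose_holomorphic:
  assumes S: "open S" and T: "open T" and F: "F holomorphic_on S" "F ` S \<subseteq> T"
  shows "C_k_on k T f \<Longrightarrow> C_k_on k S (\<lambda>z. f (F z))"
proof (induction k arbitrary: f)
  case 0
  then show ?case
    using F continuous_on_compose2[of T f S F] holomorphic_on_imp_continuous_on[of F S] by auto
next
  case (Suc k)
  have D: "C_k_on k S (deriv F)" using F S holomorphic_deriv C_k_on_holomorphic by blast
  have fF: "f differentiable (at (F z))" if "z \<in> S" for z
    using that F Suc.prems differentiable_on_openD[OF _ T] by auto
  have xy: "C_k_on k S (\<lambda>z. partial_x f (F z))" "C_k_on k S (\<lambda>z. partial_y f (F z))"
    using Suc by auto
  show ?case
    by (rule C_k_on_Suc_partialsI[OF S has_derivative_compose_holomorphic[OF F(1) S _ fF]])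
      (intro C_k_on_add C_k_on_diff C_k_on_scaleR C_k_on_Re C_k_on_Im S D xy | assumption)+
qed

lemma flat_laplacian_cong:
  assumes "open S" "z \<in> S" "\<And>w. w \<in> S \<Longrightarrow> f w = g w"
  shows "flat_laplacian f z = flat_laplacian g z"
  using partials_cong[OF assms(1,2), of "partial_x f" "partial_x g"] partials_cong[OF assms(1,2), of "partial_y f" "partial_y g"]
    partials_cong[OF assms(1) _ assms(3)]
  by (simp add: flat_laplacian_def)

lemma partials_scaleR:
  fixes r :: "complex \<Rightarrow> real"
  assumes "r differentiable (at z)" "f differentiable (at z)"
  shows "(\<lambda>z. r z *\<^sub>R f z) differentiable (at z)"
    "partial_x (\<lambda>z. r z *\<^sub>R f z) z = r z *\<^sub>R partial_x f z + partial_x r z *\<^sub>R f z"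
    "partial_y (\<lambda>z. r z *\<^sub>R f z) z = r z *\<^sub>R partial_y f z + partial_y r z *\<^sub>R f z"
proof -
  have "((\<lambda>z. r z *\<^sub>R f z) has_derivative (\<lambda>h. Re h *\<^sub>R (r z *\<^sub>R partial_x f z + partial_x r z *\<^sub>R f z)
     + Im h *\<^sub>R (r z *\<^sub>R partial_y f z + partial_y r z *\<^sub>R f z))) (at z)"
    using has_derivative_scaleR[OF has_derivative_partials[OF assms(1)] has_derivative_partials[OF assms(2)]]
    by (simp add: algebra_simps)
  from partial_derivativesI[OF this] show "(\<lambda>z. r z *\<^sub>R f z) differentiable (at z)"
    "partial_x (\<lambda>z. r z *\<^sub>R f z) z = r z *\<^sub>R partial_x f z + partial_x r z *\<^sub>R f z"
    "partial_y (\<lambda>z. r z *\<^sub>R f z) z = r z *\<^sub>R partial_y f z + partial_y r z *\<^sub>R f z" .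
qed

lemma partials_add:
  assumes "f differentiable (at z)" "g differentiable (at z)"
  shows "partial_x (\<lambda>z. f z + g z) z = partial_x f z + partial_x g z"
    "partial_y (\<lambda>z. f z + g z) z = partial_y f z + partial_y g z"
proof -
  have "((\<lambda>z. f z + g z) has_derivative (\<lambda>h. Re h *\<^sub>R (partial_x f z + partial_x g z)
     + Im h *\<^sub>R (partial_y f z + partial_y g z))) (at z)"
    using has_derivative_add[OF has_derivative_partials[OF assms(1)] has_derivative_partials[OF assms(2)]]
    by (simp add: algebra_simps)
  from partial_derivativesI[OF this] show "partial_x (\<lambda>z. f z + g z) z = partial_x f z + partial_x g z"
    "partial_y (\<lambda>z. f z + g z) z = partial_y f z + partial_y g z" by auto
qed

lemma partials_diff:
  assumes "f differentiable (at z)" "g differentiable (at z)"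
  shows "partial_x (\<lambda>z. f z - g z) z = partial_x f z - partial_x g z"
    "partial_y (\<lambda>z. f z - g z) z = partial_y f z - partial_y g z"
proof -
  have "((\<lambda>z. f z - g z) has_derivative (\<lambda>h. Re h *\<^sub>R (partial_x f z - partial_x g z)
     + Im h *\<^sub>R (partial_y f z - partial_y g z))) (at z)"
    using has_derivative_diff[OF has_derivative_partials[OF assms(1)] has_derivative_partials[OF assms(2)]]
    by (simp add: algebra_simps)
  from partial_derivativesI[OF this] show "partial_x (\<lambda>z. f z - g z) z = partial_x f z - partial_x g z"
    "partial_y (\<lambda>z. f z - g z) z = partial_y f z - partial_y g z" by auto
qed

text \<open>Conformal covariance. In the sum of the two second derivatives the terms containing
  \<open>deriv (deriv F)\<close> cancel by the Cauchy-Riemann equations, and each mixed derivative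
  of \<open>f\<close> cancels against itself, so the order of differentiation never has to be
  exchanged and \<open>f\<close> may take values in any normed space.\<close>

lemma flat_laplacian_compose_holomorphic:
  assumes S: "open S" and T: "open T" and F: "F holomorphic_on S" "F ` S \<subseteq> T"
    and f: "C_k_on 2 T f" and z: "z \<in> S"
  shows "flat_laplacian (\<lambda>z. f (F z)) z = (cmod (deriv F z))\<^sup>2 *\<^sub>R flat_laplacian f (F z)"
proof -
  define p where "p = (\<lambda>z. Re (deriv F z))"
  define q where "q = (\<lambda>z. Im (deriv F z))"
  have f1: "f differentiable (at (F z))" "partial_x f differentiable (at (F z))"
     "partial_y f differentiable (at (F z))" if "z \<in> S" for z
    using f that F(2) differentiable_on_openD[OF _ T] by (auto simp: numeral_2_eq_2)
  have D: "deriv F holomorphic_on S" using F S holomorphic_deriv by blast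
  note dD = holomorphic_has_derivative_partials[OF D S z]
  define c where "c = deriv (deriv F) z"
  have p: "(p has_derivative (\<lambda>h. Re h *\<^sub>R Re c + Im h *\<^sub>R (- Im c))) (at z)"
    using bounded_linear.has_derivative[OF bounded_linear_Re dD] by (simp add: p_def c_def)
  have q: "(q has_derivative (\<lambda>h. Re h *\<^sub>R Im c + Im h *\<^sub>R Re c)) (at z)"
    using bounded_linear.has_derivative[OF bounded_linear_Im dD] by (simp add: q_def c_def)
  note P = partial_derivativesI[OF p] and Q = partial_derivativesI[OF q]
  have c1: "partial_x (\<lambda>z. f (F z)) w = p w *\<^sub>R partial_x f (F w) + q w *\<^sub>R partial_y f (F w)"
    "partial_y (\<lambda>z. f (F z)) w = p w *\<^sub>R partial_y f (F w) - q w *\<^sub>R partial_x f (F w)" if "w \<in> S" for w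
    using partial_derivativesI[OF has_derivative_compose_holomorphic[OF F(1) S that f1(1)[OF that]]]
    by (auto simp: p_def q_def)
  note X = partial_derivativesI[OF has_derivative_compose_holomorphic[OF F(1) S z f1(2)[OF z]]]
  note Y = partial_derivativesI[OF has_derivative_compose_holomorphic[OF F(1) S z f1(3)[OF z]]]
  have xx: "partial_x (partial_x (\<lambda>z. f (F z))) z
      = partial_x (\<lambda>w. p w *\<^sub>R partial_x f (F w) + q w *\<^sub>R partial_y f (F w)) z"
    by (rule partials_cong(1)[OF S z c1(1)])
  have yy: "partial_y (partial_y (\<lambda>z. f (F z))) z
      = partial_y (\<lambda>w. p w *\<^sub>R partial_y f (F w) - q w *\<^sub>R partial_x f (F w)) z"
    by (rule partials_cong(2)[OF S z c1(2)])
  have n: "(cmod (deriv F z))\<^sup>2 = p z * p z + q z * q z"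
    unfolding cmod_power2 p_def q_def by (simp add: power2_eq_square)
  note px = partials_scaleR[OF P(1) X(1)] and py = partials_scaleR[OF P(1) Y(1)]
    and qx = partials_scaleR[OF Q(1) X(1)] and qy = partials_scaleR[OF Q(1) Y(1)]
  have "flat_laplacian (\<lambda>z. f (F z)) z = (p z *\<^sub>R (p z *\<^sub>R partial_x (partial_x f) (F z) + q z *\<^sub>R partial_y (partial_x f) (F z)) +
       Re c *\<^sub>R partial_x f (F z) +
       (q z *\<^sub>R (p z *\<^sub>R partial_x (partial_y f) (F z) + q z *\<^sub>R partial_y (partial_y f) (F z)) +
        Im c *\<^sub>R partial_y f (F z))) +
      (p z *\<^sub>R (p z *\<^sub>R partial_y (partial_y f) (F z) - q z *\<^sub>R partial_x (partial_y f) (F z)) +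
       (- Im c) *\<^sub>R partial_y f (F z) -
       (q z *\<^sub>R (p z *\<^sub>R partial_y (partial_x f) (F z) - q z *\<^sub>R partial_x (partial_x f) (F z)) +
        Re c *\<^sub>R partial_x f (F z)))"
    unfolding flat_laplacian_def xx yy partials_add(1)[OF px(1) qy(1)] partials_diff(2)[OF py(1) qx(1)]
      px(2) qy(2) py(3) qx(3) X(2,3) Y(2,3) P(2,3) Q(2,3)
    by (simp only: p_def q_def)
  then show ?thesis unfolding n flat_laplacian_def by (simp add: algebra_simps)
qed

section \<open>Derivatives along curves, mixed partials, linear images\<close>

lemma has_vector_derivative_along_curve:
  assumes g: "(g has_vector_derivative g') (at t within T)" and f: "f differentiable (at (g t))"
  shows "((\<lambda>t. f (g t)) has_vector_derivative Re g' *\<^sub>R partial_x f (g t) + Im g' *\<^sub>R partial_y f (g t))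
    (at t within T)"
proof -
  have "((\<lambda>t. f (g t)) has_derivative
     (\<lambda>x. Re (x *\<^sub>R g') *\<^sub>R partial_x f (g t) + Im (x *\<^sub>R g') *\<^sub>R partial_y f (g t))) (at t within T)"
    using g has_derivative_partials[OF f] unfolding has_vector_derivative_def
    by (rule has_derivative_compose)
  then show ?thesis unfolding has_vector_derivative_def
    by (rule has_derivative_eq_rhs) (simp add: fun_eq_iff algebra_simps)
qed

lemma has_vector_derivative_horizontal:
  assumes "f differentiable (at (c + complex_of_real t))"
  shows "((\<lambda>t. f (c + complex_of_real t)) has_vector_derivative partial_x f (c + complex_of_real t)) (at t within T)"
proof -
  have "((\<lambda>t. c + complex_of_real t) has_vector_derivative 1) (at t within T)"
    by (auto intro!: derivative_eq_intros)
  from has_vector_derivative_along_curve[OF this assms] show ?thesis by simp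
qed

lemma has_vector_derivative_vertical:
  assumes "f differentiable (at (c + \<i> * complex_of_real t))"
  shows "((\<lambda>t. f (c + \<i> * complex_of_real t)) has_vector_derivative partial_y f (c + \<i> * complex_of_real t)) (at t within T)"
proof -
  have "((\<lambda>t. c + \<i> * complex_of_real t) has_vector_derivative \<i>) (at t within T)"
    by (auto intro!: derivative_eq_intros)
  from has_vector_derivative_along_curve[OF this assms] show ?thesis by simp
qed

text \<open>The second difference \<open>D\<close> over a square of side \<open>s\<close> with
  corner \<open>z\<close> equals \<open>s * s\<close> times either mixed derivative at some point of
  the square, by the mean value theorem applied in the two orders. If the mixed derivatives at
  \<open>z\<close> differed by \<open>2 * e\<close>, continuity would keep their values on a small
  square apart.\<close>

lemma mixed_partials_real:
  fixes f :: "complex \<Rightarrow> real"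
  assumes S: "open S" "z \<in> S" and f: "C_k_on 2 S f"
  shows "partial_y (partial_x f) z = partial_x (partial_y f) z"
proof (rule ccontr)
  assume ne: "partial_y (partial_x f) z \<noteq> partial_x (partial_y f) z"
  define e where "e = \<bar>partial_y (partial_x f) z - partial_x (partial_y f) z\<bar> / 2"
  have e: "e > 0" using ne by (simp add: e_def)
  have d0: "f differentiable (at w)" and dx: "partial_x f differentiable (at w)"
    and dy: "partial_y f differentiable (at w)" if "w \<in> S" for w
    using f that differentiable_on_openD[OF _ S(1)] by (auto simp: numeral_2_eq_2)
  have "continuous_on S (partial_y (partial_x f))" "continuous_on S (partial_x (partial_y f))"
    using f by (auto simp: numeral_2_eq_2)
  then have "isCont (partial_y (partial_x f)) z" "isCont (partial_x (partial_y f)) z"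
    using S continuous_on_eq_continuous_at by blast+
  then have "eventually (\<lambda>w. dist (partial_y (partial_x f) w) (partial_y (partial_x f) z) < e) (nhds z)"
    "eventually (\<lambda>w. dist (partial_x (partial_y f) w) (partial_x (partial_y f) z) < e) (nhds z)"
    using e by (auto simp: isCont_def tendsto_at_iff_tendsto_nhds intro: tendstoD)
  moreover have "eventually (\<lambda>w. w \<in> S) (nhds z)" using S eventually_nhds_in_open by blast
  ultimately have "eventually (\<lambda>w. dist (partial_y (partial_x f) w) (partial_y (partial_x f) z) < e \<and>
     dist (partial_x (partial_y f) w) (partial_x (partial_y f) z) < e \<and> w \<in> S) (nhds z)"
    by eventually_elim auto
  then obtain r where r: "r > 0" and near: "\<And>w. dist w z < r \<Longrightarrow>
     dist (partial_y (partial_x f) w) (partial_y (partial_x f) z) < e \<and>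
     dist (partial_x (partial_y f) w) (partial_x (partial_y f) z) < e \<and> w \<in> S"
    unfolding eventually_nhds_metric by blast
  \<comment> \<open>Points of the square are at distance at most \<open>2 * s\<close> from
    \<open>z\<close>, hence closer than \<open>r\<close>.\<close>
  define s where "s = r / 3"
  have s: "s > 0" using r by (simp add: s_def)
  have near': "dist (z + complex_of_real a + \<i> * complex_of_real b) z < r" if "0 \<le> a" "a \<le> s" "0 \<le> b" "b \<le> s" for a b
  proof -
    have "dist (z + complex_of_real a + \<i> * complex_of_real b) z = cmod (complex_of_real a + \<i> * complex_of_real b)"
      by (simp add: dist_norm)
    also have "\<dots> \<le> \<bar>a\<bar> + \<bar>b\<bar>" using norm_triangle_ineq[of "complex_of_real a" "\<i> * complex_of_real b"] by (simp add: norm_mult)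
    finally show ?thesis using that r by (simp add: s_def)
  qed
  define p where "p a b = z + complex_of_real a + \<i> * complex_of_real b" for a b
  have p_alt: "p a b = (z + \<i> * complex_of_real b) + complex_of_real a" for a b by (simp add: p_def)
  have in_S: "p a b \<in> S" if "0 \<le> a" "a \<le> s" "0 \<le> b" "b \<le> s" for a b
    using near[OF near'[OF that]] by (simp add: p_def)
  have X: "((\<lambda>a. h (p a b)) has_real_derivative partial_x h (p a b)) (at a)" if "h differentiable (at (p a b))" for h a b
    using has_vector_derivative_horizontal[of h "z + \<i> * complex_of_real b" a UNIV] that
    by (simp add: p_alt has_real_derivative_iff_has_vector_derivative)
  have Y: "((\<lambda>b. h (p a b)) has_real_derivative partial_y h (p a b)) (at b)" if "h differentiable (at (p a b))" for h a b
    using has_vector_derivative_vertical[of h "z + complex_of_real a" b UNIV] that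
    by (simp add: p_def has_real_derivative_iff_has_vector_derivative)
  define D where "D = f (p s s) - f (p 0 s) - (f (p s 0) - f (p 0 0))"
  have "\<exists>a. 0 < a \<and> a < s \<and> (f (p s s) - f (p s 0)) - (f (p 0 s) - f (p 0 0)) = (s - 0) * (partial_x f (p a s) - partial_x f (p a 0))"
    by (rule MVT2) (use s in \<open>auto intro!: derivative_eq_intros X d0 in_S\<close>)
  then obtain a where a: "0 < a" "a < s" "D = s * (partial_x f (p a s) - partial_x f (p a 0))" by (auto simp: D_def)
  have "\<exists>b. 0 < b \<and> b < s \<and> partial_x f (p a s) - partial_x f (p a 0) = (s - 0) * partial_y (partial_x f) (p a b)"
    by (rule MVT2) (use s a in \<open>auto intro!: Y dx in_S\<close>)
  then obtain b where b: "0 < b" "b < s" "D = s * s * partial_y (partial_x f) (p a b)" using a by auto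
  have "\<exists>b. 0 < b \<and> b < s \<and> (f (p s s) - f (p 0 s)) - (f (p s 0) - f (p 0 0)) = (s - 0) * (partial_y f (p s b) - partial_y f (p 0 b))"
    by (rule MVT2) (use s in \<open>auto intro!: derivative_eq_intros Y d0 in_S\<close>)
  then obtain b' where b': "0 < b'" "b' < s" "D = s * (partial_y f (p s b') - partial_y f (p 0 b'))" by (auto simp: D_def)
  have "\<exists>a. 0 < a \<and> a < s \<and> partial_y f (p s b') - partial_y f (p 0 b') = (s - 0) * partial_x (partial_y f) (p a b')"
    by (rule MVT2) (use s b' in \<open>auto intro!: X dy in_S\<close>)
  then obtain a' where a': "0 < a'" "a' < s" "D = s * s * partial_x (partial_y f) (p a' b')" using b' by auto
  have "partial_y (partial_x f) (p a b) = partial_x (partial_y f) (p a' b')" using a'(3) b(3) s by simp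
  moreover have "dist (partial_y (partial_x f) (p a b)) (partial_y (partial_x f) z) < e"
    using near[OF near'[of a b]] a b by (simp add: p_def)
  moreover have "dist (partial_x (partial_y f) (p a' b')) (partial_x (partial_y f) z) < e"
    using near[OF near'[of a' b']] a' b' by (simp add: p_def)
  ultimately have "dist (partial_y (partial_x f) z) (partial_x (partial_y f) z) < 2 * e"
    by (metis dist_commute dist_triangle_less_add mult_2)
  then show False by (simp add: e_def dist_real_def)
qed

lemma (in bounded_linear) partials_bounded_linear:
  assumes "g differentiable (at z)"
  shows "partial_x (\<lambda>z. f (g z)) z = f (partial_x g z)" "partial_y (\<lambda>z. f (g z)) z = f (partial_y g z)"
proof -
  have "((\<lambda>z. f (g z)) has_derivative (\<lambda>h. Re h *\<^sub>R f (partial_x g z) + Im h *\<^sub>R f (partial_y g z))) (at z)"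
    using has_derivative[OF has_derivative_partials[OF assms]] by (simp add: add scaleR)
  from partial_derivativesI(2,3)[OF this]
  show "partial_x (\<lambda>z. f (g z)) z = f (partial_x g z)" "partial_y (\<lambda>z. f (g z)) z = f (partial_y g z)" by auto
qed

lemma (in bounded_linear) second_partials_bounded_linear:
  assumes S: "open S" "z \<in> S" and g: "C_k_on 2 S g"
  shows "partial_x (partial_x (\<lambda>z. f (g z))) z = f (partial_x (partial_x g) z)"
    "partial_y (partial_x (\<lambda>z. f (g z))) z = f (partial_y (partial_x g) z)"
    "partial_x (partial_y (\<lambda>z. f (g z))) z = f (partial_x (partial_y g) z)"
    "partial_y (partial_y (\<lambda>z. f (g z))) z = f (partial_y (partial_y g) z)"
proof -
  have d0: "g differentiable (at w)" and dx: "partial_x g differentiable (at w)"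
    and dy: "partial_y g differentiable (at w)" if "w \<in> S" for w
    using g that differentiable_on_openD[OF _ S(1)] by (auto simp: numeral_2_eq_2)
  have c: "partial_x (partial_x (\<lambda>z. f (g z))) z = partial_x (\<lambda>w. f (partial_x g w)) z"
    "partial_y (partial_x (\<lambda>z. f (g z))) z = partial_y (\<lambda>w. f (partial_x g w)) z"
    "partial_x (partial_y (\<lambda>z. f (g z))) z = partial_x (\<lambda>w. f (partial_y g w)) z"
    "partial_y (partial_y (\<lambda>z. f (g z))) z = partial_y (\<lambda>w. f (partial_y g w)) z"
    using partials_bounded_linear[OF d0] by (intro partials_cong[OF S]; simp)+
  show "partial_x (partial_x (\<lambda>z. f (g z))) z = f (partial_x (partial_x g) z)"
    "partial_y (partial_x (\<lambda>z. f (g z))) z = f (partial_y (partial_x g) z)"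
    "partial_x (partial_y (\<lambda>z. f (g z))) z = f (partial_x (partial_y g) z)"
    "partial_y (partial_y (\<lambda>z. f (g z))) z = f (partial_y (partial_y g) z)"
    using partials_bounded_linear[OF dx[OF S(2)]] partials_bounded_linear[OF dy[OF S(2)]] by (simp_all add: c)
qed

lemma flat_laplacian_bounded_linear:
  assumes "bounded_linear f" "open S" "z \<in> S" "C_k_on 2 S g"
  shows "flat_laplacian (\<lambda>z. f (g z)) z = f (flat_laplacian g z)"
  using bounded_linear.second_partials_bounded_linear[OF assms]
  by (simp add: flat_laplacian_def bounded_linear.linear[OF assms(1)] linear_add)

section \<open>Solutions on a strip\<close>

text \<open>The derivatives are parameters, so that the reflected sum
  \<open>u x t + u (- x) t\<close> can be interpreted with explicit derivatives in
  \<open>averaged_bound\<close>. The weight \<open>q\<close> is a function of \<open>x\<close>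
  alone, which the integration over a period exploits.\<close>

locale periodic_helmholtz =
  fixes u ux uxx ut utt :: "real \<Rightarrow> real \<Rightarrow> real" and q :: "real \<Rightarrow> real" and e L \<mu> :: real
  assumes e_pos: "e > 0" and L_pos: "L > 0" and mu_nonneg: "\<mu> \<ge> 0"
    and ux: "\<bar>x\<bar> < e \<Longrightarrow> ((\<lambda>x. u x t) has_real_derivative ux x t) (at x)"
    and uxx: "\<bar>x\<bar> < e \<Longrightarrow> ((\<lambda>x. ux x t) has_real_derivative uxx x t) (at x)"
    and ut: "\<bar>x\<bar> < e \<Longrightarrow> ((\<lambda>t. u x t) has_real_derivative ut x t) (at t)"
    and utt: "\<bar>x\<bar> < e \<Longrightarrow> ((\<lambda>t. ut x t) has_real_derivative utt x t) (at t)"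
    and cont_u: "continuous_on ({-e<..<e} \<times> UNIV) (\<lambda>(x,t). u x t)"
    and cont_ux: "continuous_on ({-e<..<e} \<times> UNIV) (\<lambda>(x,t). ux x t)"
    and cont_uxx: "continuous_on ({-e<..<e} \<times> UNIV) (\<lambda>(x,t). uxx x t)"
    and period_u: "\<bar>x\<bar> < e \<Longrightarrow> u x (t + L) = u x t"
    and period_ut: "\<bar>x\<bar> < e \<Longrightarrow> ut x (t + L) = ut x t"
    and helmholtz: "\<bar>x\<bar> < e \<Longrightarrow> uxx x t + utt x t = - \<mu> * q x * u x t"
begin

definition N :: "real \<Rightarrow> real" where "N x = integral {0..L} (\<lambda>t. (u x t)\<^sup>2)"

lemma continuous_compose_u:
  assumes "continuous_on S f" "continuous_on S g" "\<And>p. p \<in> S \<Longrightarrow> \<bar>f p\<bar> < e"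
  shows "continuous_on S (\<lambda>p. u (f p) (g p))" "continuous_on S (\<lambda>p. ux (f p) (g p))"
    "continuous_on S (\<lambda>p. uxx (f p) (g p))"
proof -
  have i: "(\<lambda>p. (f p, g p)) ` S \<subseteq> {-e<..<e} \<times> UNIV" using assms(3) by (fastforce simp: abs_less_iff)
  have c: "continuous_on S (\<lambda>p. (f p, g p))" using assms by (intro continuous_intros)
  show "continuous_on S (\<lambda>p. u (f p) (g p))" "continuous_on S (\<lambda>p. ux (f p) (g p))"
    "continuous_on S (\<lambda>p. uxx (f p) (g p))"
    using continuous_on_compose2[OF cont_u c i] continuous_on_compose2[OF cont_ux c i]
      continuous_on_compose2[OF cont_uxx c i] by auto
qed

lemma continuous_N: "continuous_on {-e<..<e} N"
proof -
  have "continuous_on {-e<..<e} (\<lambda>x. integral (cbox 0 L) (\<lambda>t. (u x t)\<^sup>2))"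
    by (rule integral_continuous_on_param)
      (auto simp: case_prod_unfold intro!: continuous_intros continuous_compose_u)
  then show ?thesis unfolding N_def[abs_def] by simp
qed

lemma N_nonneg: "N x \<ge> 0"
  unfolding N_def by (cases "(\<lambda>t. (u x t)\<^sup>2) integrable_on {0..L}")
    (auto intro: integral_nonneg simp: not_integrable_integral)

definition B :: "real \<Rightarrow> real \<Rightarrow> real" where "B x y = integral {0..L} (\<lambda>t. u x t * u y t)"

lemma integrable_product:
  assumes "\<bar>x\<bar> < e" "\<bar>y\<bar> < e" shows "(\<lambda>t. u x t * u y t) integrable_on {0..L}"
  by (intro integrable_continuous_real continuous_intros continuous_compose_u) (use assms in auto)

lemma B_bound:
  assumes "\<bar>x\<bar> < e" "\<bar>y\<bar> < e" shows "2 * \<bar>B x y\<bar> \<le> N x + N y"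
proof -
  have I: "(\<lambda>t. ((u x t)\<^sup>2 + (u y t)\<^sup>2) / 2) integrable_on {0..L}"
    by (intro integrable_continuous_real continuous_intros continuous_compose_u) (use assms in auto)
  have "norm (B x y) \<le> integral {0..L} (\<lambda>t. ((u x t)\<^sup>2 + (u y t)\<^sup>2) / 2)"
    unfolding B_def
  proof (rule integral_norm_bound_integral[OF integrable_product[OF assms] I])
    fix t
    show "norm (u x t * u y t) \<le> ((u x t)\<^sup>2 + (u y t)\<^sup>2) / 2"
      using sum_squares_bound[of "\<bar>u x t\<bar>" "\<bar>u y t\<bar>"] by (simp add: abs_mult)
  qed
  also have "\<dots> = (N x + N y) / 2"
    unfolding N_def using integrable_product[of x x] integrable_product[of y y] assms
    by (simp add: integral_add power2_eq_square)
  finally show ?thesis by simp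
qed

text \<open>The product \<open>c \<xi> \<eta> = u(\<xi> + \<eta>) u(\<xi> - \<eta>)\<close> has mixed derivative
  \<open>u\<^sub>x\<^sub>x(\<xi> + \<eta>) u(\<xi> - \<eta>) - u(\<xi> + \<eta>) u\<^sub>x\<^sub>x(\<xi> - \<eta>)\<close>. By the equation its \<open>u\<^sub>t\<^sub>t\<close>-part is a
  \<open>t\<close>-derivative, which integrates to zero over a period.\<close>

lemma integral_wronskian:
  assumes "\<bar>x\<bar> < e" "\<bar>y\<bar> < e"
  shows "integral {0..L} (\<lambda>t. uxx x t * u y t - u x t * uxx y t) = - \<mu> * (q x - q y) * B x y"
proof -
  define W where "W t = ut x t * u y t - u x t * ut y t" for t
  have "((\<lambda>t. utt x t * u y t - u x t * utt y t) has_integral (W L - W 0)) {0..L}"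
  proof (rule fundamental_theorem_of_calculus)
    fix t assume "t \<in> {0..L}"
    have "(W has_real_derivative utt x t * u y t - u x t * utt y t) (at t)"
      unfolding W_def using assms by (auto intro!: derivative_eq_intros ut utt simp: algebra_simps)
    then show "(W has_vector_derivative utt x t * u y t - u x t * utt y t) (at t within {0..L})"
      by (simp add: has_real_derivative_iff_has_vector_derivative has_vector_derivative_at_within)
  qed (use L_pos in simp)
  moreover have "W L = W 0" unfolding W_def using period_u[of x 0] period_u[of y 0] period_ut[of x 0] period_ut[of y 0] assms by simp
  ultimately have T: "((\<lambda>t. utt x t * u y t - u x t * utt y t) has_integral 0) {0..L}" by simp
  have "((\<lambda>t. - \<mu> * (q x - q y) * (u x t * u y t)) has_integral - \<mu> * (q x - q y) * B x y) {0..L}"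
    unfolding B_def by (intro has_integral_mult_right integrable_integral integrable_product assms)
  note has_integral_diff[OF this T]
  then
  have D: "((\<lambda>t. - \<mu> * (q x - q y) * (u x t * u y t) - (utt x t * u y t - u x t * utt y t))
     has_integral - \<mu> * (q x - q y) * B x y) {0..L}" by simp
  have eq: "- \<mu> * (q x - q y) * (u x t * u y t) - (utt x t * u y t - u x t * utt y t)
      = uxx x t * u y t - u x t * uxx y t" for t
  proof -
    have *: "uxx x t = - \<mu> * q x * u x t - utt x t" "uxx y t = - \<mu> * q y * u y t - utt y t"
      using helmholtz[of x t] helmholtz[of y t] assms by linarith+
    show ?thesis unfolding * by (simp add: algebra_simps)
  qed
  show ?thesis by (rule integral_unique) (use D in \<open>simp only: eq\<close>)
qed

text \<open>\<open>x = \<xi> + \<eta>\<close> and \<open>y = \<xi> - \<eta>\<close> are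
  characteristic coordinates, in which the wave operator is a mixed derivative; integrating it over
  a square of side \<open>a\<close> leaves the values of \<open>B\<close> at the four corners. By
  evenness of \<open>u\<close> these are \<open>B (2 * a) 0\<close>, twice \<open>N a\<close>, and
  \<open>N 0\<close>. Estimating \<open>B (2 * a) 0\<close> by half of
  \<open>N (2 * a) + N 0\<close> costs half of \<open>N 0\<close> on the left-hand side, and
  doubling yields the coefficients 4, 1 and 2.\<close>

lemma parallelogram_bound:
  assumes a: "0 < a" "2 * a < e"
    and even: "\<And>x t. \<bar>x\<bar> < e \<Longrightarrow> u (- x) t = u x t"
    and K: "\<And>x y. \<bar>x\<bar> \<le> 2 * a \<Longrightarrow> \<bar>y\<bar> \<le> 2 * a \<Longrightarrow> \<bar>q x - q y\<bar> \<le> K"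
  shows "N 0 \<le> 4 * N a + N (2 * a) + 2 * \<mu> * K * a * integral {-2*a..2*a} N"
proof -
  define I where "I = integral {-2*a..2*a} N"
  define c where "c \<xi> \<eta> t = u (\<xi> + \<eta>) t * u (\<xi> - \<eta>) t" for \<xi> \<eta> t
  define c1 where "c1 \<xi> \<eta> t = ux (\<xi> + \<eta>) t * u (\<xi> - \<eta>) t + u (\<xi> + \<eta>) t * ux (\<xi> - \<eta>) t" for \<xi> \<eta> t
  define c12 where "c12 \<xi> \<eta> t = uxx (\<xi> + \<eta>) t * u (\<xi> - \<eta>) t - u (\<xi> + \<eta>) t * uxx (\<xi> - \<eta>) t" for \<xi> \<eta> t
  define P where "P \<xi> \<eta> = integral {0..L} (c12 \<xi> \<eta>)" for \<xi> \<eta>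
  have small: "\<bar>\<xi> + \<eta>\<bar> < e" "\<bar>\<xi> - \<eta>\<bar> < e" if "0 \<le> \<xi>" "\<xi> \<le> a" "0 \<le> \<eta>" "\<eta> \<le> a" for \<xi> \<eta>
    using that a by auto
  have plus: "((\<lambda>r. u (s + r) t) has_real_derivative ux (s + r) t) (at r)"
      "((\<lambda>r. ux (s + r) t) has_real_derivative uxx (s + r) t) (at r)" if "\<bar>s + r\<bar> < e" for s r t
  proof -
    have D: "((\<lambda>r. s + r) has_real_derivative 1) (at r)" by (auto intro!: derivative_eq_intros)
    show "((\<lambda>r. u (s + r) t) has_real_derivative  ux (s + r) t) (at r)"
      "((\<lambda>r. ux (s + r) t) has_real_derivative  uxx (s + r) t) (at r)"
      using DERIV_chain2[where f = "\<lambda>x. u x t", OF ux[OF that] D] DERIV_chain2[where f = "\<lambda>x. ux x t", OF uxx[OF that] D] by simp_all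
  qed
  have minus: "((\<lambda>r. u (s - r) t) has_real_derivative - ux (s - r) t) (at r)"
      "((\<lambda>r. ux (s - r) t) has_real_derivative - uxx (s - r) t) (at r)" if "\<bar>s - r\<bar> < e" for s r t
  proof -
    have D: "((\<lambda>r. s - r) has_real_derivative - 1) (at r)" by (auto intro!: derivative_eq_intros)
    show "((\<lambda>r. u (s - r) t) has_real_derivative - ux (s - r) t) (at r)"
      "((\<lambda>r. ux (s - r) t) has_real_derivative - uxx (s - r) t) (at r)"
      using DERIV_chain2[where f = "\<lambda>x. u x t", OF ux[OF that] D] DERIV_chain2[where f = "\<lambda>x. ux x t", OF uxx[OF that] D] by simp_all
  qed
  have c_deriv: "((\<lambda>\<xi>. c \<xi> \<eta> t) has_real_derivative c1 \<xi> \<eta> t) (at \<xi>)" if "0 \<le> \<xi>" "\<xi> \<le> a" "0 \<le> \<eta>" "\<eta> \<le> a" for \<xi> \<eta> t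
  proof -
    have "((\<lambda>\<xi>. u (\<eta> + \<xi>) t * u (- \<eta> + \<xi>) t) has_real_derivative
        ux (\<eta> + \<xi>) t * u (- \<eta> + \<xi>) t + ux (- \<eta> + \<xi>) t * u (\<eta> + \<xi>) t) (at \<xi>)"
      by (intro DERIV_mult plus) (use small[OF that] in auto)
    then show ?thesis by (simp add: c_def c1_def algebra_simps)
  qed
  have c1_deriv: "((\<lambda>\<eta>. c1 \<xi> \<eta> t) has_real_derivative c12 \<xi> \<eta> t) (at \<eta>)" if "0 \<le> \<xi>" "\<xi> \<le> a" "0 \<le> \<eta>" "\<eta> \<le> a" for \<xi> \<eta> t
  proof -
    have "((\<lambda>\<eta>. c1 \<xi> \<eta> t) has_real_derivative
       (uxx (\<xi> + \<eta>) t * u (\<xi> - \<eta>) t + - ux (\<xi> - \<eta>) t * ux (\<xi> + \<eta>) t) +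
       (ux (\<xi> + \<eta>) t * ux (\<xi> - \<eta>) t + - uxx (\<xi> - \<eta>) t * u (\<xi> + \<eta>) t)) (at \<eta>)"
      unfolding c1_def by (intro DERIV_add DERIV_mult plus minus) (use small[OF that] in auto)
    then show ?thesis by (simp add: c12_def algebra_simps)
  qed
  define G where "G t \<xi> = c1 \<xi> a t - c1 \<xi> 0 t" for t \<xi>
  have G: "G t \<xi> = integral {0..a} (\<lambda>\<eta>. c12 \<xi> \<eta> t)" if "0 \<le> \<xi>" "\<xi> \<le> a" for t \<xi>
  proof -
    have "((\<lambda>\<eta>. c12 \<xi> \<eta> t) has_integral (c1 \<xi> a t - c1 \<xi> 0 t)) {0..a}"
      by (rule fundamental_theorem_of_calculus)
        (use a that c1_deriv in \<open>auto simp: has_real_derivative_iff_has_vector_derivative[symmetric] intro: has_field_derivative_at_within\<close>)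
    then show ?thesis by (simp add: G_def integral_unique)
  qed
  have G': "c a \<eta> t - c 0 \<eta> t = integral {0..a} (\<lambda>\<xi>. c1 \<xi> \<eta> t) \<and> (\<lambda>\<xi>. c1 \<xi> \<eta> t) integrable_on {0..a}"
    if "0 \<le> \<eta>" "\<eta> \<le> a" for \<eta> t
  proof -
    have "((\<lambda>\<xi>. c1 \<xi> \<eta> t) has_integral (c a \<eta> t - c 0 \<eta> t)) {0..a}"
      by (rule fundamental_theorem_of_calculus)
        (use a that c_deriv in \<open>auto simp: has_real_derivative_iff_has_vector_derivative[symmetric] intro: has_field_derivative_at_within\<close>)
    then show ?thesis by (auto simp: integral_unique)
  qed
  have contG: "continuous_on (cbox (0, 0) (L, a)) (\<lambda>(t, \<xi>). G t \<xi>)"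
    unfolding G_def c1_def case_prod_unfold
    by (intro continuous_intros continuous_compose_u) (use a in auto)
  have contc: "continuous_on (cbox (0, 0) (L, a)) (\<lambda>(t, \<eta>). c12 \<xi> \<eta> t)" if "0 \<le> \<xi>" "\<xi> \<le> a" for \<xi>
    unfolding c12_def case_prod_unfold
    by (intro continuous_intros continuous_compose_u) (use a that in auto)
  \<comment> \<open>The fundamental theorem of calculus acts at fixed \<open>t\<close>, while
    \<open>integral_wronskian\<close> needs the integral over \<open>t\<close> innermost. Hence two
    exchanges of integrals, one for \<open>\<xi>\<close> and one for \<open>\<eta>\<close>.\<close>
  have E1: "integral {0..L} (\<lambda>t. c a a t - c 0 a t - (c a 0 t - c 0 0 t)) = integral {0..L} (\<lambda>t. integral {0..a} (G t))"
  proof (rule integral_cong)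
    fix t
    show "c a a t - c 0 a t - (c a 0 t - c 0 0 t) = integral {0..a} (G t)"
      using G'[of a t] G'[of 0 t] a unfolding G_def by (simp add: integral_diff)
  qed
  also have "\<dots> = integral {0..a} (\<lambda>\<xi>. integral {0..L} (\<lambda>t. G t \<xi>))"
    using integral_swap_continuous[OF contG] by simp
  also have "\<dots> = integral {0..a} (\<lambda>\<xi>. integral {0..L} (\<lambda>t. integral {0..a} (\<lambda>\<eta>. c12 \<xi> \<eta> t)))"
    using G by (auto intro!: integral_cong)
  also have "\<dots> = integral {0..a} (\<lambda>\<xi>. integral {0..a} (P \<xi>))"
  proof (rule integral_cong)
    fix \<xi> assume "\<xi> \<in> {0..a}"
    then show "integral {0..L} (\<lambda>t. integral {0..a} (\<lambda>\<eta>. c12 \<xi> \<eta> t)) = integral {0..a} (P \<xi>)"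
      using integral_swap_continuous[OF contc[of \<xi>]] by (simp add: P_def[abs_def])
  qed
  finally have E: "integral {0..L} (\<lambda>t. c a a t - c 0 a t - (c a 0 t - c 0 0 t)) = integral {0..a} (\<lambda>\<xi>. integral {0..a} (P \<xi>))" .
  have intN: "N integrable_on {x..y}" if "- 2 * a \<le> x" "y \<le> 2 * a" for x y
    by (rule integrable_continuous_real, rule continuous_on_subset[OF continuous_N]) (use that a in auto)
  have subI: "integral {x..y} N \<le> I" if "- 2 * a \<le> x" "y \<le> 2 * a" for x y
    unfolding I_def by (rule integral_subset_le) (use that N_nonneg intN in auto)
  have I0: "I \<ge> 0" unfolding I_def by (rule integral_nonneg) (use intN N_nonneg in auto)
  have K0: "K \<ge> 0" using K[of 0 0] a by simp
  have Pb: "\<bar>P \<xi> \<eta>\<bar> \<le> \<mu> * K / 2 * (N (\<xi> + \<eta>) + N (\<xi> - \<eta>))" if "0 \<le> \<xi>" "\<xi> \<le> a" "0 \<le> \<eta>" "\<eta> \<le> a" for \<xi> \<eta>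
  proof -
    have "P \<xi> \<eta> = - \<mu> * (q (\<xi> + \<eta>) - q (\<xi> - \<eta>)) * B (\<xi> + \<eta>) (\<xi> - \<eta>)"
      unfolding P_def c12_def[abs_def] by (rule integral_wronskian[OF small[OF that]])
    then have "\<bar>P \<xi> \<eta>\<bar> = \<mu> * \<bar>q (\<xi> + \<eta>) - q (\<xi> - \<eta>)\<bar> * \<bar>B (\<xi> + \<eta>) (\<xi> - \<eta>)\<bar>"
      using mu_nonneg by (simp add: abs_mult)
    also have "\<dots> \<le> \<mu> * K * ((N (\<xi> + \<eta>) + N (\<xi> - \<eta>)) / 2)"
      using B_bound[OF small[OF that]] K[of "\<xi> + \<eta>" "\<xi> - \<eta>"] that mu_nonneg K0
      by (intro mult_mono mult_nonneg_nonneg) auto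
    finally show ?thesis by simp
  qed
  \<comment> \<open>For fixed \<open>\<xi>\<close> the points \<open>\<xi> + \<eta>\<close> and
    \<open>\<xi> - \<eta>\<close> each run through an interval of length \<open>a\<close> inside
    \<open>{-2*a..2*a}\<close>, so each of the two terms \<open>N\<close> in \<open>Pb\<close>
    integrates to at most \<open>I\<close>.\<close>
  have inner: "\<bar>integral {0..a} (P \<xi>)\<bar> \<le> \<mu> * K * I" if \<xi>: "0 \<le> \<xi>" "\<xi> \<le> a" for \<xi>
  proof -
    have Pint: "P \<xi> integrable_on {0..a}"
    proof -
      have "continuous_on (cbox (0, 0) (a, L)) (\<lambda>p. c12 \<xi> (fst p) (snd p))"
        unfolding c12_def by (intro continuous_intros continuous_compose_u) (use a \<xi> in auto)
      from integral_integrable_2dim[OF this] show ?thesis by (simp add: P_def[abs_def])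
    qed
    have p: "(\<lambda>\<eta>. N (\<xi> + \<eta>)) integrable_on {0..a}" "(\<lambda>\<eta>. N (\<xi> - \<eta>)) integrable_on {0..a}"
      by (rule integrable_continuous_real, rule continuous_on_compose2[OF continuous_N];
          use a \<xi> in \<open>auto intro!: continuous_intros\<close>)+
    have p1: "integral {0..a} (\<lambda>\<eta>. N (\<xi> + \<eta>)) = integral {\<xi>..\<xi> + a} N"
      using integral_shift_Icc_real[of 0 a N \<xi>] by (simp add: o_def add.commute)
    have p2: "integral {0..a} (\<lambda>\<eta>. N (\<xi> - \<eta>)) = integral {\<xi> - a..\<xi>} N"
      using integral_shift_Icc_real[of "- a" 0 N \<xi>] Henstock_Kurzweil_Integration.integral_reflect_real[of 0 "- a" "N \<circ> (+) \<xi>"]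
      by (simp add: o_def algebra_simps)
    have "norm (integral {0..a} (P \<xi>)) \<le> integral {0..a} (\<lambda>\<eta>. \<mu> * K / 2 * (N (\<xi> + \<eta>) + N (\<xi> - \<eta>)))"
      by (rule integral_norm_bound_integral) (use Pint p Pb \<xi> in \<open>auto intro!: integrable_on_mult_right integrable_add\<close>)
    also have "\<dots> = \<mu> * K / 2 * (integral {\<xi>..\<xi> + a} N + integral {\<xi> - a..\<xi>} N)"
      using p by (simp add: integral_add p1 p2)
    also have "\<dots> \<le> \<mu> * K / 2 * (I + I)"
      using subI \<xi> a mu_nonneg K0 by (intro mult_left_mono add_mono) auto
    finally show ?thesis by simp
  qed
  have "\<bar>integral {0..a} (\<lambda>\<xi>. integral {0..a} (P \<xi>))\<bar> \<le> \<mu> * K * I * a"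
  proof -
    have "(\<lambda>\<xi>. integral {0..L} (\<lambda>t. G t \<xi>)) integrable_on {0..a}"
    proof -
      have "continuous_on (cbox (0, 0) (a, L)) (\<lambda>p. G (snd p) (fst p))"
        unfolding G_def c1_def by (intro continuous_intros continuous_compose_u) (use a in auto)
      from integral_integrable_2dim[OF this] show ?thesis by simp
    qed
    moreover have "integral {0..L} (\<lambda>t. G t \<xi>) = integral {0..a} (P \<xi>)" if "\<xi> \<in> {0..a}" for \<xi>
    proof -
      have "integral {0..L} (\<lambda>t. G t \<xi>) = integral {0..L} (\<lambda>t. integral {0..a} (\<lambda>\<eta>. c12 \<xi> \<eta> t))"
        using G that by (auto intro!: integral_cong)
      also have "\<dots> = integral {0..a} (P \<xi>)"
        using integral_swap_continuous[OF contc[of \<xi>]] that by (simp add: P_def[abs_def])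
      finally show ?thesis .
    qed
    ultimately have "(\<lambda>\<xi>. integral {0..a} (P \<xi>)) integrable_on {0..a}"
      by (rule integrable_eq)
    from integral_norm_bound_integral[OF this integrable_const_ivl, of "\<mu> * K * I"] inner a
    show ?thesis by (simp add: algebra_simps)
  qed
  moreover have "integral {0..L} (\<lambda>t. c a a t - c 0 a t - (c a 0 t - c 0 0 t)) = B (2 * a) 0 - 2 * N a + N 0"
  proof -
    have "c a a t - c 0 a t - (c a 0 t - c 0 0 t) = u (2 * a) t * u 0 t - u a t * u a t - (u a t * u a t - u 0 t * u 0 t)" for t
      using even[of a t] a by (simp add: c_def)
    moreover have i: "((\<lambda>t. u x t * u y t) has_integral B x y) {0..L}" if "\<bar>x\<bar> < e" "\<bar>y\<bar> < e" for x y
      unfolding B_def by (intro integrable_integral integrable_product that)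
    moreover have "B x x = N x" for x by (simp add: B_def N_def power2_eq_square)
    ultimately show ?thesis
      using integral_unique[OF has_integral_diff[OF has_integral_diff[OF i[of "2 * a" 0] i[of a a]] has_integral_diff[OF i[of a a] i[of 0 0]]]] a
      by simp
  qed
  moreover have "2 * \<bar>B (2 * a) 0\<bar> \<le> N (2 * a) + N 0" using B_bound[of "2 * a" 0] a by simp
  ultimately have "N 0 \<le> 4 * N a + N (2 * a) + 2 * (\<mu> * K * I * a)" using E by linarith
  then show ?thesis by (simp add: I_def mult.assoc mult.left_commute mult.commute)
qed

text \<open>At a single \<open>a\<close> the right-hand side of \<open>parallelogram_bound\<close>
  contains pointwise values of \<open>N\<close>, over which there is no control; averaging over
  \<open>a\<close> in \<open>{0..h}\<close> turns them into integrals. The factor 5 is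
  \<open>4 + 1/2\<close> rounded up, the half coming from the dilation of \<open>a\<close> to
  \<open>2 * a\<close>.\<close>

lemma even_averaged_bound:
  assumes h: "0 < h" "2 * h < e"
    and even: "\<And>x t. \<bar>x\<bar> < e \<Longrightarrow> u (- x) t = u x t"
    and K: "\<And>x y. \<bar>x\<bar> \<le> 2 * h \<Longrightarrow> \<bar>y\<bar> \<le> 2 * h \<Longrightarrow> \<bar>q x - q y\<bar> \<le> K"
  shows "h * N 0 \<le> (5 + 2 * \<mu> * K * h\<^sup>2) * integral {-2*h..2*h} N"
proof -
  define I where "I = integral {-2*h..2*h} N"
  have K0: "K \<ge> 0" using K[of 0 0] h by simp
  have intN: "N integrable_on {x..y}" if "- 2 * h \<le> x" "y \<le> 2 * h" for x y
    by (rule integrable_continuous_real, rule continuous_on_subset[OF continuous_N]) (use that h in auto)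
  have subI: "integral {x..y} N \<le> I" if "- 2 * h \<le> x" "y \<le> 2 * h" for x y
    unfolding I_def by (rule integral_subset_le) (use that N_nonneg intN in auto)
  have I0: "I \<ge> 0" unfolding I_def by (rule integral_nonneg) (use intN N_nonneg in auto)
  have pw: "N 0 \<le> 4 * N a + N (2 * a) + 2 * \<mu> * K * h * I" if "a \<in> {0..h}" for a
  proof (cases "a = 0")
    \<comment> \<open>At \<open>a = 0\<close>, where \<open>parallelogram_bound\<close> does not
      apply, the right-hand side is \<open>5 * N 0\<close> plus a nonnegative term.\<close>
    case True
    then show ?thesis using I0 K0 h mu_nonneg N_nonneg[of 0] by simp
  next
    case False
    then have a: "0 < a" "a \<le> h" using that by auto
    have "N 0 \<le> 4 * N a + N (2 * a) + 2 * \<mu> * K * a * integral {-2*a..2*a} N"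
      by (rule parallelogram_bound) (use a h even K in auto)
    also have "2 * \<mu> * K * a * integral {-2*a..2*a} N \<le> 2 * \<mu> * K * h * I"
    proof -
      have "integral {-2*a..2*a} N \<ge> 0"
        by (rule integral_nonneg[OF intN]) (use a N_nonneg in auto)
      then have "a * integral {-2*a..2*a} N \<le> h * I"
        using a subI[of "-2*a" "2*a"] by (intro mult_mono) auto
      from mult_left_mono[OF this, of "2 * \<mu> * K"] show ?thesis
        using mu_nonneg K0 by (simp add: mult.assoc)
    qed
    finally show ?thesis by simp
  qed
  have dil: "((\<lambda>a. N (2 * a)) has_integral integral {0..2*h} N / 2) {0..h}"
    using has_integral_affinity'[where f = N and a = 0 and b = "2*h" and m = 2 and c = 0 and i = "integral {0..2*h} N"]
      integrable_integral[OF intN[of 0 "2*h"]] h by simp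
  have one: "((\<lambda>a. N a) has_integral integral {0..h} N) {0..h}"
    using integrable_integral[OF intN[of 0 h]] h by simp
  have "((\<lambda>a. 4 * N a + N (2 * a) + 2 * \<mu> * K * h * I) has_integral
     4 * integral {0..h} N + integral {0..2*h} N / 2 + h * (2 * \<mu> * K * h * I)) {0..h}"
    using has_integral_add[OF has_integral_add[OF has_integral_mult_right[OF one, of 4] dil] has_integral_const_real[of "2 * \<mu> * K * h * I" 0 h]] h
    by simp
  moreover have "((\<lambda>a. N 0) has_integral h * N 0) {0..h}"
    using has_integral_const_real[of "N 0" 0 h] h by simp
  ultimately have "h * N 0 \<le> 4 * integral {0..h} N + integral {0..2*h} N / 2 + h * (2 * \<mu> * K * h * I)"
    using has_integral_le pw by blast
  also have "\<dots> \<le> 4 * I + I + h * (2 * \<mu> * K * h * I)"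
    using subI[of 0 h] subI[of 0 "2*h"] I0 h by auto
  finally show ?thesis by (simp add: I_def algebra_simps power2_eq_square)
qed

text \<open>Since \<open>q\<close> is even, \<open>u x t + u (- x) t\<close> solves the same
  equation and is even. At \<open>x = 0\<close> it is twice \<open>u\<close>, which gives a factor 4
  on the left; \<open>(a + b)^2 \<le> 2 * (a^2 + b^2)\<close> and the reflection of the interval
  produce the same factor on the right.\<close>

lemma averaged_bound:
  assumes h: "0 < h" "2 * h < e"
    and even: "\<And>x. q (- x) = q x"
    and K: "\<And>x y. \<bar>x\<bar> \<le> 2 * h \<Longrightarrow> \<bar>y\<bar> \<le> 2 * h \<Longrightarrow> \<bar>q x - q y\<bar> \<le> K"
  shows "h * N 0 \<le> (5 + 2 * \<mu> * K * h\<^sup>2) * integral {-2*h..2*h} N"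
proof -
  have K0: "K \<ge> 0" using K[of 0 0] h by simp
  have refl: "((\<lambda>x. f (- x) t) has_real_derivative - f' (- x) t) (at x)"
    if "\<And>x. \<bar>x\<bar> < e \<Longrightarrow> ((\<lambda>x. f x t) has_real_derivative f' x t) (at x)" "\<bar>x\<bar> < e" for f f' :: "real \<Rightarrow> real \<Rightarrow> real" and x t
  proof -
    have D: "((\<lambda>x. - x) has_real_derivative - 1) (at x)" by (auto intro!: derivative_eq_intros)
    show ?thesis using DERIV_chain2[where f = "\<lambda>x. f x t", OF that(1)[of "- x"] D] that(2) by simp
  qed
  interpret v: periodic_helmholtz "\<lambda>x t. u x t + u (- x) t" "\<lambda>x t. ux x t - ux (- x) t" "\<lambda>x t. uxx x t + uxx (- x) t"
      "\<lambda>x t. ut x t + ut (- x) t" "\<lambda>x t. utt x t + utt (- x) t" q e L \<mu>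
  proof unfold_locales
    show "((\<lambda>x. u x t + u (- x) t) has_real_derivative ux x t - ux (- x) t) (at x)" if "\<bar>x\<bar> < e" for x t
      using DERIV_add[OF ux[OF that] refl[of u t ux, OF ux that]] by simp
    show "((\<lambda>x. ux x t - ux (- x) t) has_real_derivative uxx x t + uxx (- x) t) (at x)" if "\<bar>x\<bar> < e" for x t
      using DERIV_diff[OF uxx[OF that] refl[of ux t uxx, OF uxx that]] by simp
    show "uxx x t + uxx (- x) t + (utt x t + utt (- x) t) = - \<mu> * q x * (u x t + u (- x) t)" if "\<bar>x\<bar> < e" for x t
      using helmholtz[of x t] helmholtz[of "- x" t] that even[of x] by (simp add: algebra_simps)
  qed (use e_pos L_pos mu_nonneg in \<open>auto intro!: derivative_eq_intros ut utt continuous_intros continuous_compose_u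
        simp: period_u period_ut case_prod_unfold abs_less_iff\<close>)
  have "h * v.N 0 \<le> (5 + 2 * \<mu> * K * h\<^sup>2) * integral {-2*h..2*h} v.N"
    by (rule v.even_averaged_bound[OF h _ K]) auto
  moreover have "v.N 0 = 4 * N 0"
    unfolding v.N_def N_def by (simp add: integral_mult_right[symmetric] power2_eq_square algebra_simps del: integral_mult_right)
  moreover have "integral {-2*h..2*h} v.N \<le> 4 * integral {-2*h..2*h} N"
  proof -
    have intN: "N integrable_on {-2*h..2*h}"
      by (rule integrable_continuous_real, rule continuous_on_subset[OF continuous_N]) (use h in auto)
    have intv: "v.N integrable_on {-2*h..2*h}"
      by (rule integrable_continuous_real, rule continuous_on_subset[OF v.continuous_N]) (use h in auto)
    have intN': "(\<lambda>x. N (- x)) integrable_on {-2*h..2*h}" "integral {-2*h..2*h} (\<lambda>x. N (- x)) = integral {-2*h..2*h} N"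
      using Henstock_Kurzweil_Integration.integrable_reflect_real[of N "2*h" "-2*h"] intN
        Henstock_Kurzweil_Integration.integral_reflect_real[of "2*h" "-2*h" N] by auto
    have "v.N x \<le> 2 * (N x + N (- x))" if "x \<in> {-2*h..2*h}" for x
    proof -
      have x: "\<bar>x\<bar> < e" "\<bar>- x\<bar> < e" using that h by auto
      have i: "(\<lambda>t. (u x t)\<^sup>2) integrable_on {0..L}" "(\<lambda>t. (u (- x) t)\<^sup>2) integrable_on {0..L}"
        using integrable_product[OF x(1) x(1)] integrable_product[OF x(2) x(2)] by (simp_all add: power2_eq_square)
      have "v.N x \<le> integral {0..L} (\<lambda>t. 2 * ((u x t)\<^sup>2 + (u (- x) t)\<^sup>2))"
        unfolding v.N_def
      proof (rule integral_le)
        show "(\<lambda>t. (u x t + u (- x) t)\<^sup>2) integrable_on {0..L}"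
          using v.integrable_product[OF x(1) x(1)] by (simp add: power2_eq_square)
        show "(\<lambda>t. 2 * ((u x t)\<^sup>2 + (u (- x) t)\<^sup>2)) integrable_on {0..L}"
          by (intro integrable_on_mult_right integrable_add i)
        fix t show "(u x t + u (- x) t)\<^sup>2 \<le> 2 * ((u x t)\<^sup>2 + (u (- x) t)\<^sup>2)"
          using sum_squares_bound[of "u x t" "u (- x) t"] by (simp add: power2_sum)
      qed
      also have "\<dots> = 2 * (N x + N (- x))"
        unfolding N_def using i by (simp add: integral_add)
      finally show ?thesis .
    qed
    then have "integral {-2*h..2*h} v.N \<le> integral {-2*h..2*h} (\<lambda>x. 2 * (N x + N (- x)))"
      by (intro integral_le intv integrable_on_mult_right integrable_add intN intN')
    also have "\<dots> = 4 * integral {-2*h..2*h} N"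
      using intN intN' by (simp add: integral_add)
    finally show ?thesis .
  qed
  then have "(5 + 2 * \<mu> * K * h\<^sup>2) * integral {-2*h..2*h} v.N \<le> (5 + 2 * \<mu> * K * h\<^sup>2) * (4 * integral {-2*h..2*h} N)"
    using mu_nonneg K0 by (intro mult_left_mono) auto
  ultimately have "h * (4 * N 0) \<le> (5 + 2 * \<mu> * K * h\<^sup>2) * (4 * integral {-2*h..2*h} N)"
    by simp
  then show ?thesis by (simp add: algebra_simps)
qed

end

text \<open>Both terms lie between 1 and \<open>1 + 16 * h^2\<close>: the excess over 1 is the
  square of the tangent, at most \<open>z^2 / cos^2 z\<close>, and \<open>2 * h \<le> 1\<close>
  forces \<open>cos z \<ge> 1/2\<close>.\<close>

lemma inverse_cos_square_oscillation:
  fixes x y h :: real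
  assumes "\<bar>x\<bar> \<le> 2 * h" "\<bar>y\<bar> \<le> 2 * h" "2 * h \<le> 1"
  shows "\<bar>1 / (cos x)\<^sup>2 - 1 / (cos y)\<^sup>2\<bar> \<le> 16 * h\<^sup>2"
proof -
  have "0 \<le> 1 / (cos z)\<^sup>2 - 1 \<and> 1 / (cos z)\<^sup>2 - 1 \<le> 16 * h\<^sup>2" if "\<bar>z\<bar> \<le> 2 * h" for z :: real
  proof -
    have z2: "z\<^sup>2 \<le> 4 * h\<^sup>2" using power_mono[OF that, of 2] by (simp add: power_mult_distrib)
    have h2: "4 * h\<^sup>2 \<le> 1" using power_mono[of "2 * h" 1 2] assms that by (simp add: power_mult_distrib)
    \<comment> \<open>This prepares
      \<open>1 - cos z = 2 * sin^2 (z / 2) \<le> z^2 / 2\<close>.\<close>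
    have "(sin (z / 2))\<^sup>2 \<le> (z / 2)\<^sup>2" using abs_sin_x_le_abs_x[of "z / 2"] by (rule abs_le_square_iff[THEN iffD1])
    then have "1 - z\<^sup>2 / 2 \<le> cos z" using cos_double_sin[of "z / 2"] by (simp add: power_divide)
    then have c: "1 / 2 \<le> cos z" using z2 h2 by linarith
    then have c2: "1 / 4 \<le> (cos z)\<^sup>2" using power_mono[of "1/2" "cos z" 2] by (simp add: power2_eq_square)
    have "\<bar>sin z\<bar> \<le> \<bar>z\<bar>" by (rule abs_sin_x_le_abs_x)
    then have s: "(sin z)\<^sup>2 \<le> z\<^sup>2" by (rule abs_le_square_iff[THEN iffD1])
    have e: "1 / (cos z)\<^sup>2 - 1 = (sin z)\<^sup>2 / (cos z)\<^sup>2"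
      using c sin_cos_squared_add[of z] by (simp add: field_simps)
    have "(sin z)\<^sup>2 / (cos z)\<^sup>2 \<le> (4 * h\<^sup>2) / (1 / 4)"
      by (rule frac_le) (use s z2 c2 in auto)
    then show ?thesis unfolding e using c by simp
  qed
  from this[OF assms(1)] this[OF assms(2)] show ?thesis by linarith
qed

text \<open>The case \<open>q x = 1 / (cos x)^2\<close> of \<open>averaged_bound\<close>; the
  oscillation \<open>K = 16 * h^2\<close> turns \<open>2 * \<mu> * K * h^2\<close> into
  \<open>32 * \<mu> * h^4\<close>.\<close>

lemma strip_restriction_bound:
  fixes u :: "complex \<Rightarrow> real"
  assumes h: "0 < h" "2 * h < e" "2 * h \<le> 1" and L: "0 < L" and \<mu>: "0 \<le> \<mu>"
    and u: "C_k_on 2 {w. \<bar>Re w\<bar> < e} u"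
    and period: "\<And>w. \<bar>Re w\<bar> < e \<Longrightarrow> u (w + \<i> * complex_of_real L) = u w"
    and eq: "\<And>w. \<bar>Re w\<bar> < e \<Longrightarrow> flat_laplacian u w = - \<mu> * (1 / (cos (Re w))\<^sup>2) * u w"
  shows "h * integral {0..L} (\<lambda>t. (u (Complex 0 t))\<^sup>2) \<le>
    (5 + 32 * \<mu> * h ^ 4) * integral {-2*h..2*h} (\<lambda>x. integral {0..L} (\<lambda>t. (u (Complex x t))\<^sup>2))"
proof -
  define S where "S = {w. \<bar>Re w\<bar> < e}"
  have S: "open S" unfolding S_def by (intro open_Collect_less continuous_intros)
  have d0: "u differentiable (at w)" and dx: "partial_x u differentiable (at w)"
    and dy: "partial_y u differentiable (at w)" if "w \<in> S" for w
    using u that differentiable_on_openD[OF _ S] by (auto simp: numeral_2_eq_2 S_def)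
  have cont: "continuous_on S u" "continuous_on S (partial_x u)" "continuous_on S (partial_x (partial_x u))"
    using u differentiable_imp_continuous_on by (auto simp: numeral_2_eq_2 S_def)
  have CX: "Complex x t = \<i> * complex_of_real t + complex_of_real x" "Complex x t = complex_of_real x + \<i> * complex_of_real t" for x t
    by (simp_all add: complex_eq_iff)
  have inS: "\<i> * complex_of_real t + complex_of_real x \<in> S" "complex_of_real x + \<i> * complex_of_real t \<in> S" if "\<bar>x\<bar> < e" for x t
    using that by (simp_all add: S_def)
  have X: "((\<lambda>x. f (Complex x t)) has_real_derivative partial_x f (Complex x t)) (at x)"
    if "\<bar>x\<bar> < e" "\<And>w. w \<in> S \<Longrightarrow> f differentiable (at w)" for f x t
    unfolding CX(1) has_real_derivative_iff_has_vector_derivative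
    by (rule has_vector_derivative_horizontal[OF that(2)[OF inS(1)[OF that(1)]]])
  have Y: "((\<lambda>t. f (Complex x t)) has_real_derivative partial_y f (Complex x t)) (at t)"
    if "\<bar>x\<bar> < e" "\<And>w. w \<in> S \<Longrightarrow> f differentiable (at w)" for f x t
    unfolding CX(2) has_real_derivative_iff_has_vector_derivative
    by (rule has_vector_derivative_vertical[OF that(2)[OF inS(2)[OF that(1)]]])
  have C: "continuous_on ({-e<..<e} \<times> UNIV) (\<lambda>(x,t). f (Complex x t))" if "continuous_on S f" for f :: "complex \<Rightarrow> real"
    unfolding case_prod_unfold
    by (rule continuous_on_compose2[OF that]) (auto simp: S_def intro!: continuous_intros)
  have pu: "u (Complex x (t + L)) = u (Complex x t)" if "\<bar>x\<bar> < e" for x t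
    using period[of "Complex x t"] that by (simp add: CX(2) algebra_simps)
  interpret periodic_helmholtz "\<lambda>x t. u (Complex x t)" "\<lambda>x t. partial_x u (Complex x t)" "\<lambda>x t. partial_x (partial_x u) (Complex x t)"
      "\<lambda>x t. partial_y u (Complex x t)" "\<lambda>x t. partial_y (partial_y u) (Complex x t)" "\<lambda>x. 1 / (cos x)\<^sup>2" e L \<mu>
  proof unfold_locales
    \<comment> \<open>Periodicity of the \<open>t\<close>-derivative is inherited from
      \<open>u\<close> by uniqueness of derivatives.\<close>
    show "partial_y u (Complex x (t + L)) = partial_y u (Complex x t)" if x: "\<bar>x\<bar> < e" for x t
    proof -
      have "((\<lambda>t. u (Complex x (t + L))) has_real_derivative partial_y u (Complex x (t + L))) (at t)"
        using Y[OF x d0, of "t + L"] by (simp add: DERIV_shift)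
      then show ?thesis unfolding pu[OF x] using DERIV_unique Y[OF x d0] by blast
    qed
    show "partial_x (partial_x u) (Complex x t) + partial_y (partial_y u) (Complex x t) = - \<mu> * (1 / (cos x)\<^sup>2) * u (Complex x t)"
      if "\<bar>x\<bar> < e" for x t
      using eq[of "Complex x t"] that by (simp add: flat_laplacian_def)
  qed (use h L \<mu> in \<open>auto intro!: X Y C cont d0 dx dy pu\<close>)
  have "h * N 0 \<le> (5 + 2 * \<mu> * (16 * h\<^sup>2) * h\<^sup>2) * integral {-2*h..2*h} N"
    using h by (intro averaged_bound inverse_cos_square_oscillation) auto
  moreover have "2 * \<mu> * (16 * h\<^sup>2) * h\<^sup>2 = 32 * \<mu> * h ^ 4" by (simp add: power4_eq_xxxx power2_eq_square)
  ultimately show ?thesis unfolding N_def[abs_def] by (simp only:)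
qed

section \<open>Area of holomorphic images\<close>

text \<open>The Jacobian change of variables is applied on \<open>real^2\<close>, where maps have
  matrices and determinants; \<open>cvec\<close> and \<open>cval\<close> are the mutually inverse
  identifications with the complex plane.\<close>

definition cvec :: "complex \<Rightarrow> real^2" where "cvec z = (\<chi> i. if i = 1 then Re z else Im z)"

definition cval :: "real^2 \<Rightarrow> complex" where "cval v = Complex (v $ 1) (v $ 2)"

lemma cval_cvec [simp]: "cval (cvec z) = z"
  by (simp add: cval_def cvec_def)

lemma cvec_cval [simp]: "cvec (cval v) = v"
  by (simp add: cval_def cvec_def vec_eq_iff forall_2)

lemma bounded_linear_cvec: "bounded_linear cvec"
  by (rule linear_conv_bounded_linear[THEN iffD1], rule linearI) (auto simp: cvec_def vec_eq_iff)

lemma bounded_linear_cval: "bounded_linear cval"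
  by (rule linear_conv_bounded_linear[THEN iffD1], rule linearI) (auto simp: cval_def complex_eq_iff)

lemma continuous_cval: "continuous_on T cval"
  using bounded_linear_cval linear_continuous_on by blast

lemma measurable_cval [measurable]: "cval \<in> borel_measurable borel"
  using continuous_cval borel_measurable_continuous_onI by blast

lemma lborel_distr_cval: "distr lborel borel cval = lborel"
proof (rule lborel_eqI[symmetric])
  fix l u :: complex assume le: "\<And>b. b \<in> Basis \<Longrightarrow> l \<bullet> b \<le> u \<bullet> b"
  have le': "Re l \<le> Re u" "Im l \<le> Im u" using le[of 1] le[of \<i>] by (auto simp: Basis_complex_def)
  have "cval -` box l u = box (cvec l) (cvec u)"
    by (auto simp: box_def Basis_complex_def cval_def cvec_def Basis_vec_def inner_axis forall_2)
  moreover have "emeasure lborel (box (cvec l) (cvec u)) = (\<Prod>b\<in>Basis. (cvec u - cvec l) \<bullet> b)"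
    using le' by (intro emeasure_lborel_box) (auto simp: cvec_def Basis_vec_def inner_axis)
  moreover have "(\<Prod>b\<in>Basis. (cvec u - cvec l) \<bullet> b) = (\<Prod>b\<in>Basis. (u - l) \<bullet> b)"
  proof -
    have "(Basis :: (real^2) set) = {axis 1 1, axis 2 1}" by (auto simp: Basis_vec_def UNIV_2)
    moreover have "axis 1 1 \<noteq> (axis 2 1 :: real^2)" by (simp add: axis_eq_axis)
    ultimately have "(\<Prod>b\<in>Basis. (cvec u - cvec l) \<bullet> b) = (cvec u - cvec l) \<bullet> axis 1 1 * ((cvec u - cvec l) \<bullet> axis 2 1)"
      by (metis (no_types, lifting) empty_iff finite.emptyI finite_insert insert_iff mult.right_neutral prod.empty prod.insert)
    also have "\<dots> = (\<Prod>b\<in>Basis. (u - l) \<bullet> b)" by (simp add: Basis_complex_def inner_axis cvec_def)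
    finally show ?thesis .
  qed
  ultimately show "emeasure (distr lborel borel cval) (box l u) = (\<Prod>b\<in>Basis. (u - l) \<bullet> b)"
    by (subst emeasure_distr) auto
qed simp

lemma det_complex_multiplication: "det (matrix (\<lambda>v. cvec (c * cval v))) = (cmod c)\<^sup>2"
  unfolding det_2 matrix_def cmod_power2 by (simp add: cvec_def cval_def axis_def power2_eq_square)

text \<open>Change of variables for sets, the Jacobian being that of multiplication by
  \<open>deriv F z\<close>. The equivalence in \<open>key\<close> speaks of finite measure and a
  real value \<open>m\<close>; it also settles the infinite case, because a finite integral would
  give the image finite measure.\<close>

lemma emeasure_holomorphic_image:
  assumes S: "S \<in> sets borel" "S \<subseteq> U" and U: "open U" and F: "F holomorphic_on U" and inj: "inj_on F S"
    and FS: "F ` S \<in> sets borel"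
  shows "emeasure lborel (F ` S) = (\<integral>\<^sup>+z\<in>S. ennreal ((cmod (deriv F z))\<^sup>2) \<partial>lborel)"
proof -
  define G where "G v = cvec (F (cval v))" for v
  define J where "J z = (cmod (deriv F z))\<^sup>2" for z
  define S' where "S' = cval -` S"
  have S': "S' \<in> sets borel" using measurable_sets[OF measurable_cval S(1)] by (simp add: S'_def)
  have GS: "G ` S' = cval -` (F ` S)"
    unfolding S'_def G_def by (auto simp: image_iff) (metis cval_cvec cvec_cval vimageI)+
  have GS': "G ` S' \<in> sets borel" unfolding GS using measurable_sets[OF measurable_cval FS] by simp
  have injG: "inj_on G S'"
    using inj unfolding S'_def G_def inj_on_def by (metis cval_cvec cvec_cval vimageD)
  have derG: "(G has_derivative (\<lambda>v. cvec (deriv F (cval x) * cval v))) (at x within S')" if "x \<in> S'" for x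
  proof -
    have "(F has_derivative (\<lambda>h. deriv F (cval x) * h)) (at (cval x))"
      using holomorphic_derivI[OF F U] that S(2) by (auto simp: S'_def has_field_derivative_def)
    from has_derivative_compose[OF bounded_linear.has_derivative[OF bounded_linear_cval has_derivative_ident] this]
    show ?thesis unfolding G_def
      by (rule bounded_linear.has_derivative[OF bounded_linear_cvec])
  qed
  have J_meas: "(\<lambda>z. J z * indicator S z) \<in> borel_measurable borel"
  proof -
    have "deriv F holomorphic_on U" using F U by (rule holomorphic_deriv)
    then have "continuous_on S J" unfolding J_def
      by (intro continuous_intros) (meson S(2) holomorphic_on_imp_continuous_on continuous_on_subset)
    then have "(\<lambda>z. indicator S z *\<^sub>R J z) \<in> borel_measurable borel"
      by (rule borel_measurable_continuous_on_indicator[OF S(1)])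
    then show ?thesis by (simp add: mult.commute)
  qed
  have key: "G ` S' \<in> lmeasurable \<and> measure lebesgue (G ` S') = m \<longleftrightarrow>
      ((\<lambda>x. J (cval x)) has_integral m) S'" for m
    using has_measure_differentiable_image[of S' G "\<lambda>x v. cvec (deriv F (cval x) * cval v)" m] S' derG injG
    by (simp add: det_complex_multiplication J_def)
  have integ: "((\<lambda>x. J (cval x)) has_integral m) S' \<longleftrightarrow>
      (\<integral>\<^sup>+x. ennreal (J (cval x) * indicator S (cval x)) \<partial>lborel) = ennreal m" if "m \<ge> 0" for m
  proof -
    have "((\<lambda>x. J (cval x)) has_integral m) S' \<longleftrightarrow> ((\<lambda>x. J (cval x) * indicator S (cval x)) has_integral m) UNIV"
      by (subst has_integral_restrict_UNIV[symmetric]) (rule arg_cong[where f = "\<lambda>f. (f has_integral m) UNIV"], auto simp: S'_def indicator_def)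
    also have "\<dots> \<longleftrightarrow> (\<integral>\<^sup>+x. ennreal (J (cval x) * indicator S (cval x)) \<partial>lborel) = ennreal m"
    proof -
      have m: "(\<lambda>x. J (cval x) * indicator S (cval x)) \<in> borel_measurable lborel"
        using measurable_compose[OF measurable_cval J_meas] by simp
      show ?thesis
        by (subst has_integral_iff_nn_integral_lebesgue)
          (use that measurable_completion[OF m] in \<open>auto simp: J_def nn_integral_completion\<close>)
    qed
    finally show ?thesis .
  qed
  have L: "(\<integral>\<^sup>+x. ennreal (J (cval x) * indicator S (cval x)) \<partial>lborel) = (\<integral>\<^sup>+z\<in>S. ennreal (J z) \<partial>lborel)"
  proof -
    have "(\<integral>\<^sup>+z. ennreal (J z * indicator S z) \<partial>lborel) = (\<integral>\<^sup>+x. ennreal (J (cval x) * indicator S (cval x)) \<partial>lborel)"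
      using J_meas by (subst lborel_distr_cval[symmetric]) (simp add: nn_integral_distr)
    moreover have "(\<integral>\<^sup>+z. ennreal (J z * indicator S z) \<partial>lborel) = (\<integral>\<^sup>+z\<in>S. ennreal (J z) \<partial>lborel)"
      by (intro nn_integral_cong) (auto simp: indicator_def)
    ultimately show ?thesis by simp
  qed
  have R: "emeasure lborel (F ` S) = emeasure lborel (G ` S')"
    unfolding GS using FS by (subst lborel_distr_cval[symmetric]) (simp add: emeasure_distr)
  show ?thesis
  proof (cases "emeasure lborel (F ` S) = \<infinity>")
    case False
    then have "G ` S' \<in> lmeasurable" using GS' R by (auto simp: fmeasurable_def less_top)
    then have "((\<lambda>x. J (cval x)) has_integral measure lebesgue (G ` S')) S'"
      using key by blast
    then have I: "(\<integral>\<^sup>+z\<in>S. ennreal (J z) \<partial>lborel) = ennreal (measure lebesgue (G ` S'))"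
      using integ[of "measure lebesgue (G ` S')"] L by simp
    have "emeasure lborel (G ` S') = ennreal (measure lborel (G ` S'))"
      using False R by (intro emeasure_eq_ennreal_measure) auto
    also have "measure lborel (G ` S') = measure lebesgue (G ` S')"
      using GS' by simp
    finally show ?thesis using R I by (simp add: J_def)
  next
    case True
    have "(\<integral>\<^sup>+z\<in>S. ennreal (J z) \<partial>lborel) = \<infinity>"
    proof (rule ccontr)
      assume "\<not> ?thesis"
      then obtain m where m: "m \<ge> 0" "(\<integral>\<^sup>+z\<in>S. ennreal (J z) \<partial>lborel) = ennreal m"
        by (cases "\<integral>\<^sup>+z\<in>S. ennreal (J z) \<partial>lborel" rule: ennreal_cases) auto
      then have "((\<lambda>x. J (cval x)) has_integral m) S'" using integ[of m] L by simp
      then have "G ` S' \<in> lmeasurable" using key by blast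
      then show False using True R GS' by (simp add: fmeasurable_def)
    qed
    then show ?thesis using True by (simp add: J_def)
  qed
qed

text \<open>Lebesgue measure on the image of \<open>U\<close> is the push-forward of the measure
  with density \<open>J\<close>. The preceding lemma checks this on Borel sets; integrating
  \<open>h\<close> against both measures gives the formula.\<close>

lemma nn_integral_holomorphic_image:
  assumes U: "open U" and F: "F holomorphic_on U" and inj: "inj_on F U" and h: "h \<in> borel_measurable borel"
  shows "(\<integral>\<^sup>+w\<in>F ` U. h w \<partial>lborel) = (\<integral>\<^sup>+z\<in>U. ennreal ((cmod (deriv F z))\<^sup>2) * h (F z) \<partial>lborel)"
proof -
  \<comment> \<open>Not a derivative: \<open>F'\<close> is \<open>F\<close> extended by 0 outside
    \<open>U\<close>, which makes it a Borel function on the whole plane.\<close>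
  define F' where "F' z = (if z \<in> U then F z else 0)" for z
  define J where "J z = ennreal ((cmod (deriv F z))\<^sup>2) * indicator U z" for z
  have oF: "open (F ` U)" using open_mapping_thm3[OF F U inj] .
  have contF: "continuous_on U F" using F holomorphic_on_imp_continuous_on by blast
  have F'm: "F' \<in> borel_measurable borel"
    unfolding F'_def using U contF by (intro borel_measurable_continuous_on_if) auto
  have Jm: "J \<in> borel_measurable borel"
  proof -
    have "deriv F holomorphic_on U" using F U by (rule holomorphic_deriv)
    then have "continuous_on U (\<lambda>z. (cmod (deriv F z))\<^sup>2)"
      by (intro continuous_intros holomorphic_on_imp_continuous_on)
    then have "(\<lambda>z. indicator U z *\<^sub>R (cmod (deriv F z))\<^sup>2) \<in> borel_measurable borel"
      by (rule borel_measurable_continuous_on_indicator[OF borel_open[OF U]])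
    from measurable_compose[OF this measurable_ennreal]
    have "(\<lambda>z. ennreal (indicator U z *\<^sub>R (cmod (deriv F z))\<^sup>2)) \<in> borel_measurable borel" .
    also have "(\<lambda>z. ennreal (indicator U z *\<^sub>R (cmod (deriv F z))\<^sup>2)) = J"
      by (auto simp: J_def indicator_def)
    finally show ?thesis .
  qed
  have "density lborel (indicator (F ` U)) = distr (density lborel J) borel F'"
  proof (rule measure_eqI)
    fix E :: "complex set" assume "E \<in> sets (density lborel (indicator (F ` U)))"
    then have E: "E \<in> sets borel" by simp
    define S where "S = U \<inter> F' -` E"
    have FE: "F' -` E \<in> sets borel" using measurable_sets[OF F'm E] by simp
    have S: "S \<in> sets borel" "S \<subseteq> U" unfolding S_def using FE U by auto
    have FS: "F ` S = E \<inter> F ` U" by (auto simp: S_def F'_def)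
    have "emeasure (density lborel (indicator (F ` U))) E = emeasure lborel (F ` S)"
      unfolding FS using E oF by (subst emeasure_density) (auto simp: nn_integral_indicator[symmetric] indicator_inter_arith[symmetric] mult.commute simp del: nn_integral_indicator)
    also have "\<dots> = (\<integral>\<^sup>+z\<in>S. ennreal ((cmod (deriv F z))\<^sup>2) \<partial>lborel)"
      by (rule emeasure_holomorphic_image[OF S U F inj_on_subset[OF inj S(2)]]) (use FS E oF in auto)
    also have "\<dots> = (\<integral>\<^sup>+z. J z * indicator (F' -` E) z \<partial>lborel)"
      by (intro nn_integral_cong) (auto simp: J_def S_def indicator_def)
    also have "\<dots> = emeasure (distr (density lborel J) borel F') E"
      using E F'm Jm FE by (simp add: emeasure_distr emeasure_density)
    finally show "emeasure (density lborel (indicator (F ` U))) E = emeasure (distr (density lborel J) borel F') E" .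
  qed simp
  then have "(\<integral>\<^sup>+w. h w \<partial>density lborel (indicator (F ` U))) = (\<integral>\<^sup>+w. h w \<partial>distr (density lborel J) borel F')" by simp
  moreover have "(\<integral>\<^sup>+w. h w \<partial>density lborel (indicator (F ` U))) = (\<integral>\<^sup>+w\<in>F ` U. h w \<partial>lborel)"
    using h oF by (subst nn_integral_density) (auto simp: mult.commute)
  moreover have "(\<integral>\<^sup>+w. h w \<partial>distr (density lborel J) borel F') = (\<integral>\<^sup>+z. J z * h (F' z) \<partial>lborel)"
    using h F'm Jm by (simp add: nn_integral_distr nn_integral_density)
  moreover have "(\<integral>\<^sup>+z. J z * h (F' z) \<partial>lborel) = (\<integral>\<^sup>+z\<in>U. ennreal ((cmod (deriv F z))\<^sup>2) * h (F z) \<partial>lborel)"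
    by (intro nn_integral_cong) (auto simp: J_def F'_def indicator_def)
  ultimately show ?thesis by simp
qed

section \<open>Normal form of a metric of curvature -1\<close>

locale hyperbolic_metric =
  fixes \<rho> :: "complex \<Rightarrow> real" and U :: "complex set"
  assumes open_U: "open U" and smooth: "C_k_on 3 U \<rho>"
    and pos: "z \<in> U \<Longrightarrow> \<rho> z > 0"
    and curvature: "z \<in> U \<Longrightarrow> gauss_curvature \<rho> z = -1"
begin

text \<open>For the reciprocal the curvature equation becomes quadratic, with no logarithm left, and
  the equation for \<open>g_zz\<close> becomes linear.\<close>

definition g :: "complex \<Rightarrow> real" where "g z = inverse (\<rho> z)"

abbreviation "gx \<equiv> partial_x g"
abbreviation "gy \<equiv> partial_y g"
abbreviation "gxx \<equiv> partial_x gx"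
abbreviation "gxy \<equiv> partial_y gx"
abbreviation "gyy \<equiv> partial_y gy"

lemma g_pos: "z \<in> U \<Longrightarrow> g z > 0"
  using pos by (simp add: g_def)

lemma smooth_g: "C_k_on 3 U g"
  unfolding g_def[abs_def] using pos by (intro C_k_on_inverse open_U smooth) force

lemma g_differentiable:
  assumes "z \<in> U"
  shows "g differentiable (at z)" "gx differentiable (at z)" "gy differentiable (at z)"
    "gxx differentiable (at z)" "gxy differentiable (at z)" "gyy differentiable (at z)"
  using smooth_g unfolding numeral_3_eq_3 C_k_on.simps
  by (auto intro!: differentiable_on_openD[OF _ open_U assms])

lemma g_mixed: "z \<in> U \<Longrightarrow> partial_x gy z = gxy z"
  using mixed_partials_real[OF open_U _ C_k_on_mono[OF smooth_g]] by simp

lemma g_third_mixed: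
  assumes "z \<in> U"
  shows "partial_x gxy z = partial_y gxx z" "partial_y gxy z = partial_x gyy z"
proof -
  have c: "C_k_on 2 U gx" "C_k_on 2 U gy"
    using smooth_g by (simp_all add: numeral_3_eq_3 numeral_2_eq_2)
  show "partial_x gxy z = partial_y gxx z"
    using mixed_partials_real[OF open_U assms c(1)] by simp
  have "partial_y gxy z = partial_y (partial_x gy) z"
    by (rule partials_cong(2)[OF open_U assms]) (simp add: g_mixed)
  then show "partial_y gxy z = partial_x gyy z"
    using mixed_partials_real[OF open_U assms c(2)] by simp
qed

lemma has_derivative_g:
  assumes "z \<in> U"
  shows "(g has_derivative (\<lambda>h. Re h * gx z + Im h * gy z)) (at z)"
    "(gx has_derivative (\<lambda>h. Re h * gxx z + Im h * gxy z)) (at z)"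
    "(gy has_derivative (\<lambda>h. Re h * gxy z + Im h * gyy z)) (at z)"
    "(gxx has_derivative (\<lambda>h. Re h * partial_x gxx z + Im h * partial_y gxx z)) (at z)"
    "(gxy has_derivative (\<lambda>h. Re h * partial_y gxx z + Im h * partial_x gyy z)) (at z)"
    "(gyy has_derivative (\<lambda>h. Re h * partial_x gyy z + Im h * partial_y gyy z)) (at z)"
  using g_differentiable[OF assms, THEN has_derivative_partials] g_mixed[OF assms] g_third_mixed[OF assms]
  by simp_all

text \<open>Since \<open>ln \<rho> = - ln g\<close>, the flat Laplacian of \<open>ln \<rho>\<close>
  is \<open>|grad g|^2 / g^2 - (gxx + gyy) / g\<close>, and curvature -1 says that it equals
  \<open>\<rho>^2 = 1 / g^2\<close>.\<close>

lemma curvature_equation: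
  assumes "z \<in> U"
  shows "g z * (gxx z + gyy z) = (gx z)\<^sup>2 + (gy z)\<^sup>2 - 1"
proof -
  let ?l = "\<lambda>w. ln (\<rho> w)"
  have l: "(?l has_derivative (\<lambda>h. Re h *\<^sub>R (- gx w / g w) + Im h *\<^sub>R (- gy w / g w))) (at w)" if w: "w \<in> U" for w
  proof -
    have "((\<lambda>w. - ln (g w)) has_derivative (\<lambda>h. Re h *\<^sub>R (- gx w / g w) + Im h *\<^sub>R (- gy w / g w))) (at w)"
      using has_derivative_g(1)[OF w] g_pos[OF w] by (auto intro!: derivative_eq_intros simp: field_simps)
    then show ?thesis
      by (rule has_derivative_transform_within_open[OF _ open_U w]) (use pos in \<open>simp add: g_def ln_inverse\<close>)
  qed
  note L = partial_derivativesI[OF l]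
  have "((\<lambda>w. - gx w / g w) has_derivative (\<lambda>h. Re h *\<^sub>R ((gx z)\<^sup>2 / (g z)\<^sup>2 - gxx z / g z)
       + Im h *\<^sub>R (gx z * gy z / (g z)\<^sup>2 - gxy z / g z))) (at z)"
    using has_derivative_g(1,2)[OF assms] g_pos[OF assms]
    by (auto intro!: derivative_eq_intros simp: field_simps power2_eq_square)
  note X = partial_derivativesI(2)[OF this]
  have "((\<lambda>w. - gy w / g w) has_derivative (\<lambda>h. Re h *\<^sub>R (gx z * gy z / (g z)\<^sup>2 - gxy z / g z)
       + Im h *\<^sub>R ((gy z)\<^sup>2 / (g z)\<^sup>2 - gyy z / g z))) (at z)"
    using has_derivative_g(1,3)[OF assms] g_pos[OF assms]
    by (auto intro!: derivative_eq_intros simp: field_simps power2_eq_square)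
  note Y = partial_derivativesI(3)[OF this]
  have xx: "partial_x (partial_x ?l) z = partial_x (\<lambda>w. - gx w / g w) z"
    by (rule partials_cong(1)[OF open_U assms L(2)])
  have yy: "partial_y (partial_y ?l) z = partial_y (\<lambda>w. - gy w / g w) z"
    by (rule partials_cong(2)[OF open_U assms L(3)])
  have "flat_laplacian ?l z = ((gx z)\<^sup>2 + (gy z)\<^sup>2) / (g z)\<^sup>2 - (gxx z + gyy z) / g z"
    unfolding flat_laplacian_def xx yy X Y by (simp add: add_divide_distrib)
  moreover have "flat_laplacian ?l z = 1 / (g z)\<^sup>2"
    using curvature[OF assms] pos[OF assms] by (simp add: gauss_curvature_def g_def field_simps)
  moreover have "a / (g z)\<^sup>2 - b / g z = (a - g z * b) / (g z)\<^sup>2" for a b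
    using g_pos[OF assms] by (simp add: field_simps power2_eq_square)
  ultimately have "((gx z)\<^sup>2 + (gy z)\<^sup>2 - g z * (gxx z + gyy z)) / (g z)\<^sup>2 = 1 / (g z)\<^sup>2" by simp
  then have "(gx z)\<^sup>2 + (gy z)\<^sup>2 - g z * (gxx z + gyy z) = 1" using g_pos[OF assms] by simp
  then show ?thesis by simp
qed

text \<open>In complex notation \<open>m = 4 g\<^sub>z\<^sub>z\<close>, so that \<open>g\<^sub>z\<^sub>z = - T g\<close>.\<close>

definition m :: "complex \<Rightarrow> complex" where "m z = Complex (gxx z - gyy z) (- 2 * gxy z)"

definition T :: "complex \<Rightarrow> complex" where "T z = - m z / (4 * complex_of_real (g z))"

text \<open>Apply \<open>d/dz\<close> to the curvature equation in the form
  \<open>4 g g_zz' = 4 g_z g_z' - 1\<close>, with \<open>z'\<close> the conjugate variable. The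
  terms \<open>4 g_z g_zz'\<close> cancel and \<open>g g_zzz' = g_zz g_z'\<close> remains; the
  statement is 8 times this identity.\<close>

lemma curvature_equation_derivative:
  assumes "z \<in> U"
  shows "complex_of_real (g z) * Complex (partial_x gxx z + partial_x gyy z) (- (partial_y gxx z + partial_y gyy z))
    = m z * Complex (gx z) (gy z)"
proof -
  \<comment> \<open>\<open>k\<close> is constantly -1 on \<open>U\<close>. The directions
    \<open>h = 1\<close> and \<open>h = \<i>\<close> of its zero derivative give the real and the
    imaginary part of the claim.\<close>
  define k where "k w = g w * (gxx w + gyy w) - ((gx w)\<^sup>2 + (gy w)\<^sup>2)" for w
  have "(k has_derivative (\<lambda>h. 0)) (at z)"
    by (rule has_derivative_transform_within_open[OF has_derivative_const open_U assms, of "-1"])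
      (use curvature_equation in \<open>simp add: k_def\<close>)
  moreover have "(k has_derivative (\<lambda>h. (Re h * gx z + Im h * gy z) * (gxx z + gyy z)
       + g z * ((Re h * partial_x gxx z + Im h * partial_y gxx z) + (Re h * partial_x gyy z + Im h * partial_y gyy z))
       - (2 * gx z * (Re h * gxx z + Im h * gxy z) + 2 * gy z * (Re h * gxy z + Im h * gyy z)))) (at z)"
    unfolding k_def using has_derivative_g[OF assms]
    by (auto intro!: derivative_eq_intros simp: algebra_simps)
  ultimately have e: "(Re h * gx z + Im h * gy z) * (gxx z + gyy z)
       + g z * ((Re h * partial_x gxx z + Im h * partial_y gxx z) + (Re h * partial_x gyy z + Im h * partial_y gyy z))
       - (2 * gx z * (Re h * gxx z + Im h * gxy z) + 2 * gy z * (Re h * gxy z + Im h * gyy z)) = 0" for h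
    using has_derivative_unique by (metis (no_types, lifting))
  show ?thesis using e[of 1] e[of \<i>] by (simp add: complex_eq_iff m_def algebra_simps)
qed

text \<open>The previous identity says that the derivative of \<open>g_zz / g\<close> with respect
  to the conjugate variable vanishes. Geometrically \<open>T\<close> is half the Schwarzian
  derivative of the quotient \<open>y1 / y2\<close> of solutions formed below, a coordinate in which
  the metric is the standard one of the disc.\<close>

lemma T_holomorphic: "T holomorphic_on U"
proof (rule holomorphic_onI)
  fix z assume z: "z \<in> U"
  define a where "a = Complex (partial_x gxx z - partial_x gyy z) (- 2 * partial_y gxx z)"
  define b where "b = Complex (partial_y gxx z - partial_y gyy z) (- 2 * partial_x gyy z)"
  let ?g = "complex_of_real (g z)"
  have m_eq: "m = (\<lambda>w. complex_of_real (gxx w - gyy w) + \<i> * complex_of_real (- 2 * gxy w))"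
    by (simp add: fun_eq_iff m_def complex_eq_iff)
  have dm: "(m has_derivative (\<lambda>h. Re h *\<^sub>R a + Im h *\<^sub>R b)) (at z)"
    unfolding m_eq using has_derivative_g[OF z]
    by (auto intro!: derivative_eq_intros simp: complex_eq_iff a_def b_def algebra_simps)
  have g0: "?g \<noteq> 0" using g_pos[OF z] by simp
  have dT: "(T has_derivative (\<lambda>h. - (Re h *\<^sub>R a + Im h *\<^sub>R b) / (4 * ?g)
      + m z * complex_of_real (Re h * gx z + Im h * gy z) / (4 * ?g\<^sup>2))) (at z)"
    unfolding T_def[abs_def] using dm has_derivative_g(1)[OF z] g0
    by (auto intro!: derivative_eq_intros simp: field_simps power2_eq_square)
  \<comment> \<open>\<open>a + \<i> * b\<close> is twice the derivative of \<open>m\<close> with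
    respect to the conjugate variable, so \<open>cr\<close> is the vanishing of the numerator in the
    quotient rule for \<open>m / g\<close>.\<close>
  have cr: "?g * (a + \<i> * b) = m z * (complex_of_real (gx z) + \<i> * complex_of_real (gy z))"
    using curvature_equation_derivative[OF z] by (simp add: a_def b_def complex_eq_iff algebra_simps)
  define c where "c = - a / (4 * ?g) + m z * complex_of_real (gx z) / (4 * ?g\<^sup>2)"
  have "- b / (4 * ?g) + m z * complex_of_real (gy z) / (4 * ?g\<^sup>2) = \<i> * c"
  proof -
    have "?g * b - m z * complex_of_real (gy z) = \<i> * (?g * a - m z * complex_of_real (gx z))"
      using cr by (simp add: algebra_simps complex_eq_iff)
    then have "- (?g * b - m z * complex_of_real (gy z)) / (4 * ?g\<^sup>2) = \<i> * (- (?g * a - m z * complex_of_real (gx z)) / (4 * ?g\<^sup>2))"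
      by (simp only: times_divide_eq_right mult_minus_right)
    then show ?thesis unfolding c_def using g0 by (simp add: field_simps power2_eq_square)
  qed
  then have "(\<lambda>h. - (Re h *\<^sub>R a + Im h *\<^sub>R b) / (4 * ?g)
      + m z * complex_of_real (Re h * gx z + Im h * gy z) / (4 * ?g\<^sup>2)) = (\<lambda>h. c * h)" (is "?l = ?r")
  proof -
    assume bc: "- b / (4 * ?g) + m z * complex_of_real (gy z) / (4 * ?g\<^sup>2) = \<i> * c"
    have "?l h = complex_of_real (Re h) * c + complex_of_real (Im h) * (- b / (4 * ?g) + m z * complex_of_real (gy z) / (4 * ?g\<^sup>2))" for h
      unfolding c_def by (simp add: scaleR_conv_of_real add_divide_distrib diff_divide_distrib algebra_simps)
    then have "?l h = (complex_of_real (Re h) + \<i> * complex_of_real (Im h)) * c" for h unfolding bc by (simp add: algebra_simps)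
    then show ?thesis by (simp add: fun_eq_iff complex_eq[symmetric] mult.commute)
  qed
  then have "(T has_field_derivative c) (at z)" using dT by (simp add: has_field_derivative_def)
  then show "T field_differentiable (at z within U)"
    using field_differentiable_at_within field_differentiable_def by blast
qed

end

section \<open>Power series solutions of \<open>y'' = - T y\<close>\<close>

fun ode_coeff :: "(nat \<Rightarrow> complex) \<Rightarrow> complex \<Rightarrow> complex \<Rightarrow> nat \<Rightarrow> complex" where
  "ode_coeff t a b 0 = a"
| "ode_coeff t a b (Suc 0) = b"
| "ode_coeff t a b (Suc (Suc n)) =
     - (\<Sum>k\<le>n. t k * ode_coeff t a b (n - k)) / (of_nat (n + 2) * of_nat (n + 1))"

text \<open>In the recursion the \<open>n + 1\<close> summands are paid for by the factor
  \<open>n + 1\<close> of the denominator, the other factor is bounded below by 1, and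
  \<open>M \<le> K^2\<close> supplies the two missing powers of \<open>K\<close>.\<close>

lemma ode_coeff_bound:
  assumes K: "1 \<le> K" "M \<le> K\<^sup>2" and t: "\<And>n. cmod (t n) \<le> M * K ^ n"
    and C: "cmod a \<le> C" "cmod b \<le> C"
  shows "cmod (ode_coeff t a b n) \<le> C * K ^ n"
proof (induction n rule: less_induct)
  case (less n)
  have C0: "C \<ge> 0" using C(1) norm_ge_zero[of a] by linarith
  have M0: "M \<ge> 0" using order_trans[OF norm_ge_zero t[of 0]] by simp
  consider "n = 0" | "n = 1" | m where "n = m + 2"
    by (cases n; cases "n - 1") auto
  then show ?case
  proof cases
    case 1
    then show ?thesis using C by simp
  next
    case 2
    have "C * 1 \<le> C * K" using C0 K by (intro mult_left_mono) auto
    then show ?thesis using C 2 by simp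
  next
    case 3
    have "cmod (\<Sum>k\<le>m. t k * ode_coeff t a b (m - k)) \<le> (\<Sum>k\<le>m. M * C * K ^ m)"
    proof (rule sum_norm_le)
      fix k assume k: "k \<in> {..m}"
      have "cmod (t k * ode_coeff t a b (m - k)) \<le> (M * K ^ k) * (C * K ^ (m - k))"
        unfolding norm_mult using t less[of "m - k"] 3 K M0 by (intro mult_mono) auto
      also have "\<dots> = M * C * K ^ m" using k by (simp add: power_add[symmetric] mult_ac)
      finally show "cmod (t k * ode_coeff t a b (m - k)) \<le> M * C * K ^ m" .
    qed
    also have "\<dots> = real (m + 1) * (M * C * K ^ m)" by simp
    finally have s: "cmod (\<Sum>k\<le>m. t k * ode_coeff t a b (m - k)) \<le> real (m + 1) * (M * C * K ^ m)" .
    have "ode_coeff t a b n = - (\<Sum>k\<le>m. t k * ode_coeff t a b (m - k)) / (of_nat (m + 2) * of_nat (m + 1))"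
      using 3 by simp
    then have "cmod (ode_coeff t a b n) = cmod (\<Sum>k\<le>m. t k * ode_coeff t a b (m - k)) / (real (m + 2) * real (m + 1))"
      by (simp only: norm_divide norm_minus_cancel norm_mult norm_of_nat)
    also have "\<dots> \<le> real (m + 1) * (M * C * K ^ m) / (real (m + 2) * real (m + 1))"
      using s by (intro divide_right_mono) auto
    also have "\<dots> = M * C * K ^ m / real (m + 2)"
      by (metis mult.commute mult_divide_mult_cancel_left of_nat_neq_0 add.commute plus_1_eq_Suc)
    also have "\<dots> \<le> M * C * K ^ m / 1" using M0 C0 K by (intro divide_left_mono) auto
    also have "\<dots> \<le> K\<^sup>2 * C * K ^ m / 1" using K C0 by (intro divide_right_mono mult_right_mono) auto
    also have "\<dots> = C * K ^ n" using 3 by (simp add: power_add power2_eq_square)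
    finally show ?thesis .
  qed
qed

text \<open>The coefficients of \<open>T\<close> grow at most geometrically because its series
  converges at some \<open>R > 0\<close>; then so do those of the formal solution, which therefore
  converges. The equation is checked between power series and transferred to the functions near 0.
  The three radii stand for the equation, the convergence and the inclusion in
  \<open>U\<close>.\<close>

lemma holomorphic_second_order_ode_0:
  assumes T: "T holomorphic_on U" "open U" "0 \<in> U"
  shows "\<exists>r>0. \<exists>y. ball 0 r \<subseteq> U \<and> y holomorphic_on ball 0 r \<and> y 0 = a \<and> deriv y 0 = b \<and>
    (\<forall>z\<in>ball 0 r. deriv (deriv y) z = - T z * y z)"
proof -
  define t where "t = fps_expansion T 0"
  have tT: "T has_fps_expansion t"
    unfolding t_def using T by (intro has_fps_expansion_fps_expansion) auto
  then obtain R where R: "0 < R" "ereal R < fps_conv_radius t"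
    using ereal_dense2[of 0 "fps_conv_radius t"] by (auto simp: has_fps_expansion_def zero_ereal_def)
  have "summable (\<lambda>n. fps_nth t n * complex_of_real R ^ n)"
    using R by (intro summable_fps) auto
  then have "Bseq (\<lambda>n. fps_nth t n * complex_of_real R ^ n)"
    using summable_imp_Bseq by blast
  then obtain M0 where M0: "M0 > 0" "\<And>n. cmod (fps_nth t n * complex_of_real R ^ n) \<le> M0"
    by (auto simp: Bseq_def)
  \<comment> \<open>\<open>1 / R\<close> governs the growth of the coefficients of \<open>T\<close>;
    being at least 1 and at least \<open>M0\<close>, \<open>K\<close> also satisfies
    \<open>M0 \<le> K^2\<close>, as \<open>ode_coeff_bound\<close> requires.\<close>
  define K where "K = Max {1, M0, 1 / R}"
  have K: "1 \<le> K" "M0 \<le> K" "1 / R \<le> K" unfolding K_def by auto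
  have K2: "M0 \<le> K\<^sup>2"
    using mult_left_mono[OF K(1), of K] K unfolding power2_eq_square by linarith
  have tb: "cmod (fps_nth t n) \<le> M0 * K ^ n" for n
  proof -
    have "cmod (fps_nth t n) = cmod (fps_nth t n * complex_of_real R ^ n) * (1 / R) ^ n"
      using R by (simp add: norm_mult norm_power power_divide)
    also have "\<dots> \<le> M0 * K ^ n"
      using M0 K R by (intro mult_mono power_mono) auto
    finally show ?thesis .
  qed
  define c where "c = Abs_fps (ode_coeff (fps_nth t) a b)"
  define C where "C = max (cmod a) (cmod b)"
  have cb: "cmod (fps_nth c n) \<le> C * K ^ n" for n
    unfolding c_def using ode_coeff_bound[OF K(1) K2 tb, of a C b] by (simp add: C_def)
  \<comment> \<open>At the point \<open>1 / (2 * K)\<close> the bound \<open>cb\<close> becomes a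
    geometric series of ratio \<open>1/2\<close>.\<close>
  have "ereal (cmod (complex_of_real (1 / (2 * K)))) \<le> conv_radius (fps_nth c)"
  proof (rule conv_radius_geI)
    show "summable (\<lambda>n. fps_nth c n * complex_of_real (1 / (2 * K)) ^ n)"
    proof (rule summable_comparison_test')
      show "summable (\<lambda>n. C * (1 / 2) ^ n)" by (intro summable_mult summable_geometric) auto
      show "norm (fps_nth c n * complex_of_real (1 / (2 * K)) ^ n) \<le> C * (1 / 2) ^ n" for n
      proof -
        have "norm (fps_nth c n * complex_of_real (1 / (2 * K)) ^ n) = cmod (fps_nth c n) * (1 / (2 * K)) ^ n"
          using K by (simp add: norm_mult norm_power norm_divide power_divide power_mult_distrib)
        also have "\<dots> \<le> C * K ^ n * (1 / (2 * K)) ^ n"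
          using cb K by (intro mult_right_mono) auto
        also have "\<dots> = C * (1 / 2) ^ n" using K by (simp add: power_divide power_mult_distrib)
        finally show ?thesis .
      qed
    qed
  qed
  moreover have "0 < ereal (cmod (complex_of_real (1 / (2 * K))))" using K by simp
  ultimately have rad: "fps_conv_radius c > 0" unfolding fps_conv_radius_def by (rule less_le_trans[rotated])
  define y where "y = eval_fps c"
  have y: "y has_fps_expansion c" using rad by (simp add: has_fps_expansion_def y_def)
  have y2: "deriv (deriv y) has_fps_expansion fps_deriv (fps_deriv c)"
    by (intro has_fps_expansion_deriv y)
  have Ty: "(\<lambda>z. - T z * y z) has_fps_expansion - t * c"
    by (intro fps_expansion_intros tT y)
  have eq: "fps_deriv (fps_deriv c) = - t * c"
  proof (rule fps_ext)
    fix n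
    have "fps_nth c (n + 2) = - (\<Sum>k\<le>n. fps_nth t k * fps_nth c (n - k)) / (of_nat (n + 2) * of_nat (n + 1))"
      unfolding c_def fps_nth_Abs_fps using ode_coeff.simps(3)[of _ a b n] by (simp only: add_2_eq_Suc')
    then have "of_nat (n + 2) * of_nat (n + 1) * fps_nth c (n + 2) = - (\<Sum>k\<le>n. fps_nth t k * fps_nth c (n - k))"
      by (simp del: of_nat_add of_nat_Suc)
    moreover have "fps_nth (- t * c) n = - (\<Sum>k\<le>n. fps_nth t k * fps_nth c (n - k))"
      by (simp add: fps_mult_nth sum_negf atMost_atLeast0)
    moreover have "fps_nth (fps_deriv (fps_deriv c)) n = of_nat (n + 2) * of_nat (n + 1) * fps_nth c (n + 2)"
      by (simp add: algebra_simps)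
    ultimately show "fps_nth (fps_deriv (fps_deriv c)) n = fps_nth (- t * c) n" by simp
  qed
  have "eventually (\<lambda>z. eval_fps (- t * c) z = deriv (deriv y) z) (nhds 0)"
    "eventually (\<lambda>z. eval_fps (- t * c) z = - T z * y z) (nhds 0)"
    using y2 Ty unfolding eq has_fps_expansion_def by auto
  then have "eventually (\<lambda>z. deriv (deriv y) z = - T z * y z) (nhds 0)"
    by eventually_elim simp
  then obtain r1 where r1: "r1 > 0" "\<And>z. dist z 0 < r1 \<Longrightarrow> deriv (deriv y) z = - T z * y z"
    unfolding eventually_nhds_metric by blast
  obtain r2 where r2: "r2 > 0" "ereal r2 < fps_conv_radius c"
    using ereal_dense2[OF rad] by (auto simp: zero_ereal_def)
  obtain r3 where r3: "r3 > 0" "ball 0 r3 \<subseteq> U" using T openE by blast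
  define r where "r = min r1 (min r2 r3)"
  have y_hol: "y holomorphic_on ball 0 r"
    unfolding y_def
  proof (rule holomorphic_on_eval_fps)
    show "ball (0::complex) r \<subseteq> eball 0 (fps_conv_radius c)"
    proof
      fix z :: complex assume "z \<in> ball 0 r"
      then have "ereal (cmod z) < ereal r2" by (simp add: r_def)
      then have "ereal (cmod z) < fps_conv_radius c" using r2(2) by (rule less_trans)
      then show "z \<in> eball 0 (fps_conv_radius c)" by simp
    qed
  qed
  have y0: "y 0 = a" "deriv y 0 = b"
  proof -
    show "y 0 = a" unfolding y_def by (simp add: eval_fps_at_0 c_def)
    have "deriv y 0 = eval_fps (fps_deriv c) 0" unfolding y_def using rad by (subst eval_fps_deriv) (auto simp: zero_ereal_def)
    then show "deriv y 0 = b" by (simp add: eval_fps_at_0 c_def)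
  qed
  show ?thesis using r1 r2 r3 y_hol y0
    by (intro exI[of _ r] conjI exI[of _ y]) (auto simp: r_def dist_norm subset_iff)
qed

lemma holomorphic_second_order_ode:
  assumes T: "T holomorphic_on U" "open U" "z0 \<in> U"
  shows "\<exists>r>0. \<exists>y. ball z0 r \<subseteq> U \<and> y holomorphic_on ball z0 r \<and> y z0 = a \<and> deriv y z0 = b \<and>
    (\<forall>z\<in>ball z0 r. deriv (deriv y) z = - T z * y z)"
proof -
  have "(\<lambda>w. T (z0 + w)) holomorphic_on ((+) (- z0) ` U)"
    by (rule holomorphic_on_compose_gen[OF _ T(1), unfolded o_def]) (auto intro!: holomorphic_intros)
  from holomorphic_second_order_ode_0[OF this open_translation[OF T(2)], of a b] T(3)
  obtain r y where r: "r > 0" "ball 0 r \<subseteq> (+) (- z0) ` U" and y: "y holomorphic_on ball 0 r" "y 0 = a" "deriv y 0 = b"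
      "\<And>z. z \<in> ball 0 r \<Longrightarrow> deriv (deriv y) z = - T (z0 + z) * y z"
    by (force simp: image_iff)
  define Y where "Y z = y (z - z0)" for z
  have m: "z - z0 \<in> ball 0 r" if "z \<in> ball z0 r" for z using that by (simp add: dist_norm norm_minus_commute)
  have sh: "((\<lambda>z. z - z0) has_field_derivative 1) (at z)" for z
    by (auto intro!: derivative_eq_intros)
  have Y: "(Y has_field_derivative deriv y (z - z0)) (at z)" if "z \<in> ball z0 r" for z
    unfolding Y_def using DERIV_chain2[where f = y, OF holomorphic_derivI[OF y(1) open_ball m[OF that]] sh] by simp
  then have dY: "deriv Y z = deriv y (z - z0)" if "z \<in> ball z0 r" for z using that DERIV_imp_deriv by blast
  have d2: "deriv (deriv Y) z = - T z * Y z" if z: "z \<in> ball z0 r" for z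
  proof -
    have "((\<lambda>z. deriv y (z - z0)) has_field_derivative deriv (deriv y) (z - z0)) (at z)"
      using DERIV_chain2[where f = "deriv y", OF holomorphic_derivI[OF holomorphic_deriv[OF y(1) open_ball] open_ball m[OF z]] sh]
      by simp
    then have "(deriv Y has_field_derivative deriv (deriv y) (z - z0)) (at z)"
      by (rule has_field_derivative_transform_within_open[OF _ open_ball z]) (simp add: dY)
    then show ?thesis using y(4)[OF m[OF z]] by (simp add: DERIV_imp_deriv Y_def)
  qed
  have "Y holomorphic_on ball z0 r" using Y holomorphic_on_open[OF open_ball] by blast
  moreover have "ball z0 r \<subseteq> U"
  proof
    fix z assume "z \<in> ball z0 r"
    then have "z - z0 \<in> (+) (- z0) ` U" using m r(2) by blast
    then show "z \<in> U" by auto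
  qed
  ultimately show ?thesis using r(1) y(2,3) dY d2
    by (intro exI[of _ r] conjI exI[of _ Y]) (auto simp: Y_def)
qed

section \<open>Uniqueness for linear systems\<close>

lemma linear_differential_inequality_zero:
  fixes X :: "real \<Rightarrow> 'a::real_inner"
  assumes X: "\<And>s. s \<in> {0..b} \<Longrightarrow> (X has_vector_derivative X' s) (at s within {0..b})"
    and bound: "\<And>s. s \<in> {0..b} \<Longrightarrow> norm (X' s) \<le> K * norm (X s)"
    and X0: "X 0 = 0" and b: "0 \<le> b"
  shows "X b = 0"
proof -
  \<comment> \<open>Gronwall's device: since
    \<open>2 * (X s \<bullet> X' s) \<le> 2 * K * (X s \<bullet> X s)\<close>, the exponential
    weight makes the derivative of \<open>f\<close> nonpositive, and \<open>f 0 = 0\<close> forces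
    \<open>f b \<le> 0\<close>.\<close>
  define f where "f s = (X s \<bullet> X s) * exp (- 2 * K * s)" for s
  show ?thesis
  proof (cases "b = 0")
    case True
    then show ?thesis using X0 by simp
  next
    case False
    have f: "(f has_derivative (\<lambda>h. h * ((2 * (X s \<bullet> X' s) - 2 * K * (X s \<bullet> X s)) * exp (- 2 * K * s)))) (at s within {0..b})"
      if "s \<in> {0..b}" for s
      unfolding f_def using X[OF that]
      by (auto intro!: derivative_eq_intros simp: has_vector_derivative_def algebra_simps inner_commute)
    have "\<exists>s\<in>{0<..<b}. f b - f 0 = (b - 0) * ((2 * (X s \<bullet> X' s) - 2 * K * (X s \<bullet> X s)) * exp (- 2 * K * s))"
      using False b f by (intro mvt_simple) auto
    then obtain s where s: "s \<in> {0<..<b}"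
      "f b - f 0 = b * ((2 * (X s \<bullet> X' s) - 2 * K * (X s \<bullet> X s)) * exp (- 2 * K * s))" by auto
    have "X s \<bullet> X' s \<le> norm (X s) * norm (X' s)" by (rule norm_cauchy_schwarz)
    also have "\<dots> \<le> norm (X s) * (K * norm (X s))" using bound[of s] s by (intro mult_left_mono) auto
    finally have "X s \<bullet> X' s \<le> K * (X s \<bullet> X s)" by (simp add: dot_square_norm power2_eq_square mult_ac)
    then have "f b - f 0 \<le> 0" unfolding s(2) using b
      by (intro mult_nonneg_nonpos mult_nonpos_nonneg) auto
    then have "(X b \<bullet> X b) * exp (- 2 * K * b) \<le> 0" using X0 by (simp add: f_def)
    then have "X b \<bullet> X b \<le> 0" by (simp add: mult_le_0_iff)
    then show ?thesis by (metis inner_gt_zero_iff not_less)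
  qed
qed

text \<open>For a real function \<open>A\<close> with \<open>A\<^sub>z\<^sub>z = - T A\<close> the triple
  \<open>(A, A\<^sub>z, A\<^sub>z\<^sub>z\<^sub>')\<close> (\<open>z'\<close> the conjugate variable) satisfies a closed linear system.\<close>

definition jet_system ::
    "(complex \<Rightarrow> complex) \<Rightarrow> (complex \<Rightarrow> real) \<Rightarrow> (complex \<Rightarrow> complex) \<Rightarrow> (complex \<Rightarrow> real) \<Rightarrow> complex \<Rightarrow> bool" where
  "jet_system T A B C z \<longleftrightarrow>
     (A has_derivative (\<lambda>h. 2 * Re (B z * h))) (at z) \<and>
     (B has_derivative (\<lambda>h. - T z * complex_of_real (A z) * h + complex_of_real (C z) * cnj h)) (at z) \<and>
     (C has_derivative (\<lambda>h. 2 * Re (- T z * cnj (B z) * h))) (at z)"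

lemma jet_system_diff:
  assumes "jet_system T A B C z" "jet_system T A' B' C' z"
  shows "jet_system T (\<lambda>z. A z - A' z) (\<lambda>z. B z - B' z) (\<lambda>z. C z - C' z) z"
proof -
  have a: "(A has_derivative (\<lambda>h. 2 * Re (B z * h))) (at z)" "(A' has_derivative (\<lambda>h. 2 * Re (B' z * h))) (at z)"
    and b: "(B has_derivative (\<lambda>h. - T z * complex_of_real (A z) * h + complex_of_real (C z) * cnj h)) (at z)"
      "(B' has_derivative (\<lambda>h. - T z * complex_of_real (A' z) * h + complex_of_real (C' z) * cnj h)) (at z)"
    and c: "(C has_derivative (\<lambda>h. 2 * Re (- T z * cnj (B z) * h))) (at z)"
      "(C' has_derivative (\<lambda>h. 2 * Re (- T z * cnj (B' z) * h))) (at z)"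
    using assms by (auto simp: jet_system_def)
  show ?thesis unfolding jet_system_def
    by (intro conjI has_derivative_eq_rhs[OF has_derivative_diff[OF a]] has_derivative_eq_rhs[OF has_derivative_diff[OF b]]
        has_derivative_eq_rhs[OF has_derivative_diff[OF c]]; simp add: fun_eq_iff algebra_simps)
qed

lemma jet_system_cmult:
  assumes "jet_system T A B C z"
  shows "jet_system T (\<lambda>z. k * A z) (\<lambda>z. complex_of_real k * B z) (\<lambda>z. k * C z) z"
proof -
  have a: "(A has_derivative (\<lambda>h. 2 * Re (B z * h))) (at z)"
    and b: "(B has_derivative (\<lambda>h. - T z * complex_of_real (A z) * h + complex_of_real (C z) * cnj h)) (at z)"
    and c: "(C has_derivative (\<lambda>h. 2 * Re (- T z * cnj (B z) * h))) (at z)"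
    using assms by (auto simp: jet_system_def)
  show ?thesis unfolding jet_system_def
    by (intro conjI has_derivative_eq_rhs[OF has_derivative_mult_right[OF a]] has_derivative_eq_rhs[OF has_derivative_mult_right[OF b]]
        has_derivative_eq_rhs[OF has_derivative_mult_right[OF c]]; simp add: fun_eq_iff algebra_simps)
qed

text \<open>For \<open>d/dz\<close> the factor \<open>cnj y\<close> is a constant, so
  \<open>A = |y|^2\<close> has \<open>A_z = y' cnj y\<close> and
  \<open>A_zz = y'' cnj y = - T A\<close>; the mixed derivative is \<open>|y'|^2\<close>.\<close>

lemma jet_system_norm_square:
  assumes y: "(y has_field_derivative y' z) (at z)" "(y' has_field_derivative - T z * y z) (at z)"
  shows "jet_system T (\<lambda>z. Re (y z * cnj (y z))) (\<lambda>z. y' z * cnj (y z)) (\<lambda>z. Re (y' z * cnj (y' z))) z"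
proof -
  note d = y[unfolded has_field_derivative_def]
  note dc = d[THEN bounded_linear.has_derivative[OF bounded_linear_cnj]]
  have a: "((\<lambda>z. Re (y z * cnj (y z))) has_derivative (\<lambda>h. Re (y z * cnj (y' z * h) + y' z * h * cnj (y z)))) (at z)"
    by (rule bounded_linear.has_derivative[OF bounded_linear_Re has_derivative_mult[OF d(1) dc(1)]])
  have c: "((\<lambda>z. Re (y' z * cnj (y' z))) has_derivative (\<lambda>h. Re (y' z * cnj (- T z * y z * h) + - T z * y z * h * cnj (y' z)))) (at z)"
    by (rule bounded_linear.has_derivative[OF bounded_linear_Re has_derivative_mult[OF d(2) dc(2)]])
  have b: "((\<lambda>z. y' z * cnj (y z)) has_derivative (\<lambda>h. y' z * cnj (y' z * h) + - T z * y z * h * cnj (y z))) (at z)"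
    by (rule has_derivative_mult[OF d(2) dc(1)])
  show ?thesis unfolding jet_system_def
    by (intro conjI has_derivative_eq_rhs[OF a] has_derivative_eq_rhs[OF b] has_derivative_eq_rhs[OF c];
        simp add: fun_eq_iff complex_eq_iff algebra_simps)
qed

text \<open>On the segment from \<open>z0\<close> to \<open>z\<close> the system becomes a linear
  ordinary differential equation for the triple, with coefficients controlled by a bound
  \<open>M\<close> of \<open>T\<close> on a compact disc, so zero data at \<open>z0\<close>
  propagate to \<open>z\<close>.\<close>

lemma jet_system_unique:
  assumes sys: "\<And>z. z \<in> ball z0 r \<Longrightarrow> jet_system T A B C z" and T: "continuous_on (ball z0 r) T"
    and zero: "A z0 = 0" "B z0 = 0" "C z0 = 0" and z: "z \<in> ball z0 r"
  shows "A z = 0"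
proof -
  define \<zeta> where "\<zeta> = z - z0"
  define c where "c s = z0 + s *\<^sub>R \<zeta>" for s :: real
  have c_in: "c s \<in> cball z0 (cmod \<zeta>)" "c s \<in> ball z0 r" if "s \<in> {0..1}" for s
  proof -
    have "dist z0 (c s) \<le> cmod \<zeta>" using that mult_right_mono[of s 1 "cmod \<zeta>"] by (simp add: c_def dist_norm)
    moreover have "cmod \<zeta> < r" using z by (simp add: \<zeta>_def dist_norm norm_minus_commute)
    ultimately show "c s \<in> cball z0 (cmod \<zeta>)" "c s \<in> ball z0 r" by auto
  qed
  have "compact (cball z0 (cmod \<zeta>))" "cball z0 (cmod \<zeta>) \<subseteq> ball z0 r"
    using z by (auto simp: \<zeta>_def dist_norm norm_minus_commute)
  then have "bounded (T ` cball z0 (cmod \<zeta>))"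
    using compact_imp_bounded compact_continuous_image continuous_on_subset[OF T] by blast
  then obtain M where M: "M > 0" "\<And>w. w \<in> cball z0 (cmod \<zeta>) \<Longrightarrow> cmod (T w) \<le> M"
    unfolding bounded_pos by auto
  define X where "X s = (A (c s), B (c s), C (c s))" for s
  define X' where "X' s = (2 * Re (B (c s) * \<zeta>), - T (c s) * complex_of_real (A (c s)) * \<zeta> + complex_of_real (C (c s)) * cnj \<zeta>,
      2 * Re (- T (c s) * cnj (B (c s)) * \<zeta>))" for s
  have "X 1 = 0"
  proof (rule linear_differential_inequality_zero)
    fix s :: real assume s: "s \<in> {0..1}"
    have c': "(c has_derivative (\<lambda>h. h *\<^sub>R \<zeta>)) (at s within {0..1})"
      unfolding c_def by (auto intro!: derivative_eq_intros)
    have S: "(A has_derivative (\<lambda>h. 2 * Re (B (c s) * h))) (at (c s))"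
      "(B has_derivative (\<lambda>h. - T (c s) * complex_of_real (A (c s)) * h + complex_of_real (C (c s)) * cnj h)) (at (c s))"
      "(C has_derivative (\<lambda>h. 2 * Re (- T (c s) * cnj (B (c s)) * h))) (at (c s))"
      using sys[OF c_in(2)[OF s]] by (auto simp: jet_system_def)
    show "(X has_vector_derivative X' s) (at s within {0..1})"
      unfolding X_def[abs_def] X'_def has_vector_derivative_def scaleR_prod_def fst_conv snd_conv
      by (intro has_derivative_Pair has_derivative_eq_rhs[OF has_derivative_compose[OF c' S(1)]]
          has_derivative_eq_rhs[OF has_derivative_compose[OF c' S(2)]] has_derivative_eq_rhs[OF has_derivative_compose[OF c' S(3)]];
          simp add: fun_eq_iff scaleR_conv_of_real algebra_simps)
    have comp: "\<bar>A (c s)\<bar> \<le> norm (X s)" "cmod (B (c s)) \<le> norm (X s)" "\<bar>C (c s)\<bar> \<le> norm (X s)"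
    proof -
      have t: "cmod (B (c s)) \<le> norm (B (c s), C (c s))" "\<bar>C (c s)\<bar> \<le> norm (B (c s), C (c s))"
        "norm (B (c s), C (c s)) \<le> norm (X s)" "\<bar>A (c s)\<bar> \<le> norm (X s)"
        using norm_fst_le[of "B (c s)" "C (c s)"] norm_snd_le[of "C (c s)" "B (c s)"]
          norm_snd_le[of "(B (c s), C (c s))" "A (c s)"] norm_fst_le[of "A (c s)" "(B (c s), C (c s))"] by (simp_all add: X_def)
      then show "\<bar>A (c s)\<bar> \<le> norm (X s)" "cmod (B (c s)) \<le> norm (X s)" "\<bar>C (c s)\<bar> \<le> norm (X s)" by linarith+
    qed
    have Tb: "cmod (T (c s)) \<le> M" using M c_in s by blast
    have p1: "\<bar>2 * Re (B (c s) * \<zeta>)\<bar> \<le> 2 * cmod \<zeta> * norm (X s)"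
    proof -
      have "\<bar>Re (B (c s) * \<zeta>)\<bar> \<le> cmod (B (c s)) * cmod \<zeta>" using abs_Re_le_cmod[of "B (c s) * \<zeta>"] by (simp add: norm_mult)
      also have "\<dots> \<le> norm (X s) * cmod \<zeta>" using comp by (intro mult_right_mono) auto
      finally show ?thesis by (simp add: mult_ac)
    qed
    have p2: "cmod (- T (c s) * complex_of_real (A (c s)) * \<zeta> + complex_of_real (C (c s)) * cnj \<zeta>) \<le> (M + 1) * cmod \<zeta> * norm (X s)"
    proof -
      have "cmod (- T (c s) * complex_of_real (A (c s)) * \<zeta> + complex_of_real (C (c s)) * cnj \<zeta>)
         \<le> cmod (T (c s)) * \<bar>A (c s)\<bar> * cmod \<zeta> + \<bar>C (c s)\<bar> * cmod \<zeta>"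
        by (rule order_trans[OF norm_triangle_ineq]) (simp add: norm_mult)
      also have "\<dots> \<le> M * norm (X s) * cmod \<zeta> + norm (X s) * cmod \<zeta>"
        using comp Tb M by (intro add_mono mult_right_mono mult_mono) auto
      finally show ?thesis by (simp add: algebra_simps)
    qed
    have p3: "\<bar>2 * Re (- T (c s) * cnj (B (c s)) * \<zeta>)\<bar> \<le> 2 * M * cmod \<zeta> * norm (X s)"
    proof -
      have "\<bar>Re (- T (c s) * cnj (B (c s)) * \<zeta>)\<bar> \<le> cmod (T (c s)) * cmod (B (c s)) * cmod \<zeta>"
        using abs_Re_le_cmod[of "- T (c s) * cnj (B (c s)) * \<zeta>"] by (simp add: norm_mult)
      also have "\<dots> \<le> M * norm (X s) * cmod \<zeta>" using comp Tb M by (intro mult_right_mono mult_mono) auto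
      finally have f: "\<bar>Re (- T (c s) * cnj (B (c s)) * \<zeta>)\<bar> \<le> M * norm (X s) * cmod \<zeta>" .
      have "\<bar>2 * Re (- T (c s) * cnj (B (c s)) * \<zeta>)\<bar> = 2 * \<bar>Re (- T (c s) * cnj (B (c s)) * \<zeta>)\<bar>"
        by (simp only: abs_mult abs_numeral)
      also have "\<dots> \<le> 2 * (M * norm (X s) * cmod \<zeta>)" using f by simp
      finally show ?thesis by (simp only: mult_ac)
    qed
    have "norm (X' s) \<le> \<bar>2 * Re (B (c s) * \<zeta>)\<bar> + (cmod (- T (c s) * complex_of_real (A (c s)) * \<zeta> + complex_of_real (C (c s)) * cnj \<zeta>)
        + \<bar>2 * Re (- T (c s) * cnj (B (c s)) * \<zeta>)\<bar>)"
    proof -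
      have "norm (x, y, z) \<le> \<bar>x\<bar> + (cmod y + \<bar>z\<bar>)" for x :: real and y :: complex and z :: real
        using norm_Pair_le[of x "(y, z)"] norm_Pair_le[of y z] by simp
      then show ?thesis unfolding X'_def by blast
    qed
    \<comment> \<open>The contributions 2, \<open>M + 1\<close> and \<open>2 * M\<close> of the
      three components add up to \<open>3 * M + 3\<close>.\<close>
    also have "\<dots> \<le> 2 * cmod \<zeta> * norm (X s) + ((M + 1) * cmod \<zeta> * norm (X s) + 2 * M * cmod \<zeta> * norm (X s))"
      by (intro add_mono p1 p2 p3)
    also have "\<dots> = ((3 * M + 3) * cmod \<zeta>) * norm (X s)" by (simp add: algebra_simps)
    finally show "norm (X' s) \<le> ((3 * M + 3) * cmod \<zeta>) * norm (X s)" .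
  qed (simp_all add: X_def c_def zero zero_prod_def)
  then show ?thesis by (simp add: X_def c_def \<zeta>_def zero_prod_def)
qed

section \<open>Explicit local solutions and isometric coordinates\<close>

context hyperbolic_metric
begin

text \<open>The Wirtinger derivative \<open>g_z\<close>; \<open>P\<close> below is
  \<open>g_zz'\<close>. They are the second and third entries of the jet of
  \<open>g\<close>.\<close>

definition Gz :: "complex \<Rightarrow> complex" where "Gz z = Complex (gx z / 2) (- gy z / 2)"

definition P :: "complex \<Rightarrow> real" where "P z = (gxx z + gyy z) / 4"

text \<open>The second equation combines the definition of \<open>T\<close> with that of
  \<open>P\<close>; the third, \<open>P_z = - T g_z'\<close>, is the differentiated curvature
  equation divided by \<open>g\<close>.\<close>

lemma jet_system_g:
  assumes z: "z \<in> U" shows "jet_system T g Gz P z"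
proof -
  have g0: "complex_of_real (g z) \<noteq> 0" using g_pos[OF z] by simp
  have mT: "- T z * complex_of_real (g z) = m z / 4" using g0 by (simp add: T_def)
  have a: "(g has_derivative (\<lambda>h. 2 * Re (Gz z * h))) (at z)"
    by (rule has_derivative_eq_rhs[OF has_derivative_g(1)[OF z]]) (simp add: fun_eq_iff Gz_def algebra_simps)
  have Gz_eq: "Gz = (\<lambda>z. complex_of_real (gx z / 2) + \<i> * complex_of_real (- gy z / 2))"
    by (simp add: fun_eq_iff Gz_def complex_eq_iff)
  have "(Gz has_derivative (\<lambda>h. complex_of_real ((Re h * gxx z + Im h * gxy z) / 2)
      + \<i> * complex_of_real (- (Re h * gxy z + Im h * gyy z) / 2))) (at z)"
    unfolding Gz_eq using has_derivative_g[OF z]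
    by (auto intro!: derivative_eq_intros simp: fun_eq_iff complex_eq_iff field_simps)
  then have b: "(Gz has_derivative (\<lambda>h. - T z * complex_of_real (g z) * h + complex_of_real (P z) * cnj h)) (at z)"
    by (rule has_derivative_eq_rhs) (unfold mT, simp add: fun_eq_iff complex_eq_iff m_def P_def field_simps)
  have "complex_of_real (g z) * Complex (partial_x gxx z + partial_x gyy z) (- (partial_y gxx z + partial_y gyy z))
      = complex_of_real (g z) * (- 8 * T z * cnj (Gz z))"
  proof -
    have "complex_of_real (g z) * (- 8 * T z * cnj (Gz z)) = 8 * (- T z * complex_of_real (g z)) * cnj (Gz z)" by simp
    also have "\<dots> = m z * Complex (gx z) (gy z)" unfolding mT by (simp add: Gz_def complex_eq_iff algebra_simps)
    finally show ?thesis using curvature_equation_derivative[OF z] by simp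
  qed
  then have e: "Complex (partial_x gxx z + partial_x gyy z) (- (partial_y gxx z + partial_y gyy z)) = - 8 * T z * cnj (Gz z)"
    using g0 mult_left_cancel by blast
  have "2 * Re (- T z * cnj (Gz z) * h) = Re (- 8 * T z * cnj (Gz z) * h) / 4" for h
    by (simp add: algebra_simps)
  then have e': "2 * Re (- T z * cnj (Gz z) * h) = ((partial_x gxx z + partial_x gyy z) * Re h + (partial_y gxx z + partial_y gyy z) * Im h) / 4" for h
    unfolding e[symmetric] by (simp add: algebra_simps)
  have "(P has_derivative (\<lambda>h. ((Re h * partial_x gxx z + Im h * partial_y gxx z) + (Re h * partial_x gyy z + Im h * partial_y gyy z)) / 4)) (at z)"
    unfolding P_def[abs_def] using has_derivative_g[OF z] by (auto intro!: derivative_eq_intros)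
  then have c: "(P has_derivative (\<lambda>h. 2 * Re (- T z * cnj (Gz z) * h))) (at z)"
    by (rule has_derivative_eq_rhs) (unfold e', simp add: fun_eq_iff algebra_simps)
  show ?thesis unfolding jet_system_def using a b c by blast
qed

text \<open>By \<open>jet_system_unique\<close> it suffices to match the jets of
  \<open>2 * g\<close> and \<open>|y2|^2 - |y1|^2\<close> at \<open>z0\<close>. With
  \<open>y1 z0 = 0\<close> the values require \<open>|y2|^2 = 2 * g z0\<close>, the first
  derivatives then determine \<open>y2'\<close>, and the last entry fixes only the modulus of
  \<open>y1'\<close>, which the curvature equation evaluates to
  \<open>|y1'|^2 = 1 / (2 * g z0)\<close>. The phase of \<open>y1'\<close> remains free; tying it to
  \<open>v\<close> decides the direction of the geodesic in the final coordinate.\<close>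

lemma hermitian_representation:
  assumes z0: "z0 \<in> U" and v: "cmod v = g z0"
  defines "a \<equiv> complex_of_real (sqrt (2 * g z0))"
  shows "\<exists>r>0. \<exists>y1 y2. ball z0 r \<subseteq> U \<and> y1 holomorphic_on ball z0 r \<and> y2 holomorphic_on ball z0 r \<and>
    y1 z0 = 0 \<and> deriv y1 z0 = \<i> * a / (2 * v) \<and> y2 z0 = a \<and>
    (\<forall>z\<in>ball z0 r. deriv y1 z * y2 z - y1 z * deriv y2 z = \<i> * a\<^sup>2 / (2 * v)) \<and>
    (\<forall>z\<in>ball z0 r. 2 * g z = (cmod (y2 z))\<^sup>2 - (cmod (y1 z))\<^sup>2)"
proof -
  have g0: "g z0 > 0" using g_pos z0 by simp
  have v0: "v \<noteq> 0" using v g0 by auto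
  have a2: "a\<^sup>2 = complex_of_real (2 * g z0)" unfolding a_def of_real_power[symmetric] using g0 by simp
  have ca: "cnj a = a" by (simp add: a_def)
  have a0: "a \<noteq> 0" using g0 by (simp add: a_def)
  \<comment> \<open>As \<open>cmod v = g z0\<close>, this has the required modulus, with the phase
    given by \<open>v\<close>.\<close>
  define b where "b = \<i> * a / (2 * v)"
  \<comment> \<open>The solution of \<open>2 * Gz z0 = c * cnj a\<close>, which is the vanishing of
    \<open>B\<close> at \<open>z0\<close>.\<close>
  define c where "c = 2 * Gz z0 / a"
  obtain r1 y1 where r1: "r1 > 0" "ball z0 r1 \<subseteq> U" "y1 holomorphic_on ball z0 r1" "y1 z0 = 0" "deriv y1 z0 = b"
      "\<And>z. z \<in> ball z0 r1 \<Longrightarrow> deriv (deriv y1) z = - T z * y1 z"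
    using holomorphic_second_order_ode[OF T_holomorphic open_U z0, of 0 b] by blast
  obtain r2 y2 where r2: "r2 > 0" "ball z0 r2 \<subseteq> U" "y2 holomorphic_on ball z0 r2" "y2 z0 = a" "deriv y2 z0 = c"
      "\<And>z. z \<in> ball z0 r2 \<Longrightarrow> deriv (deriv y2) z = - T z * y2 z"
    using holomorphic_second_order_ode[OF T_holomorphic open_U z0, of a c] by blast
  define r where "r = min r1 r2"
  have r: "r > 0" and sub: "ball z0 r \<subseteq> ball z0 r1" "ball z0 r \<subseteq> ball z0 r2" "ball z0 r \<subseteq> U" using r1 r2 by (auto simp: r_def)
  have d: "(y1 has_field_derivative deriv y1 z) (at z)" "(deriv y1 has_field_derivative - T z * y1 z) (at z)"
    "(y2 has_field_derivative deriv y2 z) (at z)" "(deriv y2 has_field_derivative - T z * y2 z) (at z)" if "z \<in> ball z0 r" for z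
    using holomorphic_derivI[OF r1(3) open_ball] holomorphic_derivI[OF r2(3) open_ball]
      holomorphic_derivI[OF holomorphic_deriv[OF r1(3) open_ball] open_ball]
      holomorphic_derivI[OF holomorphic_deriv[OF r2(3) open_ball] open_ball] r1(6) r2(6) sub that
    by (metis subsetD)+
  define A where "A z = 2 * g z - (Re (y2 z * cnj (y2 z)) - Re (y1 z * cnj (y1 z)))" for z
  define B where "B z = complex_of_real 2 * Gz z - (deriv y2 z * cnj (y2 z) - deriv y1 z * cnj (y1 z))" for z
  define C where "C z = 2 * P z - (Re (deriv y2 z * cnj (deriv y2 z)) - Re (deriv y1 z * cnj (deriv y1 z)))" for z
  have sys: "jet_system T A B C z" if z: "z \<in> ball z0 r" for z
    unfolding A_def[abs_def] B_def[abs_def] C_def[abs_def]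
    using d[OF z] z sub by (intro jet_system_diff jet_system_cmult jet_system_g jet_system_norm_square) auto
  have contT: "continuous_on (ball z0 r) T"
    using T_holomorphic holomorphic_on_imp_continuous_on continuous_on_subset sub by blast
  have A0: "A z0 = 0"
  proof -
    have "a * cnj a = complex_of_real (2 * g z0)" using a2 ca by (simp add: power2_eq_square)
    then show ?thesis by (simp only: A_def r1 r2) simp
  qed
  have B0: "B z0 = 0" unfolding B_def r1 r2 using a0 by (simp add: c_def ca)
  have nc: "(cmod c)\<^sup>2 = 2 * (cmod (Gz z0))\<^sup>2 / g z0"
    using g0 by (simp add: c_def a_def norm_divide norm_mult power_divide power_mult_distrib)
  have nb: "(cmod b)\<^sup>2 = 1 / (2 * g z0)"
    using g0 v by (simp add: b_def a_def norm_divide norm_mult power_divide power_mult_distrib power2_eq_square)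
  have nG: "4 * (cmod (Gz z0))\<^sup>2 = (gx z0)\<^sup>2 + (gy z0)\<^sup>2" by (simp add: Gz_def cmod_power2 power_divide)
  have C0: "C z0 = 0"
  proof -
    have n: "Re (w * cnj w) = (cmod w)\<^sup>2" for w unfolding cmod_power2 by (simp add: power2_eq_square)
    have "C z0 = 2 * P z0 - (2 * (cmod (Gz z0))\<^sup>2 / g z0 - 1 / (2 * g z0))" by (simp only: C_def r1 r2 n nc nb)
    also have "\<dots> = (g z0 * (gxx z0 + gyy z0) - 4 * (cmod (Gz z0))\<^sup>2 + 1) / (2 * g z0)"
      using g0 by (simp add: P_def field_simps)
    also have "\<dots> = 0" unfolding nG curvature_equation[OF z0] by simp
    finally show ?thesis .
  qed
  have rep: "2 * g z = (cmod (y2 z))\<^sup>2 - (cmod (y1 z))\<^sup>2" if z: "z \<in> ball z0 r" for z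
    using jet_system_unique[OF sys contT A0 B0 C0 z] unfolding A_def cmod_power2 by (simp add: power2_eq_square)
  \<comment> \<open>The Wronskian of two solutions of \<open>y'' = - T y\<close> is constant; its
    value is read off at \<open>z0\<close>.\<close>
  have W: "deriv y1 z * y2 z - y1 z * deriv y2 z = \<i> * a\<^sup>2 / (2 * v)" if z: "z \<in> ball z0 r" for z
  proof -
    have "\<exists>k. \<forall>z\<in>ball z0 r. deriv y1 z * y2 z - y1 z * deriv y2 z = k"
    proof (rule has_field_derivative_zero_constant)
      fix z assume z: "z \<in> ball z0 r"
      have "((\<lambda>z. deriv y1 z * y2 z - y1 z * deriv y2 z) has_field_derivative 0) (at z)"
        using d[OF z] by (auto intro!: derivative_eq_intros)
      then show "((\<lambda>z. deriv y1 z * y2 z - y1 z * deriv y2 z) has_field_derivative 0) (at z within ball z0 r)"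
        by (rule has_field_derivative_at_within)
    qed simp
    then obtain k where k: "\<And>z. z \<in> ball z0 r \<Longrightarrow> deriv y1 z * y2 z - y1 z * deriv y2 z = k" by blast
    from k[of z0] r r1 r2 have "k = b * a" by simp
    then show ?thesis using k[OF z] by (simp add: b_def power2_eq_square)
  qed
  show ?thesis
    using r sub r1 r2 W rep by (intro exI[of _ r] conjI exI[of _ y1] exI[of _ y2])
      (auto intro: holomorphic_on_subset simp: b_def)
qed

text \<open>The quotient \<open>f = y1 / y2\<close> is a local isometry into the unit disc with the
  metric \<open>2 |df| / (1 - |f|^2)\<close>, because \<open>f' = W / y2^2\<close> with
  \<open>cmod W = 1\<close> and \<open>2 * g = |y2|^2 (1 - |f|^2)\<close>. The map
  \<open>tan (w / 2)\<close> takes the strip \<open>|Re w| < pi / 2\<close> onto this disc and turns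
  its metric into \<open>|dw| / cos (Re w)\<close>. So \<open>F\<close> is found by solving
  \<open>f (F w) = tan (w / 2)\<close>; the phase chosen in \<open>hermitian_representation\<close>
  yields the value of \<open>deriv F 0\<close>.\<close>

lemma isometric_strip_chart:
  assumes z0: "z0 \<in> U" and v: "cmod v * \<rho> z0 = 1"
  shows "\<exists>r>0. r \<le> 1 \<and> (\<exists>F. F holomorphic_on ball 0 r \<and> inj_on F (ball 0 r) \<and> F ` ball 0 r \<subseteq> U \<and>
    F 0 = z0 \<and> deriv F 0 = - \<i> * v \<and> (\<forall>w\<in>ball 0 r. \<rho> (F w) * cmod (deriv F w) = 1 / cos (Re w)))"
proof -
  have g0: "g z0 > 0" using g_pos z0 by simp
  have vg: "cmod v = g z0" using v pos[OF z0] by (simp add: g_def field_simps)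
  define a where "a = complex_of_real (sqrt (2 * g z0))"
  have v0: "v \<noteq> 0" using vg g0 by auto
  have a0: "a \<noteq> 0" using g0 by (simp add: a_def)
  have a2: "a\<^sup>2 = complex_of_real (2 * g z0)" unfolding a_def of_real_power[symmetric] using g0 by simp
  define W where "W = \<i> * a\<^sup>2 / (2 * v)"
  have nW: "cmod W = 1" using g0 unfolding W_def a2 by (simp add: norm_divide norm_mult vg)
  obtain r y1 y2 where r: "r > 0" "ball z0 r \<subseteq> U" and y1: "y1 holomorphic_on ball z0 r" and y2: "y2 holomorphic_on ball z0 r"
    and y1z: "y1 z0 = 0" and y1d: "deriv y1 z0 = \<i> * a / (2 * v)" and y2z: "y2 z0 = a"
    and wr: "\<And>z. z \<in> ball z0 r \<Longrightarrow> deriv y1 z * y2 z - y1 z * deriv y2 z = W"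
    and rep: "\<And>z. z \<in> ball z0 r \<Longrightarrow> 2 * g z = (cmod (y2 z))\<^sup>2 - (cmod (y1 z))\<^sup>2"
    using hermitian_representation[OF z0 vg] unfolding a_def[symmetric] W_def[symmetric] by blast
  have y2nz: "y2 z \<noteq> 0" if "z \<in> ball z0 r" for z
  proof
    assume "y2 z = 0"
    then have "2 * g z \<le> 0" using rep[OF that] by simp
    moreover have "g z > 0" using g_pos r(2) that by blast
    ultimately show False by simp
  qed
  define f where "f z = y1 z / y2 z" for z
  have f_hol: "f holomorphic_on ball z0 r" unfolding f_def using y1 y2 y2nz by (intro holomorphic_intros) auto
  have df: "deriv f z = W / (y2 z)\<^sup>2" if z: "z \<in> ball z0 r" for z
  proof -
    have "(f has_field_derivative (deriv y1 z * y2 z - y1 z * deriv y2 z) / (y2 z * y2 z)) (at z)"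
      unfolding f_def using y2nz[OF z] by (intro DERIV_divide holomorphic_derivI[OF y1 open_ball z] holomorphic_derivI[OF y2 open_ball z])
    then show ?thesis unfolding wr[OF z] by (simp add: DERIV_imp_deriv power2_eq_square)
  qed
  have W0: "W \<noteq> 0" using nW by auto
  have z0r: "z0 \<in> ball z0 r" using r by simp
  have "deriv f z0 \<noteq> 0" using df[OF z0r] W0 y2nz[OF z0r] by simp
  then obtain r1 where r1: "r1 > 0" "ball z0 r1 \<subseteq> ball z0 r" "inj_on f (ball z0 r1)"
    using has_complex_derivative_locally_injective[OF f_hol z0r open_ball] by metis
  have f_hol1: "f holomorphic_on ball z0 r1" using f_hol r1 holomorphic_on_subset by blast
  obtain G where G: "G holomorphic_on f ` ball z0 r1" "\<And>z. z \<in> ball z0 r1 \<Longrightarrow> deriv f z * deriv G (f z) = 1"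
      "\<And>z. z \<in> ball z0 r1 \<Longrightarrow> G (f z) = z"
    using holomorphic_has_inverse[OF f_hol1 open_ball r1(3)] by metis
  have oV: "open (f ` ball z0 r1)" using open_mapping_thm3[OF f_hol1 open_ball r1(3)] .
  have f0: "f z0 = 0" by (simp add: f_def y1z)
  \<comment> \<open>The addition formula for the cosine of \<open>w / 2\<close> plus its conjugate:
    the products become squared moduli, and the sum of the arguments is \<open>Re w\<close>.\<close>
  have trig: "(cmod (cos (w / 2)))\<^sup>2 - (cmod (sin (w / 2)))\<^sup>2 = cos (Re w)" for w
  proof -
    have "complex_of_real ((cmod (cos (w / 2)))\<^sup>2 - (cmod (sin (w / 2)))\<^sup>2) = cos (w / 2 + cnj (w / 2))"
      by (simp only: of_real_diff complex_norm_square cos_add cnj_cos cnj_sin)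
    also have "w / 2 + cnj (w / 2) = complex_of_real (Re w)" by (simp add: complex_eq_iff)
    also have "cos (complex_of_real (Re w)) = complex_of_real (cos (Re w))" by (simp add: cos_of_real)
    finally show ?thesis unfolding of_real_eq_iff .
  qed
  have cosRe: "cos (Re w) > 0" if "w \<in> ball 0 1" for w :: complex
  proof -
    have "\<bar>Re w\<bar> < 1" using that abs_Re_le_cmod[of w] by simp
    then show "cos (Re w) > 0" using pi_gt3 by (intro cos_gt_zero_pi) auto
  qed
  have cos_nz: "cos (w / 2) \<noteq> 0" if "w \<in> ball 0 1" for w :: complex
  proof
    assume "cos (w / 2) = 0"
    then have "cos (Re w) \<le> 0" unfolding trig[of w, symmetric] by simp
    then show False using cosRe[OF that] by simp
  qed
  define q where "q w = tan (w / 2)" for w :: complex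
  have dq: "(q has_field_derivative 1 / (2 * (cos (w / 2))\<^sup>2)) (at w)" if "w \<in> ball 0 1" for w
    unfolding q_def using cos_nz[OF that]
    by (auto intro!: derivative_eq_intros simp: field_simps)
  have q_hol: "q holomorphic_on ball 0 1" using dq holomorphic_on_open[OF open_ball] by blast
  have "isCont q 0" using DERIV_isCont[OF dq[of 0]] by simp
  moreover have "q 0 \<in> f ` ball z0 r1" using r1 f0 by (force simp: q_def)
  ultimately have "eventually (\<lambda>w. q w \<in> f ` ball z0 r1) (nhds 0)"
    using oV by (simp add: isCont_def tendsto_at_iff_tendsto_nhds topological_tendstoD)
  then obtain r2 where r2: "r2 > 0" "\<And>w. dist w 0 < r2 \<Longrightarrow> q w \<in> f ` ball z0 r1"
    unfolding eventually_nhds_metric by blast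
  \<comment> \<open>A radius of at most 1, less than \<open>pi / 2\<close>, keeps
    \<open>cos (Re w)\<close> positive.\<close>
  define r3 where "r3 = min 1 r2"
  have r3: "r3 > 0" "r3 \<le> 1" "ball 0 r3 \<subseteq> ball (0::complex) 1" "q ` ball 0 r3 \<subseteq> f ` ball z0 r1"
    using r2 by (auto simp: r3_def)
  define F where "F w = G (q w)" for w
  have F_hol: "F holomorphic_on ball 0 r3"
    unfolding F_def using holomorphic_on_compose_gen[OF holomorphic_on_subset[OF q_hol r3(3)] G(1) r3(4)] by (simp add: o_def)
  have Fw: "F w \<in> ball z0 r1" "f (F w) = q w" if "w \<in> ball 0 r3" for w
  proof -
    have "q w \<in> f ` ball z0 r1" using r3(4) imageI[OF that, of q] by (rule subsetD)
    then obtain z where z: "z \<in> ball z0 r1" "q w = f z" by (rule imageE)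
    show "F w \<in> ball z0 r1" "f (F w) = q w" using z G(3)[OF z(1)] by (auto simp: F_def)
  qed
  have dF: "deriv F w = (y2 (F w))\<^sup>2 / (2 * W * (cos (w / 2))\<^sup>2)" if w: "w \<in> ball 0 r3" for w
  proof -
    have w1: "w \<in> ball 0 1" using w r3 by blast
    have Fr: "F w \<in> ball z0 r" using Fw(1)[OF w] r1 by blast
    have "(G has_field_derivative deriv G (q w)) (at (q w))"
      using holomorphic_derivI[OF G(1) oV] r3(4) w by blast
    from DERIV_chain2[OF this dq[OF w1]]
    have "deriv F w = deriv G (q w) * (1 / (2 * (cos (w / 2))\<^sup>2))"
      unfolding F_def by (rule DERIV_imp_deriv)
    moreover have "deriv G (q w) = (y2 (F w))\<^sup>2 / W"
    proof -
      have e: "W / (y2 (F w))\<^sup>2 * deriv G (q w) = 1"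
        using G(2)[OF Fw(1)[OF w]] unfolding df[OF Fr] Fw(2)[OF w] .
      have "deriv G (q w) = (y2 (F w))\<^sup>2 / W * (W / (y2 (F w))\<^sup>2 * deriv G (q w))"
        using W0 y2nz[OF Fr] by simp
      then show ?thesis unfolding e by simp
    qed
    ultimately show ?thesis by simp
  qed
  have F0: "F 0 = z0" using G(3)[of z0] r1 f0 by (simp add: F_def q_def)
  have dF0: "deriv F 0 = - \<i> * v"
    using dF[of 0] r3(1) F0 a0 v0 by (simp add: y2z W_def field_simps)
  have iso: "\<rho> (F w) * cmod (deriv F w) = 1 / cos (Re w)" if w: "w \<in> ball 0 r3" for w
  proof -
    have w1: "w \<in> ball 0 1" using w r3 by blast
    have Fr: "F w \<in> ball z0 r" using Fw(1)[OF w] r1 by blast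
    define Y where "Y = (cmod (y2 (F w)))\<^sup>2"
    define c where "c = (cmod (cos (w / 2)))\<^sup>2"
    define s where "s = (cmod (sin (w / 2)))\<^sup>2"
    have Y: "Y > 0" using y2nz[OF Fr] by (simp add: Y_def)
    have c: "c > 0" using cos_nz[OF w1] by (simp add: c_def)
    have cs: "c - s = cos (Re w)" unfolding c_def s_def by (rule trig)
    have "y1 (F w) = q w * y2 (F w)" using Fw(2)[OF w] y2nz[OF Fr] by (simp add: f_def field_simps)
    then have "(cmod (y1 (F w)))\<^sup>2 = s / c * Y"
      by (simp add: q_def tan_def norm_mult norm_divide power_mult_distrib power_divide Y_def c_def s_def)
    then have "2 * g (F w) = Y - s / c * Y" using rep[OF Fr] by (simp add: Y_def)
    then have gF: "g (F w) = Y * (c - s) / (2 * c)" using c by (simp add: field_simps)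
    have "\<rho> (F w) = 1 / g (F w)" by (simp add: g_def inverse_eq_divide)
    moreover have "cmod (deriv F w) = Y / (2 * c)"
      unfolding dF[OF w] by (simp add: norm_divide norm_mult norm_power nW Y_def c_def)
    ultimately show ?thesis using Y c cosRe[OF w1] by (simp add: gF cs)
  qed
  have ne: "deriv F 0 \<noteq> 0" using dF0 v0 by simp
  have c0: "0 \<in> ball (0::complex) r3" using r3(1) by simp
  obtain r4 where r4: "r4 > 0" "ball (0::complex) r4 \<subseteq> ball 0 r3" "inj_on F (ball 0 r4)"
    using has_complex_derivative_locally_injective[OF F_hol c0 open_ball ne] by blast
  have sub: "ball (0::complex) (min 1 r4) \<subseteq> ball 0 r4" by auto
  show ?thesis
  proof (intro exI[of _ "min 1 r4"] conjI exI[of _ F] ballI)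
    show "F holomorphic_on ball 0 (min 1 r4)" using F_hol r4 sub holomorphic_on_subset by blast
    show "inj_on F (ball 0 (min 1 r4))" using r4 sub inj_on_subset by blast
    show "F ` ball 0 (min 1 r4) \<subseteq> U" using Fw(1) r1 r r4 sub by blast
    show "\<rho> (F w) * cmod (deriv F w) = 1 / cos (Re w)" if "w \<in> ball 0 (min 1 r4)" for w
      using iso that r4 sub by blast
  qed (use r4 F0 dF0 in auto)
qed

end

section \<open>Uniqueness of geodesics\<close>

lemma linear_differential_inequality_zero_sym:
  fixes X :: "real \<Rightarrow> 'a::real_inner"
  assumes X: "\<And>s. \<bar>s\<bar> < d \<Longrightarrow> (X has_vector_derivative X' s) (at s)"
    and bound: "\<And>s. \<bar>s\<bar> < d \<Longrightarrow> norm (X' s) \<le> K * norm (X s)"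
    and X0: "X 0 = 0" and b: "\<bar>b\<bar> < d"
  shows "X b = 0"
proof (cases "0 \<le> b")
  case True
  show ?thesis
    by (rule linear_differential_inequality_zero[of b X X' K])
      (use True b X bound X0 in \<open>auto intro: has_vector_derivative_at_within\<close>)
next
  case False
  have "((\<lambda>s. X (- s)) has_vector_derivative - X' (- s)) (at s)" if "\<bar>s\<bar> < d" for s
  proof -
    have "((\<lambda>s. - s) has_vector_derivative - 1) (at s)" by (auto intro!: derivative_eq_intros)
    from vector_diff_chain_at[OF this X[of "- s"]] that show ?thesis by (simp add: o_def)
  qed
  then have "X (- (- b)) = 0"
    by (intro linear_differential_inequality_zero[of "- b" "\<lambda>s. X (- s)" "\<lambda>s. - X' (- s)" K])
      (use False b bound X0 in \<open>auto intro: has_vector_derivative_at_within\<close>)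
  then show ?thesis by simp
qed

lemma C1_lipschitz_on_cball:
  assumes U: "open U" "cball z0 r \<subseteq> U" and f: "C_k_on 1 U f"
  shows "\<exists>K\<ge>0. \<forall>x\<in>cball z0 r. \<forall>y\<in>cball z0 r. norm (f x - f y) \<le> K * norm (x - y)"
proof -
  have d: "f differentiable (at z)" if "z \<in> U" for z
    by (rule differentiable_on_openD[OF _ U(1) that]) (use f in simp)
  have c: "continuous_on (cball z0 r) (\<lambda>z. norm (partial_x f z) + norm (partial_y f z))"
    using f by (intro continuous_intros continuous_on_subset[OF _ U(2)]) auto
  then have "bounded ((\<lambda>z. norm (partial_x f z) + norm (partial_y f z)) ` cball z0 r)"
    by (intro compact_imp_bounded compact_continuous_image) auto
  then obtain K where K: "K > 0" "\<And>z. z \<in> cball z0 r \<Longrightarrow> norm (partial_x f z) + norm (partial_y f z) \<le> K"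
    unfolding bounded_pos by fastforce
  have "norm (f x - f y) \<le> K * norm (x - y)" if "x \<in> cball z0 r" "y \<in> cball z0 r" for x y
  proof (rule differentiable_bound[OF convex_cball _ _ that])
    fix z assume z: "z \<in> cball z0 r"
    then show "(f has_derivative (\<lambda>h. Re h *\<^sub>R partial_x f z + Im h *\<^sub>R partial_y f z)) (at z within cball z0 r)"
      using has_derivative_partials[OF d] U(2) has_derivative_at_withinI by blast
    show "onorm (\<lambda>h. Re h *\<^sub>R partial_x f z + Im h *\<^sub>R partial_y f z) \<le> K"
    proof (rule onorm_le)
      fix h :: complex
      have "norm (Re h *\<^sub>R partial_x f z + Im h *\<^sub>R partial_y f z) \<le> \<bar>Re h\<bar> * norm (partial_x f z) + \<bar>Im h\<bar> * norm (partial_y f z)"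
        using norm_triangle_ineq[of "Re h *\<^sub>R partial_x f z" "Im h *\<^sub>R partial_y f z"] by simp
      also have "\<dots> \<le> cmod h * norm (partial_x f z) + cmod h * norm (partial_y f z)"
        by (intro add_mono mult_right_mono abs_Re_le_cmod abs_Im_le_cmod) auto
      also have "\<dots> = (norm (partial_x f z) + norm (partial_y f z)) * cmod h" by (simp add: algebra_simps)
      also have "\<dots> \<le> K * cmod h" using K(2)[OF z] by (intro mult_right_mono) auto
      finally show "norm (Re h *\<^sub>R partial_x f z + Im h *\<^sub>R partial_y f z) \<le> K * norm h" .
    qed
  qed
  then show ?thesis using K(1) by (intro exI[of _ K]) auto
qed

text \<open>Gronwall for the differences of positions and velocities. Near 0 both curves stay in a
  disc on which \<open>l\<close> is Lipschitz, and both velocities are bounded by \<open>V\<close>.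
  Splitting the difference of the right-hand sides as
  \<open>(l w - l c) w'^2 + l c (w' - c') (w' + c')\<close> then bounds it linearly.\<close>

lemma second_order_ode_local_uniqueness:
  fixes l w w' c c' :: "_ \<Rightarrow> complex"
  assumes U: "open U" "z0 \<in> U" and l: "C_k_on 1 U l" and d: "d > 0"
    and w: "\<And>s::real. \<bar>s\<bar> < d \<Longrightarrow> (w has_vector_derivative w' s) (at s)"
      "\<And>s. \<bar>s\<bar> < d \<Longrightarrow> (w' has_vector_derivative - 2 * l (w s) * (w' s)\<^sup>2) (at s)"
    and c: "\<And>s. \<bar>s\<bar> < d \<Longrightarrow> (c has_vector_derivative c' s) (at s)"
      "\<And>s. \<bar>s\<bar> < d \<Longrightarrow> (c' has_vector_derivative - 2 * l (c s) * (c' s)\<^sup>2) (at s)"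
    and init: "w 0 = z0" "c 0 = z0" "w' 0 = c' 0"
  shows "\<exists>e>0. e \<le> d \<and> (\<forall>s. \<bar>s\<bar> < e \<longrightarrow> w s = c s)"
proof -
  obtain r where r: "r > 0" "cball z0 r \<subseteq> U" using U open_contains_cball by blast
  obtain K where K: "K \<ge> 0" "\<And>x y. x \<in> cball z0 r \<Longrightarrow> y \<in> cball z0 r \<Longrightarrow> cmod (l x - l y) \<le> K * cmod (x - y)"
    using C1_lipschitz_on_cball[OF U(1) r(2) l] by blast
  define V where "V = cmod (c' 0) + 1"
  have cont: "isCont w 0" "isCont w' 0" "isCont c 0" "isCont c' 0"
    using w[of 0] c[of 0] d has_vector_derivative_continuous by auto
  have "eventually (\<lambda>s. dist (w s) z0 < r \<and> dist (c s) z0 < r \<and> dist (w' s) (c' 0) < 1 \<and> dist (c' s) (c' 0) < 1) (nhds 0)"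
    using cont init r unfolding isCont_def tendsto_at_iff_tendsto_nhds
    by (intro eventually_conj tendstoD) auto
  then obtain e0 where e0: "e0 > 0" "\<And>s. dist s 0 < e0 \<Longrightarrow>
      dist (w s) z0 < r \<and> dist (c s) z0 < r \<and> dist (w' s) (c' 0) < 1 \<and> dist (c' s) (c' 0) < 1"
    unfolding eventually_nhds_metric by blast
  define e where "e = min e0 d"
  have near: "w s \<in> cball z0 r" "c s \<in> cball z0 r" "cmod (w' s) \<le> V" "cmod (c' s) \<le> V" if "\<bar>s\<bar> < e" for s
  proof -
    have *: "dist (w s) z0 < r" "dist (c s) z0 < r" "dist (w' s) (c' 0) < 1" "dist (c' s) (c' 0) < 1"
      using e0(2)[of s] that by (auto simp: e_def)
    then show "w s \<in> cball z0 r" "c s \<in> cball z0 r" by (auto simp: dist_commute)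
    show "cmod (w' s) \<le> V" "cmod (c' s) \<le> V"
      using * norm_triangle_sub[of "w' s" "c' 0"] norm_triangle_sub[of "c' s" "c' 0"] by (auto simp: V_def dist_norm)
  qed
  define M where "M = cmod (l z0) + K * r"
  have lM: "cmod (l x) \<le> M" if "x \<in> cball z0 r" for x
  proof -
    have "cmod (l x - l z0) \<le> K * cmod (x - z0)" using K(2)[OF that, of z0] r by simp
    also have "\<dots> \<le> K * r" using that K(1) by (intro mult_left_mono) (auto simp: dist_norm norm_minus_commute)
    finally show ?thesis using norm_triangle_sub[of "l x" "l z0"] by (simp add: M_def)
  qed
  have V0: "V \<ge> 0" and M0: "M \<ge> 0" using K r by (auto simp: V_def M_def)
  define X where "X s = (w s - c s, w' s - c' s)" for s
  define X' where "X' s = (w' s - c' s, - 2 * l (w s) * (w' s)\<^sup>2 - (- 2 * l (c s) * (c' s)\<^sup>2))" for s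
  have "X s = 0" if "\<bar>s\<bar> < e" for s
  proof (rule linear_differential_inequality_zero_sym[OF _ _ _ that])
    fix s assume s: "\<bar>s\<bar> < e"
    then have sd: "\<bar>s\<bar> < d" by (simp add: e_def)
    show "(X has_vector_derivative X' s) (at s)"
      unfolding X_def[abs_def] X'_def
      by (intro has_vector_derivative_Pair has_vector_derivative_diff w c sd)
    have n1: "cmod (w s - c s) \<le> norm (X s)" and n2: "cmod (w' s - c' s) \<le> norm (X s)"
      using norm_fst_le[of "w s - c s" "w' s - c' s"] norm_snd_le[of "w' s - c' s" "w s - c s"] by (simp_all add: X_def)
    have "l (w s) * (w' s)\<^sup>2 - l (c s) * (c' s)\<^sup>2 = (l (w s) - l (c s)) * (w' s * w' s) + l (c s) * ((w' s - c' s) * (w' s + c' s))"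
      by (simp add: algebra_simps power2_eq_square)
    then have "cmod (l (w s) * (w' s)\<^sup>2 - l (c s) * (c' s)\<^sup>2)
        \<le> cmod (l (w s) - l (c s)) * (cmod (w' s) * cmod (w' s)) + cmod (l (c s)) * (cmod (w' s - c' s) * cmod (w' s + c' s))"
      by (metis norm_mult norm_triangle_ineq)
    also have "\<dots> \<le> (K * norm (X s)) * (V * V) + M * (norm (X s) * (2 * V))"
    proof (intro add_mono mult_mono)
      show "cmod (l (w s) - l (c s)) \<le> K * norm (X s)"
        using K(2)[OF near(1,2)[OF s]] mult_left_mono[OF n1 K(1)] by linarith
      show "cmod (w' s + c' s) \<le> 2 * V" using norm_triangle_ineq[of "w' s" "c' s"] near(3,4)[OF s] by linarith
    qed (use near[OF s] lM n2 K V0 M0 in auto)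
    finally have q: "cmod (l (w s) * (w' s)\<^sup>2 - l (c s) * (c' s)\<^sup>2) \<le> (K * norm (X s)) * (V * V) + M * (norm (X s) * (2 * V))" .
    have "norm (X' s) \<le> cmod (w' s - c' s) + cmod (- 2 * l (w s) * (w' s)\<^sup>2 - (- 2 * l (c s) * (c' s)\<^sup>2))"
      unfolding X'_def by (rule norm_Pair_le)
    also have "- 2 * l (w s) * (w' s)\<^sup>2 - (- 2 * l (c s) * (c' s)\<^sup>2) = (- 2) * (l (w s) * (w' s)\<^sup>2 - l (c s) * (c' s)\<^sup>2)"
      by (simp add: algebra_simps)
    also have "cmod ((- 2) * (l (w s) * (w' s)\<^sup>2 - l (c s) * (c' s)\<^sup>2)) = 2 * cmod (l (w s) * (w' s)\<^sup>2 - l (c s) * (c' s)\<^sup>2)"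
      unfolding norm_mult by simp
    finally have f: "norm (X' s) \<le> cmod (w' s - c' s) + 2 * cmod (l (w s) * (w' s)\<^sup>2 - l (c s) * (c' s)\<^sup>2)" .
    have "norm (X' s) \<le> norm (X s) + 2 * ((K * norm (X s)) * (V * V) + M * (norm (X s) * (2 * V)))"
      by (rule order_trans[OF f add_mono[OF n2 mult_left_mono[OF q]]]) simp
    then show "norm (X' s) \<le> (1 + 2 * K * (V * V) + 4 * M * V) * norm (X s)" by (simp add: algebra_simps)
  qed (simp add: X_def init zero_prod_def)
  then show ?thesis using e0 d by (intro exI[of _ e]) (auto simp: e_def X_def zero_prod_def)
qed

context hyperbolic_metric
begin

abbreviation "\<l> \<equiv> log_factor_dw \<rho>"

lemma C1_log_factor: "C_k_on 1 U \<l>"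
proof -
  have "C_k_on 3 U (\<lambda>w. ln (\<rho> w))" using pos by (intro C_k_on_ln open_U smooth) auto
  then have *: "C_k_on 2 U (partial_x (\<lambda>w. ln (\<rho> w)))" "C_k_on 2 U (partial_y (\<lambda>w. ln (\<rho> w)))"
    by (simp_all add: numeral_3_eq_3 numeral_2_eq_2)
  have "C_k_on 1 U (\<lambda>z. (1 / 2) * (complex_of_real (partial_x (\<lambda>w. ln (\<rho> w)) z) - \<i> * complex_of_real (partial_y (\<lambda>w. ln (\<rho> w)) z)))"
    by (intro C_k_on_cmult C_k_on_diff C_k_on_of_real open_U C_k_on_mono[OF *(1)] C_k_on_mono[OF *(2)]) auto
  then show ?thesis by (simp add: log_factor_dw_def[abs_def])
qed

lemma has_derivative_ln_factor:
  assumes "z \<in> U" shows "((\<lambda>w. ln (\<rho> w)) has_derivative (\<lambda>h. 2 * Re (\<l> z * h))) (at z)"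
proof -
  have "C_k_on 3 U (\<lambda>w. ln (\<rho> w))" using pos by (intro C_k_on_ln open_U smooth) auto
  then have "(\<lambda>w. ln (\<rho> w)) differentiable (at z)"
    by (intro differentiable_on_openD[OF _ open_U assms]) (simp add: numeral_3_eq_3)
  from has_derivative_partials[OF this] show ?thesis
    by (rule has_derivative_eq_rhs) (simp add: fun_eq_iff log_factor_dw_def algebra_simps)
qed

text \<open>Differentiate the logarithm of the isometry relation,
  \<open>2 ln \<rho>(F) + ln |F'|^2 + 2 ln cos (Re w) = 0\<close>. On the imaginary axis the last
  term drops out, and the rest is the claim. It says that \<open>c s = F (\<i> * s)\<close> solves
  the geodesic equation, since \<open>c' = \<i> * F'\<close> and \<open>c'' = - F''\<close>.\<close>

lemma isometric_chart_second_derivative: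
  assumes F: "F holomorphic_on ball 0 r" "F ` ball 0 r \<subseteq> U"
    and iso: "\<And>w. w \<in> ball 0 r \<Longrightarrow> \<rho> (F w) * cmod (deriv F w) = 1 / cos (Re w)"
    and w: "w \<in> ball 0 r" "Re w = 0" and r: "r \<le> 1"
  shows "deriv (deriv F) w = - 2 * \<l> (F w) * (deriv F w)\<^sup>2"
proof -
  have cosp: "cos (Re z) > 0" if "z \<in> ball 0 r" for z
    using that abs_Re_le_cmod[of z] r pi_gt3 by (intro cos_gt_zero_pi) auto
  have nz: "deriv F z \<noteq> 0" if "z \<in> ball 0 r" for z
    using iso[OF that] cosp[OF that] by auto
  define n where "n z = Re (deriv F z * cnj (deriv F z))" for z
  have nn: "n z = (cmod (deriv F z))\<^sup>2" for z unfolding n_def cmod_power2 by (simp add: power2_eq_square)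
  have eq: "2 * ln (\<rho> (F z)) + ln (n z) + 2 * ln (cos (Re z)) = 0" if z: "z \<in> ball 0 r" for z
  proof -
    have p: "\<rho> (F z) > 0" using pos F(2) z by blast
    have "\<rho> (F z) * cmod (deriv F z) * cos (Re z) = 1" using iso[OF z] cosp[OF z] by simp
    then have "ln (\<rho> (F z) * cmod (deriv F z) * cos (Re z)) = 0" by simp
    then have "ln (\<rho> (F z)) + ln (cmod (deriv F z)) + ln (cos (Re z)) = 0"
      using p nz[OF z] cosp[OF z] by (simp add: ln_mult)
    moreover have "ln (n z) = 2 * ln (cmod (deriv F z))" using nz[OF z] by (simp add: nn ln_realpow)
    ultimately show ?thesis by simp
  qed
  define F1 F2 where "F1 = deriv F w" and "F2 = deriv (deriv F) w"
  have dF: "(F has_derivative (\<lambda>h. F1 * h)) (at w)" and ddF: "(deriv F has_derivative (\<lambda>h. F2 * h)) (at w)"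
    using holomorphic_derivI[OF F(1) open_ball w(1)] holomorphic_derivI[OF holomorphic_deriv[OF F(1) open_ball] open_ball w(1)]
    by (simp_all add: has_field_derivative_def F1_def F2_def)
  have a: "((\<lambda>z. ln (\<rho> (F z))) has_derivative (\<lambda>h. 2 * Re (\<l> (F w) * (F1 * h)))) (at w)"
    using has_derivative_compose[OF dF has_derivative_ln_factor] F(2) w(1) by blast
  have "(n has_derivative (\<lambda>h. Re (F1 * cnj (F2 * h) + F2 * h * cnj F1))) (at w)"
    unfolding n_def[abs_def] F1_def
    by (rule bounded_linear.has_derivative[OF bounded_linear_Re
          has_derivative_mult[OF ddF bounded_linear.has_derivative[OF bounded_linear_cnj ddF]]])
  then have n': "(n has_derivative (\<lambda>h. 2 * Re (F2 * h * cnj F1))) (at w)"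
    by (rule has_derivative_eq_rhs) (simp add: fun_eq_iff algebra_simps)
  have nw: "n w > 0" using nz[OF w(1)] by (simp add: nn)
  have cw: "cos (Re w) = 1" "sin (Re w) = 0" using w by auto
  have b: "((\<lambda>z. ln (n z)) has_derivative (\<lambda>h. 2 * Re (F2 * h * cnj F1) / n w)) (at w)"
    using n' nw by (auto intro!: derivative_eq_intros simp: fun_eq_iff field_simps)
  \<comment> \<open>This is where \<open>Re w = 0\<close> enters: the cosine is stationary at
    0.\<close>
  have c: "((\<lambda>z. 2 * ln (cos (Re z))) has_derivative (\<lambda>h. 0)) (at w)"
    using cw by (auto intro!: derivative_eq_intros simp: fun_eq_iff)
  have "((\<lambda>z. 2 * ln (\<rho> (F z)) + ln (n z) + 2 * ln (cos (Re z))) has_derivative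
      (\<lambda>h. 2 * (2 * Re (\<l> (F w) * (F1 * h))) + 2 * Re (F2 * h * cnj F1) / n w)) (at w)"
    using has_derivative_add[OF has_derivative_add[OF has_derivative_mult_right[OF a, of 2] b] c] by simp
  moreover have "((\<lambda>z. 2 * ln (\<rho> (F z)) + ln (n z) + 2 * ln (cos (Re z))) has_derivative (\<lambda>h. 0)) (at w)"
    by (rule has_derivative_transform_within_open[OF has_derivative_const open_ball w(1), of 0]) (simp add: eq)
  ultimately have z: "(\<lambda>h. 2 * (2 * Re (\<l> (F w) * (F1 * h))) + 2 * Re (F2 * h * cnj F1) / n w) = (\<lambda>h. 0)"
    by (rule has_derivative_unique)
  define q where "q = 2 * \<l> (F w) * F1 * complex_of_real (n w) + F2 * cnj F1"
  \<comment> \<open>The vanishing derivative is the real part of \<open>q * h\<close> up to a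
    positive factor; the directions 1 and \<open>\<i>\<close> then give
    \<open>q = 0\<close>.\<close>
  have "Re (q * h) = 0" for h
  proof -
    have "2 * (2 * Re (\<l> (F w) * (F1 * h))) + 2 * Re (F2 * h * cnj F1) / n w = 0" using fun_cong[OF z, of h] by simp
    then have "n w * (2 * (2 * Re (\<l> (F w) * (F1 * h)))) + 2 * Re (F2 * h * cnj F1) = 0"
      using nw by (simp add: field_simps)
    then show ?thesis by (simp add: q_def algebra_simps)
  qed
  from this[of 1] this[of \<i>] have "q = 0" by (simp add: complex_eq_iff)
  moreover have "complex_of_real (n w) = F1 * cnj F1" by (simp only: nn complex_norm_square F1_def)
  ultimately have "(2 * \<l> (F w) * F1\<^sup>2 + F2) * cnj F1 = 0" by (simp add: q_def power2_eq_square algebra_simps)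
  then have "F2 = - (2 * \<l> (F w) * F1\<^sup>2)" using nz[OF w(1)] by (auto simp: F1_def add_eq_0_iff)
  then show ?thesis by (simp add: F1_def F2_def)
qed

text \<open>Take \<open>v = w' 0\<close> in \<open>isometric_strip_chart\<close>: the curve
  \<open>F (\<i> * s)\<close> then starts at \<open>w 0\<close> with velocity \<open>w' 0\<close>.
  It satisfies the geodesic equation by the previous lemma, so uniqueness identifies it with
  \<open>w\<close> near 0.\<close>

lemma geodesic_strip_chart:
  assumes d: "d > 0" and U: "w 0 \<in> U"
    and w: "\<And>s. \<bar>s\<bar> < d \<Longrightarrow> (w has_vector_derivative w' s) (at s)"
      "\<And>s. \<bar>s\<bar> < d \<Longrightarrow> (w' has_vector_derivative - 2 * \<l> (w s) * (w' s)\<^sup>2) (at s)"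
    and unit: "\<rho> (w 0) * cmod (w' 0) = 1"
  shows "\<exists>r>0. r \<le> 1 \<and> r \<le> d \<and> (\<exists>F. F holomorphic_on ball 0 r \<and> inj_on F (ball 0 r) \<and> F ` ball 0 r \<subseteq> U \<and>
    (\<forall>w\<in>ball 0 r. \<rho> (F w) * cmod (deriv F w) = 1 / cos (Re w)) \<and>
    (\<forall>s. \<bar>s\<bar> < r \<longrightarrow> F (\<i> * complex_of_real s) = w s))"
proof -
  obtain r F where r: "r > 0" "r \<le> 1" and F: "F holomorphic_on ball 0 r" "inj_on F (ball 0 r)" "F ` ball 0 r \<subseteq> U"
      "F 0 = w 0" "deriv F 0 = - \<i> * w' 0" and iso: "\<And>w. w \<in> ball 0 r \<Longrightarrow> \<rho> (F w) * cmod (deriv F w) = 1 / cos (Re w)"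
    using isometric_strip_chart[OF U, of "w' 0"] unit by (auto simp: mult.commute)
  define e where "e = min d r"
  have in_ball: "\<i> * complex_of_real s \<in> ball 0 r" if "\<bar>s\<bar> < e" for s using that by (simp add: e_def norm_mult)
  define c where "c s = F (\<i> * complex_of_real s)" for s
  define c' where "c' s = \<i> * deriv F (\<i> * complex_of_real s)" for s
  have line: "((\<lambda>s. \<i> * complex_of_real s) has_vector_derivative \<i>) (at s)" for s
    by (auto intro!: derivative_eq_intros)
  have c1: "(c has_vector_derivative c' s) (at s)" if "\<bar>s\<bar> < e" for s
    unfolding c_def[abs_def] c'_def
    using field_vector_diff_chain_at[OF line holomorphic_derivI[OF F(1) open_ball in_ball[OF that]]] by (simp add: o_def)
  have c2: "(c' has_vector_derivative - 2 * \<l> (c s) * (c' s)\<^sup>2) (at s)" if "\<bar>s\<bar> < e" for s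
  proof -
    have "((\<lambda>s. deriv F (\<i> * complex_of_real s)) has_vector_derivative \<i> * deriv (deriv F) (\<i> * complex_of_real s)) (at s)"
      using field_vector_diff_chain_at[OF line holomorphic_derivI[OF holomorphic_deriv[OF F(1) open_ball] open_ball in_ball[OF that]]]
      by (simp add: o_def)
    then have "(c' has_vector_derivative \<i> * (\<i> * deriv (deriv F) (\<i> * complex_of_real s))) (at s)"
      unfolding c'_def[abs_def] by (rule has_vector_derivative_mult_right)
    moreover have "deriv (deriv F) (\<i> * complex_of_real s) = - 2 * \<l> (c s) * (deriv F (\<i> * complex_of_real s))\<^sup>2"
      unfolding c_def by (rule isometric_chart_second_derivative[OF F(1,3) iso in_ball[OF that] _ r(2)]) auto
    ultimately show ?thesis by (simp add: c'_def power_mult_distrib algebra_simps)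
  qed
  have "\<exists>e'>0. e' \<le> e \<and> (\<forall>s. \<bar>s\<bar> < e' \<longrightarrow> w s = c s)"
    by (rule second_order_ode_local_uniqueness[OF open_U U C1_log_factor, of e w w' c c'])
      (use d r w c1 c2 F in \<open>auto simp: e_def c_def c'_def\<close>)
  then obtain e' where e': "e' > 0" "e' \<le> e" "\<And>s. \<bar>s\<bar> < e' \<Longrightarrow> w s = c s" by blast
  have sub: "ball (0::complex) e' \<subseteq> ball 0 r" using e'(2) by (auto simp: e_def)
  show ?thesis
  proof (intro exI[of _ e'] conjI exI[of _ F] ballI)
    show "F holomorphic_on ball 0 e'" using F(1) sub holomorphic_on_subset by blast
    show "inj_on F (ball 0 e')" using F(2) sub inj_on_subset by blast
  qed (use e' r F iso sub in \<open>auto simp: e_def c_def\<close>)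
qed

end

section \<open>Strip charts along a closed geodesic\<close>

lemma dist_imaginary: "dist (\<i> * complex_of_real t) (\<i> * complex_of_real s) = \<bar>s - t\<bar>"
proof -
  have "\<i> * complex_of_real t - \<i> * complex_of_real s = \<i> * complex_of_real (t - s)" by (simp add: algebra_simps)
  then show ?thesis unfolding dist_norm by (simp add: norm_mult abs_minus_commute del: of_real_diff)
qed

lemma C_k_on_local:
  assumes "open S" "\<And>z. z \<in> S \<Longrightarrow> \<exists>T. open T \<and> z \<in> T \<and> C_k_on k T f"
  shows "C_k_on k S f"
  using assms(2)
proof (induction k arbitrary: f)
  case 0
  have "isCont f z" if z: "z \<in> S" for z
  proof -
    obtain T where "open T" "z \<in> T" "continuous_on T f" using 0[OF z] by auto
    then show ?thesis using continuous_on_eq_continuous_at by blast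
  qed
  then show ?case using assms(1) by (simp add: continuous_on_eq_continuous_at)
next
  case (Suc k)
  have "f differentiable (at z)" if z: "z \<in> S" for z
  proof -
    obtain T where T: "open T" "z \<in> T" "C_k_on (Suc k) T f" using Suc.prems[OF z] by blast
    then show ?thesis using differentiable_on_openD[OF _ T(1,2), of f] by simp
  qed
  moreover have "C_k_on k S (partial_x f)"
  proof (rule Suc.IH)
    fix z assume "z \<in> S"
    then obtain T where "open T" "z \<in> T" "C_k_on (Suc k) T f" using Suc.prems by blast
    then show "\<exists>T. open T \<and> z \<in> T \<and> C_k_on k T (partial_x f)" by auto
  qed
  moreover have "C_k_on k S (partial_y f)"
  proof (rule Suc.IH)
    fix z assume "z \<in> S"
    then obtain T where "open T" "z \<in> T" "C_k_on (Suc k) T f" using Suc.prems by blast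
    then show "\<exists>T. open T \<and> z \<in> T \<and> C_k_on k T (partial_y f)" by auto
  qed
  ultimately show ?case by (simp add: differentiable_on_eq_differentiable_at[OF assms(1)])
qed

section \<open>Charts and the identity theorem for maps into the surface\<close>

context compact_riemann_surface
begin

lemma chart_maps:
  assumes "\<kappa> \<in> A"
  shows "p \<in> chart_dom \<kappa> \<Longrightarrow> coord \<kappa> p \<in> chart_img \<kappa>" "p \<in> chart_dom \<kappa> \<Longrightarrow> param \<kappa> (coord \<kappa> p) = p"
    "z \<in> chart_img \<kappa> \<Longrightarrow> param \<kappa> z \<in> chart_dom \<kappa>" "z \<in> chart_img \<kappa> \<Longrightarrow> coord \<kappa> (param \<kappa> z) = z"
    "continuous_on (chart_dom \<kappa>) (coord \<kappa>)" "continuous_on (chart_img \<kappa>) (param \<kappa>)"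
  using chart_homeomorphism[OF assms] by (auto simp: homeomorphism_def)

lemma chart_dom_subset: "\<kappa> \<in> A \<Longrightarrow> chart_dom \<kappa> \<subseteq> Y"
  using cover by blast

lemma open_coord_image:
  assumes "\<kappa> \<in> A" "openin (top_of_set Y) V" "V \<subseteq> chart_dom \<kappa>"
  shows "open (coord \<kappa> ` V)"
proof -
  have "openin (top_of_set (chart_dom \<kappa>)) V"
    by (rule openin_subset_trans[OF assms(2,3) chart_dom_subset[OF assms(1)]])
  then show ?thesis
    by (rule openin_open_trans[OF homeomorphism_imp_open_map[OF chart_homeomorphism[OF assms(1)]] img_open[OF assms(1)]])
qed

lemma openin_param_image:
  assumes "\<kappa> \<in> A" "open V" "V \<subseteq> chart_img \<kappa>"
  shows "openin (top_of_set Y) (param \<kappa> ` V)"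
proof -
  have "openin (top_of_set (chart_img \<kappa>)) V" using assms by (simp add: open_subset)
  then have "openin (top_of_set (chart_dom \<kappa>)) (param \<kappa> ` V)"
    using homeomorphism_imp_open_map homeomorphism_sym chart_homeomorphism[OF assms(1)] by blast
  then show ?thesis using dom_open[OF assms(1)] openin_trans by blast
qed

lemma open_overlap:
  assumes "\<kappa> \<in> A" "\<kappa>' \<in> A" shows "open (coord \<kappa> ` (chart_dom \<kappa> \<inter> chart_dom \<kappa>'))"
  using assms by (intro open_coord_image openin_Int dom_open) auto

text \<open>\<open>f1\<close> and \<open>f2\<close> take values in different charts and can be
  compared directly only where these overlap. The limit points in \<open>D\<close> of the agreement
  set form a relatively closed set, and an open one because near such a point the transition map
  reduces the question to the classical identity theorem; connectedness of \<open>D\<close> does the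
  rest.\<close>

lemma chart_maps_agree:
  assumes k: "\<kappa>1 \<in> A" "\<kappa>2 \<in> A" and D: "open D" "connected D"
    and f1: "f1 holomorphic_on D" "f1 ` D \<subseteq> chart_img \<kappa>1"
    and f2: "f2 holomorphic_on D" "f2 ` D \<subseteq> chart_img \<kappa>2"
    and w0: "w0 \<in> D" "w0 islimpt {w \<in> D. param \<kappa>1 (f1 w) = param \<kappa>2 (f2 w)}"
    and w: "w \<in> D"
  shows "param \<kappa>1 (f1 w) = param \<kappa>2 (f2 w)"
proof -
  define H1 H2 where "H1 = (\<lambda>w. param \<kappa>1 (f1 w))" and "H2 = (\<lambda>w. param \<kappa>2 (f2 w))"
  define E where "E = {w \<in> D. H1 w = H2 w}"
  have c1: "continuous_on D f1" and c2: "continuous_on D f2"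
    using f1 f2 holomorphic_on_imp_continuous_on by blast+
  have cH: "continuous_on D H1" "continuous_on D H2" unfolding H1_def H2_def
    using continuous_on_compose2[OF chart_maps(6)[OF k(1)] c1 f1(2)] continuous_on_compose2[OF chart_maps(6)[OF k(2)] c2 f2(2)] by auto
  \<comment> \<open>Agreement passes to limit points because the ambient space is Hausdorff.\<close>
  have eq: "H1 w = H2 w" if w: "w \<in> D" "w islimpt E" for w
  proof (rule ccontr)
    assume ne: "H1 w \<noteq> H2 w"
    obtain U1 U2 where U: "open U1" "open U2" "H1 w \<in> U1" "H2 w \<in> U2" "U1 \<inter> U2 = {}"
      using hausdorff[OF ne] by auto
    have "open (D \<inter> H1 -` U1)" "open (D \<inter> H2 -` U2)"
      by (rule continuous_open_preimage[OF cH(1) D(1) U(1)], rule continuous_open_preimage[OF cH(2) D(1) U(2)])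
    then have op: "open ((D \<inter> H1 -` U1) \<inter> (D \<inter> H2 -` U2))" by (rule open_Int)
    have mem: "w \<in> (D \<inter> H1 -` U1) \<inter> (D \<inter> H2 -` U2)" using U w by simp
    obtain x where "x \<in> E" "x \<in> (D \<inter> H1 -` U1) \<inter> (D \<inter> H2 -` U2)"
      by (rule islimptE[OF w(2) mem op])
    then show False using U(5) by (auto simp: E_def)
  qed
  \<comment> \<open>At a limit point both maps have the same value, which lies in both charts, so
    nearby \<open>f2\<close> can be carried into the coordinate of \<open>f1\<close>.\<close>
  have near: "\<exists>e>0. ball w e \<subseteq> E" if w: "w \<in> D" "w islimpt E" for w
  proof -
    define V where "V = coord \<kappa>2 ` (chart_dom \<kappa>2 \<inter> chart_dom \<kappa>1)"
    have V: "open V" unfolding V_def using open_overlap k by blast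
    have d1: "H1 w \<in> chart_dom \<kappa>1" and d2: "H2 w \<in> chart_dom \<kappa>2"
      unfolding H1_def H2_def
      by (rule chart_maps(3)[OF k(1) subsetD[OF f1(2) imageI[OF w(1)]]], rule chart_maps(3)[OF k(2) subsetD[OF f2(2) imageI[OF w(1)]]])
    have "f2 w \<in> chart_img \<kappa>2" using f2(2) w(1) by blast
    then have "f2 w = coord \<kappa>2 (H2 w)" unfolding H2_def by (simp add: chart_maps(4)[OF k(2)])
    moreover have "H2 w \<in> chart_dom \<kappa>1" using d1 eq[OF w] by simp
    ultimately have "w \<in> D \<inter> f2 -` V" using d2 w(1) by (simp add: V_def)
    with continuous_open_preimage[OF c2 D(1) V] obtain e where e: "e > 0" "ball w e \<subseteq> D \<inter> f2 -` V"
      by (rule openE)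
    have "transition \<kappa>2 \<kappa>1 holomorphic_on V" unfolding V_def by (rule transition_holomorphic[OF k(2,1)])
    moreover have "f2 holomorphic_on ball w e" "f1 holomorphic_on ball w e"
      using f1(1) f2(1) e(2) holomorphic_on_subset[of _ D "ball w e"] by auto
    moreover have "f2 ` ball w e \<subseteq> V" using e(2) by auto
    ultimately have hol: "(\<lambda>z. transition \<kappa>2 \<kappa>1 (f2 z) - f1 z) holomorphic_on ball w e"
      using holomorphic_on_compose_gen[of f2 "ball w e" "transition \<kappa>2 \<kappa>1" V]
      by (intro holomorphic_on_diff) (simp_all add: o_def)
    have lim: "w islimpt E \<inter> ball w e"
      using w(2) e(1) by (intro islimpt_Int_eventually eventually_at_in_open') auto
    have zero: "transition \<kappa>2 \<kappa>1 (f2 z) - f1 z = 0" if "z \<in> E \<inter> ball w e" for z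
      using that chart_maps(4)[OF k(1), of "f1 z"] f1(2) by (auto simp: E_def H1_def H2_def transition_def)
    have all: "transition \<kappa>2 \<kappa>1 (f2 z) - f1 z = 0" if "z \<in> ball w e" for z
      by (rule analytic_continuation[OF hol open_ball connected_ball _ _ lim zero that]) (use e in auto)
    have "z \<in> E" if z: "z \<in> ball w e" for z
    proof -
      obtain q where q: "q \<in> chart_dom \<kappa>2" "q \<in> chart_dom \<kappa>1" "f2 z = coord \<kappa>2 q" using e z by (auto simp: V_def)
      have "H2 z = q" unfolding H2_def q(3) by (rule chart_maps(2)[OF k(2) q(1)])
      moreover have "f1 z = coord \<kappa>1 q" using all[OF z] \<open>H2 z = q\<close> by (simp add: transition_def H2_def)
      then have "H1 z = q" unfolding H1_def using chart_maps(2)[OF k(1) q(2)] by simp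
      ultimately show ?thesis using e z by (auto simp: E_def)
    qed
    then show ?thesis using e by blast
  qed
  define L where "L = D \<inter> {w. w islimpt E}"
  have "open L"
    unfolding open_contains_ball
  proof
    fix w assume "w \<in> L"
    then obtain e where e: "e > 0" "ball w e \<subseteq> E" using near unfolding L_def by blast
    have "ball w e \<subseteq> L"
    proof
      fix z assume z: "z \<in> ball w e"
      then have "z islimpt ball w e" using e by (simp add: islimpt_ball)
      then have "z islimpt E" using e(2) by (rule islimpt_subset)
      moreover have "z \<in> D" using z e(2) by (auto simp: E_def)
      ultimately show "z \<in> L" by (simp add: L_def)
    qed
    then show "\<exists>e>0. ball w e \<subseteq> L" using e by blast
  qed
  then have "openin (top_of_set D) L" by (simp add: L_def open_subset)
  moreover have "closedin (top_of_set D) L" unfolding L_def using closed_limpts by (rule closedin_closed_Int)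
  moreover have "w0 \<in> L" using w0 unfolding L_def E_def H1_def H2_def by blast
  ultimately have "L = D" using D(2) unfolding connected_clopen by blast
  then show ?thesis using eq[of w] w unfolding L_def H1_def H2_def by blast
qed

end

context compact_hyperbolic_surface
begin

lemma chart_hyperbolic_metric: "\<kappa> \<in> A \<Longrightarrow> hyperbolic_metric (conf_factor \<kappa>) (chart_img \<kappa>)"
  using img_open conf_factor_smooth conf_factor_pos curvature by (unfold_locales) (auto simp: smooth_on_def)

text \<open>A local isometry from the strip metric that carries the imaginary axis to
  \<open>\<gamma>\<close>, the imaginary part being arc length. By holomorphy the values on the axis
  determine the resulting map into \<open>Y\<close>, whatever the chart; this is what makes gluing
  possible.\<close>

definition strip_chart :: "(real \<Rightarrow> 'a) \<Rightarrow> real \<Rightarrow> real \<Rightarrow> 'a metric_chart \<Rightarrow> (complex \<Rightarrow> complex) \<Rightarrow> bool" where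
  "strip_chart \<gamma> t r \<kappa> F \<longleftrightarrow> \<kappa> \<in> A \<and> 0 < r \<and> r \<le> 1 \<and>
     F holomorphic_on ball (\<i> * complex_of_real t) r \<and> inj_on F (ball (\<i> * complex_of_real t) r) \<and>
     F ` ball (\<i> * complex_of_real t) r \<subseteq> chart_img \<kappa> \<and>
     (\<forall>w\<in>ball (\<i> * complex_of_real t) r. conf_factor \<kappa> (F w) * cmod (deriv F w) = 1 / cos (Re w)) \<and>
     (\<forall>s. \<bar>s - t\<bar> < r \<longrightarrow> \<gamma> s \<in> chart_dom \<kappa> \<and> F (\<i> * complex_of_real s) = coord \<kappa> (\<gamma> s))"

lemma strip_chart_translate:
  fixes a :: complex
  assumes F: "F holomorphic_on ball z0 r" "inj_on F (ball z0 r)"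
  defines "G \<equiv> \<lambda>w. F (w - a)"
  shows "G holomorphic_on ball (z0 + a) r" "inj_on G (ball (z0 + a) r)" "G ` ball (z0 + a) r = F ` ball z0 r"
    "w \<in> ball (z0 + a) r \<Longrightarrow> deriv G w = deriv F (w - a)"
proof -
  have b: "w \<in> ball (z0 + a) r \<longleftrightarrow> w - a \<in> ball z0 r" for w by (simp add: dist_norm algebra_simps)
  have d: "(G has_field_derivative deriv F (w - a)) (at w)" if "w \<in> ball (z0 + a) r" for w
  proof -
    have "((\<lambda>w. w - a) has_field_derivative 1) (at w)" by (auto intro!: derivative_eq_intros)
    from DERIV_chain2[where f = F, OF holomorphic_derivI[OF F(1) open_ball] this] that b show ?thesis by (simp add: G_def)
  qed
  then show "G holomorphic_on ball (z0 + a) r" using holomorphic_on_open[OF open_ball] by blast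
  show "w \<in> ball (z0 + a) r \<Longrightarrow> deriv G w = deriv F (w - a)" using d DERIV_imp_deriv by blast
  show "inj_on G (ball (z0 + a) r)" using F(2) b unfolding inj_on_def G_def by (metis diff_eq_eq)
  show "G ` ball (z0 + a) r = F ` ball z0 r"
  proof
    show "G ` ball (z0 + a) r \<subseteq> F ` ball z0 r" using b by (auto simp: G_def)
    have "F z = G (z + a)" "z + a \<in> ball (z0 + a) r" if "z \<in> ball z0 r" for z
      using that by (auto simp: G_def dist_norm)
    then show "F ` ball z0 r \<subseteq> G ` ball (z0 + a) r" by blast
  qed
qed

text \<open>Time is shifted so that the base point becomes 0, \<open>geodesic_strip_chart\<close> is
  applied in one chart around \<open>\<gamma> t\<close>, and the coordinate is shifted back by
  \<open>\<i> * t\<close>.\<close>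

lemma exists_strip_chart:
  assumes "closed_geodesic Y A \<gamma> L"
  shows "\<exists>r \<kappa> F. strip_chart \<gamma> t r \<kappa> F"
proof -
  have gY: "\<gamma> s \<in> Y" and gc: "continuous_on UNIV \<gamma>" for s using assms by (auto simp: closed_geodesic_def)
  obtain \<kappa> where k: "\<kappa> \<in> A" "\<gamma> t \<in> chart_dom \<kappa>" using cover gY by blast
  interpret hyperbolic_metric "conf_factor \<kappa>" "chart_img \<kappa>" by (rule chart_hyperbolic_metric[OF k(1)])
  obtain T where T: "open T" "chart_dom \<kappa> = Y \<inter> T" using dom_open[OF k(1)] by (auto simp: openin_open)
  have "open (\<gamma> -` T)" using gc T(1) by (rule open_vimage[rotated])
  then obtain d where d: "d > 0" "ball t d \<subseteq> \<gamma> -` T" using k(2) T(2) openE[of "\<gamma> -` T" t] by blast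
  have in_dom: "\<gamma> (t + s) \<in> chart_dom \<kappa>" if "\<bar>s\<bar> < d" for s
    using d(2) that T(2) gY by (auto simp: dist_real_def subset_iff)
  define w where "w s = coord \<kappa> (\<gamma> (t + s))" for s
  define w' where "w' s = vector_derivative (coord \<kappa> \<circ> \<gamma>) (at (t + s))" for s
  have geo: "(coord \<kappa> \<circ> \<gamma>) differentiable (at (t + s))" "conf_factor \<kappa> (w s) * cmod (w' s) = 1"
     "((\<lambda>s. vector_derivative (coord \<kappa> \<circ> \<gamma>) (at s)) has_vector_derivative
        - 2 * log_factor_dw (conf_factor \<kappa>) (w s) * (w' s)\<^sup>2) (at (t + s))" if "\<bar>s\<bar> < d" for s
    using assms k(1) in_dom[OF that] unfolding closed_geodesic_def Let_def w_def w'_def by auto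
  have sh: "((\<lambda>s. t + s) has_vector_derivative 1) (at s)" for s by (auto intro!: derivative_eq_intros)
  have w1: "(w has_vector_derivative w' s) (at s)" if "\<bar>s\<bar> < d" for s
    using vector_diff_chain_at[OF sh vector_derivative_works[THEN iffD1, OF geo(1)[OF that]]]
    by (simp add: w_def[abs_def] w'_def o_def)
  have w2: "(w' has_vector_derivative - 2 * log_factor_dw (conf_factor \<kappa>) (w s) * (w' s)\<^sup>2) (at s)" if "\<bar>s\<bar> < d" for s
    using vector_diff_chain_at[OF sh geo(3)[OF that]] by (simp add: w'_def[abs_def] o_def)
  have w0: "w 0 \<in> chart_img \<kappa>" using chart_maps(1)[OF k] by (simp add: w_def)
  obtain r F where r: "r > 0" "r \<le> 1" "r \<le> d" and F: "F holomorphic_on ball 0 r" "inj_on F (ball 0 r)" "F ` ball 0 r \<subseteq> chart_img \<kappa>"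
     "\<And>w. w \<in> ball 0 r \<Longrightarrow> conf_factor \<kappa> (F w) * cmod (deriv F w) = 1 / cos (Re w)"
     "\<And>s. \<bar>s\<bar> < r \<Longrightarrow> F (\<i> * complex_of_real s) = w s"
    using geodesic_strip_chart[OF d(1) w0 w1 w2] geo(2)[of 0] d(1) by auto
  note tr = strip_chart_translate[OF F(1,2), where a = "\<i> * complex_of_real t", unfolded add_0_left]
  have "F (\<i> * complex_of_real s - \<i> * complex_of_real t) = coord \<kappa> (\<gamma> s)" if "\<bar>s - t\<bar> < r" for s
    using F(5)[OF that] by (simp add: w_def algebra_simps)
  moreover have "\<gamma> s \<in> chart_dom \<kappa>" if "\<bar>s - t\<bar> < r" for s using in_dom[of "s - t"] that r by simp
  moreover have "conf_factor \<kappa> (F (z - \<i> * complex_of_real t)) * cmod (deriv (\<lambda>w. F (w - \<i> * complex_of_real t)) z) = 1 / cos (Re z)"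
    if z: "z \<in> ball (\<i> * complex_of_real t) r" for z
    using F(4)[of "z - \<i> * complex_of_real t"] z tr(4)[OF z] by (simp add: dist_norm norm_minus_commute)
  ultimately have "strip_chart \<gamma> t r \<kappa> (\<lambda>w. F (w - \<i> * complex_of_real t))"
    unfolding strip_chart_def using k(1) r tr(1,2,3) F(3) by auto
  then show ?thesis by blast
qed

text \<open>Both sides equal \<open>\<gamma>\<close> on the imaginary axis, which supplies a limit
  point of agreement. The common domain is convex as an intersection of discs, so
  \<open>chart_maps_agree\<close> spreads the agreement to all of it.\<close>

lemma strip_chart_agree:
  assumes "strip_chart \<gamma> t1 r1 \<kappa>1 F1" "strip_chart \<gamma> t2 r2 \<kappa>2 F2"
    and w: "w \<in> ball (\<i> * complex_of_real t1) r1" "w \<in> ball (\<i> * complex_of_real t2) r2"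
  shows "param \<kappa>1 (F1 w) = param \<kappa>2 (F2 w)"
proof -
  define D where "D = ball (\<i> * complex_of_real t1) r1 \<inter> ball (\<i> * complex_of_real t2) r2"
  have D: "open D" "connected D" unfolding D_def by (auto intro: convex_connected convex_Int)
  \<comment> \<open>The projection of \<open>w\<close> to the imaginary axis is no farther from the
    two centres than \<open>w\<close> itself.\<close>
  define w0 where "w0 = \<i> * complex_of_real (Im w)"
  have bd: "\<bar>Im w - t\<bar> < r" if "w \<in> ball (\<i> * complex_of_real t) r" for t r
    using abs_Im_le_cmod[of "w - \<i> * complex_of_real t"] that by (simp add: dist_norm norm_minus_commute)
  note nn = dist_imaginary
  have w0: "w0 \<in> D" using bd[OF w(1)] bd[OF w(2)] by (simp add: w0_def D_def nn)
  have agree: "param \<kappa>1 (F1 (\<i> * complex_of_real s)) = param \<kappa>2 (F2 (\<i> * complex_of_real s))" if "\<i> * complex_of_real s \<in> D" for s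
    using that assms(1,2) chart_maps(2) by (auto simp: D_def nn strip_chart_def)
  have "w0 islimpt {w \<in> D. param \<kappa>1 (F1 w) = param \<kappa>2 (F2 w)}"
    unfolding islimpt_approachable
  proof (intro allI impI)
    fix e :: real assume e: "e > 0"
    obtain e' where e': "e' > 0" "ball w0 e' \<subseteq> D" using D(1) w0 openE by blast
    define s where "s = Im w + min e e' / 2"
    have ds: "dist w0 (\<i> * complex_of_real s) = min e e' / 2" unfolding w0_def nn using e e' by (simp add: s_def)
    then have "\<i> * complex_of_real s \<in> D" using e' e by (intro subsetD[OF e'(2)]) auto
    moreover have "dist (\<i> * complex_of_real s) w0 < e" "\<i> * complex_of_real s \<noteq> w0" using ds e e' by (auto simp: dist_commute)
    ultimately show "\<exists>x'\<in>{w \<in> D. param \<kappa>1 (F1 w) = param \<kappa>2 (F2 w)}. x' \<noteq> w0 \<and> dist x' w0 < e"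
      using agree by (intro bexI[of _ "\<i> * complex_of_real s"]) auto
  qed
  note lim = this
  have hol: "F1 holomorphic_on D" "F2 holomorphic_on D" "F1 ` D \<subseteq> chart_img \<kappa>1" "F2 ` D \<subseteq> chart_img \<kappa>2"
    using assms(1,2) by (auto simp: strip_chart_def D_def intro: holomorphic_on_subset)
  have "w \<in> D" "\<kappa>1 \<in> A" "\<kappa>2 \<in> A" using assms by (auto simp: strip_chart_def D_def)
  then show ?thesis using chart_maps_agree[OF _ _ D hol(1,3) hol(2,4) w0 lim] by blast
qed

lemma strip_chart_shrink:
  assumes "strip_chart \<gamma> t r \<kappa> F" "0 < r'" "\<bar>t' - t\<bar> + r' \<le> r"
  shows "strip_chart \<gamma> t' r' \<kappa> F"
proof -
  have sub: "ball (\<i> * complex_of_real t') r' \<subseteq> ball (\<i> * complex_of_real t) r"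
  proof -
    have d: "dist (\<i> * complex_of_real t') (\<i> * complex_of_real t) + r' \<le> r"
      using assms(3) unfolding dist_imaginary by (simp add: abs_minus_commute)
    show ?thesis
    proof
      fix z assume "z \<in> ball (\<i> * complex_of_real t') r'"
      then show "z \<in> ball (\<i> * complex_of_real t) r"
        using d dist_triangle[of "\<i> * complex_of_real t" z "\<i> * complex_of_real t'"] by (simp add: dist_commute)
    qed
  qed
  have lt: "\<bar>s - t\<bar> < r" if "\<bar>s - t'\<bar> < r'" for s using that assms(3) by linarith
  have "r' \<le> r" using assms(3) by linarith
  moreover note a = assms(1)[unfolded strip_chart_def]
  moreover have "F holomorphic_on ball (\<i> * complex_of_real t') r'" "inj_on F (ball (\<i> * complex_of_real t') r')"
    "F ` ball (\<i> * complex_of_real t') r' \<subseteq> chart_img \<kappa>"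
    using a holomorphic_on_subset[OF _ sub, of F] inj_on_subset[OF _ sub, of F] image_mono[OF sub, of F] by auto
  ultimately show ?thesis unfolding strip_chart_def using assms(2) subsetD[OF sub] lt by simp
qed

lemma strip_chart_periodic:
  assumes g: "\<And>t. \<gamma> (t + L) = \<gamma> t" and sc: "strip_chart \<gamma> t r \<kappa> F"
  shows "strip_chart \<gamma> (t + L) r \<kappa> (\<lambda>w. F (w - \<i> * complex_of_real L))"
proof -
  have F: "F holomorphic_on ball (\<i> * complex_of_real t) r" "inj_on F (ball (\<i> * complex_of_real t) r)"
    using sc by (auto simp: strip_chart_def)
  note tr = strip_chart_translate[OF F, where a = "\<i> * complex_of_real L"]
  have c: "\<i> * complex_of_real (t + L) = \<i> * complex_of_real t + \<i> * complex_of_real L" by (simp add: algebra_simps)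
  have iso: "conf_factor \<kappa> (F (z - \<i> * complex_of_real L)) * cmod (deriv (\<lambda>w. F (w - \<i> * complex_of_real L)) z) = 1 / cos (Re z)"
    if z: "z \<in> ball (\<i> * complex_of_real t + \<i> * complex_of_real L) r" for z
  proof -
    have "z - \<i> * complex_of_real L \<in> ball (\<i> * complex_of_real t) r" using z by (simp add: dist_norm algebra_simps)
    then have "conf_factor \<kappa> (F (z - \<i> * complex_of_real L)) * cmod (deriv F (z - \<i> * complex_of_real L)) = 1 / cos (Re (z - \<i> * complex_of_real L))"
      using sc unfolding strip_chart_def by blast
    then show ?thesis unfolding tr(4)[OF z] by simp
  qed
  have "\<gamma> s \<in> chart_dom \<kappa> \<and> F (\<i> * complex_of_real s - \<i> * complex_of_real L) = coord \<kappa> (\<gamma> s)" if "\<bar>s - (t + L)\<bar> < r" for s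
  proof -
    have "\<bar>(s - L) - t\<bar> < r" using that by (simp add: algebra_simps)
    then have "\<gamma> (s - L) \<in> chart_dom \<kappa> \<and> F (\<i> * complex_of_real (s - L)) = coord \<kappa> (\<gamma> (s - L))"
      using sc unfolding strip_chart_def by blast
    then show ?thesis using g[of "s - L"] by (simp add: right_diff_distrib)
  qed
  then show ?thesis using sc tr(1-3) iso unfolding strip_chart_def c by auto
qed

text \<open>Compactness of one period gives a common radius, and \<open>strip_chart_periodic\<close>
  carries the charts to all other periods.\<close>

lemma uniform_strip_chart:
  assumes geo: "closed_geodesic Y A \<gamma> L"
  shows "\<exists>r>0. \<forall>t. \<exists>\<kappa> F. strip_chart \<gamma> t r \<kappa> F"
proof -
  have L: "L > 0" and per: "\<gamma> (t + L) = \<gamma> t" for t using geo by (auto simp: closed_geodesic_def)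
  obtain R K F where R: "\<And>t. strip_chart \<gamma> t (R t) (K t) (F t)" using exists_strip_chart[OF geo] by metis
  have Rpos: "R t > 0" for t using R[of t] by (simp add: strip_chart_def)
  have "compact {0..L}" by simp
  \<comment> \<open>Half radii: around a point within \<open>R c / 2\<close> of a centre
    \<open>c\<close>, a disc of radius \<open>R c / 2\<close> still fits into the disc of the chart
    at \<open>c\<close>.\<close>
  moreover have "{0..L} \<subseteq> (\<Union>t\<in>{0..L}. ball t (R t / 2))" using Rpos by force
  ultimately obtain C where C: "C \<subseteq> {0..L}" "finite C" "{0..L} \<subseteq> (\<Union>t\<in>C. ball t (R t / 2))"
    using compactE_image[of "{0..L}" "{0..L}" "\<lambda>t. ball t (R t / 2)"] by auto
  have "C \<noteq> {}" using C(3) L by force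
  define r where "r = Min ((\<lambda>t. R t / 2) ` C)"
  have r: "r > 0" unfolding r_def using C(2) \<open>C \<noteq> {}\<close> Rpos by (subst Min_gr_iff) auto
  have base: "\<exists>\<kappa> F. strip_chart \<gamma> t r \<kappa> F" if "t \<in> {0..L}" for t
  proof -
    have "t \<in> (\<Union>t\<in>C. ball t (R t / 2))" using C(3) that by blast
    then obtain c where c: "c \<in> C" "t \<in> ball c (R c / 2)" by blast
    have "r \<le> R c / 2" unfolding r_def using c C(2) by (intro Min_le) auto
    moreover have "\<bar>t - c\<bar> < R c / 2" using c(2) by (simp add: dist_real_def abs_minus_commute)
    ultimately have "\<bar>t - c\<bar> + r \<le> R c" by linarith
    then have "strip_chart \<gamma> t r (K c) (F c)" by (rule strip_chart_shrink[OF R r])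
    then show ?thesis by blast
  qed
  have up: "\<exists>\<kappa> F. strip_chart \<gamma> (t + real n * L) r \<kappa> F" if "t \<in> {0..L}" for n t
  proof (induction n)
    case (Suc n)
    then obtain \<kappa> F where "strip_chart \<gamma> (t + real n * L) r \<kappa> F" by blast
    from strip_chart_periodic[OF per this] show ?case by (auto simp: algebra_simps)
  qed (use base[OF that] in simp)
  have per': "\<gamma> (t + - L) = \<gamma> t" for t using per[of "t - L"] by simp
  have down: "\<exists>\<kappa> F. strip_chart \<gamma> (t - real n * L) r \<kappa> F" if "t \<in> {0..L}" for n t
  proof (induction n)
    case (Suc n)
    then obtain \<kappa> F where "strip_chart \<gamma> (t - real n * L) r \<kappa> F" by blast
    from strip_chart_periodic[OF per' this] show ?case by (auto simp: algebra_simps)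
  qed (use base[OF that] in simp)
  have "\<exists>\<kappa> F. strip_chart \<gamma> t r \<kappa> F" for t
  proof -
    \<comment> \<open>Reduction of \<open>t\<close> modulo \<open>L\<close>; the sign of
      \<open>k\<close> decides between \<open>up\<close> and \<open>down\<close>.\<close>
    define k where "k = \<lfloor>t / L\<rfloor>"
    define t0 where "t0 = t - real_of_int k * L"
    have "real_of_int k \<le> t / L" "t / L < real_of_int k + 1" unfolding k_def by linarith+
    then have t0: "t0 \<in> {0..L}" using L by (auto simp: t0_def field_simps)
    show ?thesis
    proof (cases "k \<ge> 0")
      case True
      then have "t = t0 + real (nat k) * L" by (simp add: t0_def)
      then show ?thesis using up[OF t0, of "nat k"] by simp
    next
      case False
      then have "t = t0 - real (nat (- k)) * L" by (simp add: t0_def)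
      then show ?thesis using down[OF t0, of "nat (- k)"] by simp
    qed
  qed
  then show ?thesis using r by blast
qed

end

section \<open>The cylinder around a closed geodesic\<close>

text \<open>The first component of a pair becomes the imaginary part: pairs are written
  \<open>(t, x)\<close>, as in the rectangles of the next lemma.\<close>

lemma lborel_distr_Complex: "distr lborel borel (\<lambda>p. Complex (snd p) (fst p)) = lborel"
proof (rule lborel_eqI[symmetric])
  let ?f = "\<lambda>p::real \<times> real. Complex (snd p) (fst p)"
  have m: "?f \<in> borel_measurable borel"
    by (intro borel_measurable_continuous_onI continuous_intros)
  fix l u :: complex assume le: "\<And>b. b \<in> Basis \<Longrightarrow> l \<bullet> b \<le> u \<bullet> b"
  have le': "Re l \<le> Re u" "Im l \<le> Im u" using le[of 1] le[of \<i>] by (auto simp: Basis_complex_def)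
  have pre: "?f -` box l u = {Im l<..<Im u} \<times> {Re l<..<Re u}"
    by (auto simp: box_def Basis_complex_def)
  have "emeasure (distr lborel borel ?f) (box l u) = emeasure lborel ({Im l<..<Im u} \<times> {Re l<..<Re u})"
    using m by (subst emeasure_distr) (auto simp: pre)
  also have "\<dots> = emeasure (lborel \<Otimes>\<^sub>M lborel) ({Im l<..<Im u} \<times> {Re l<..<Re u})"
    by (simp add: lborel_prod)
  also have "\<dots> = emeasure lborel {Im l<..<Im u} * emeasure lborel {Re l<..<Re u}"
    by (rule lborel.emeasure_pair_measure_Times) auto
  also have "\<dots> = ennreal ((Im u - Im l) * (Re u - Re l))"
    using le' by (simp add: ennreal_mult)
  also have "\<dots> = (\<Prod>b\<in>Basis. (u - l) \<bullet> b)" by (simp add: Basis_complex_def mult.commute)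
  finally show "emeasure (distr lborel borel ?f) (box l u) = (\<Prod>b\<in>Basis. (u - l) \<bullet> b)" .
qed simp

text \<open>Passage from iterated gauge integrals over a rectangle to the Lebesgue integral over an
  open set, in which the mass of an eigenfunction is measured.\<close>

lemma iterated_integral_le_nn_integral:
  fixes f :: "complex \<Rightarrow> real"
  assumes S: "open S" "continuous_on S f" "\<And>w. w \<in> S \<Longrightarrow> 0 \<le> f w"
    and sub: "\<And>x t. x \<in> {a..b} \<Longrightarrow> t \<in> {c..d} \<Longrightarrow> Complex x t \<in> S"
  shows "ennreal (integral {c..d} (\<lambda>t. integral {a..b} (\<lambda>x. f (Complex x t)))) \<le> (\<integral>\<^sup>+w\<in>S. ennreal (f w) \<partial>lborel)"
proof -
  define R where "R = cbox (c, a) (d, b)"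
  define g where "g p = f (Complex (snd p) (fst p))" for p
  have mem: "Complex (snd p) (fst p) \<in> S" if "p \<in> R" for p
    using that sub by (auto simp: R_def cbox_Pair_eq)
  have cg: "continuous_on R g" unfolding g_def
    by (rule continuous_on_compose2[OF S(2)]) (auto intro!: continuous_intros mem)
  have "integral R g = integral {c..d} (\<lambda>t. integral {a..b} (\<lambda>x. f (Complex x t)))"
    unfolding R_def by (subst integral_prod_continuous) (use cg in \<open>auto simp: R_def g_def\<close>)
  moreover have "ennreal (integral R g) = (\<integral>\<^sup>+p\<in>R. ennreal (g p) \<partial>lborel)"
  proof -
    have "(g has_integral integral R g) R" using cg unfolding R_def by (intro integrable_integral integrable_continuous)
    then have "((\<lambda>p. if p \<in> R then g p else 0) has_integral integral R g) UNIV"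
      by (simp add: has_integral_restrict_UNIV)
    then have "integral\<^sup>N lebesgue (\<lambda>p. ennreal (if p \<in> R then g p else 0)) = ennreal (integral R g)"
      by (subst (asm) has_integral_iff_nn_integral_lebesgue) (auto simp: g_def intro: S(3) mem)
    then have "ennreal (integral R g) = (\<integral>\<^sup>+p. ennreal (if p \<in> R then g p else 0) \<partial>lborel)"
      by (simp add: nn_integral_completion)
    also have "\<dots> = (\<integral>\<^sup>+p\<in>R. ennreal (g p) \<partial>lborel)" by (intro nn_integral_cong) (auto simp: indicator_def)
    finally show ?thesis .
  qed
  moreover have "(\<integral>\<^sup>+p\<in>R. ennreal (g p) \<partial>lborel) \<le> (\<integral>\<^sup>+w\<in>S. ennreal (f w) \<partial>lborel)"
  proof -
    have m: "(\<lambda>p::real \<times> real. Complex (snd p) (fst p)) \<in> borel_measurable borel"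
      by (intro borel_measurable_continuous_onI continuous_intros)
    have "(\<lambda>w. indicator S w *\<^sub>R f w) \<in> borel_measurable borel"
      using borel_measurable_continuous_on_indicator[OF borel_open[OF S(1)] S(2)] .
    from measurable_compose[OF this measurable_ennreal]
    have fm: "(\<lambda>w. ennreal (f w) * indicator S w) \<in> borel_measurable borel"
      by (rule measurable_cong[THEN iffD1, rotated]) (auto simp: indicator_def)
    have "(\<integral>\<^sup>+p\<in>R. ennreal (g p) \<partial>lborel) \<le> (\<integral>\<^sup>+p. ennreal (f (Complex (snd p) (fst p))) * indicator S (Complex (snd p) (fst p)) \<partial>lborel)"
      by (intro nn_integral_mono) (auto simp: g_def indicator_def mem)
    also have "\<dots> = (\<integral>\<^sup>+w. ennreal (f w) * indicator S w \<partial>distr lborel borel (\<lambda>p. Complex (snd p) (fst p)))"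
      using fm m by (subst nn_integral_distr) auto
    also have "\<dots> = (\<integral>\<^sup>+w\<in>S. ennreal (f w) \<partial>lborel)" by (simp only: lborel_distr_Complex)
    finally show ?thesis .
  qed
  ultimately show ?thesis by simp
qed

context compact_hyperbolic_surface
begin

text \<open>The volume is a supremum of the chart measures, so the mass seen in one chart is at most
  the total mass 1.\<close>

lemma chart_L2_bound:
  assumes k: "\<kappa> \<in> A" and norm: "L2_norm_on Y A \<phi> = 1"
  shows "(\<integral>\<^sup>+z\<in>chart_img \<kappa>. ennreal ((cmod (\<phi> (param \<kappa> z)))\<^sup>2 * (conf_factor \<kappa> z)\<^sup>2) \<partial>lborel) \<le> 1"
proof -
  define M where "M = volume Y A"
  define N where "N = chart_volume Y \<kappa>"
  have sN: "sets (chart_volume Y \<kappa>') = sets (restrict_space borel Y)" for \<kappa>' by (simp add: chart_volume_def)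
  have sM: "sets M = sets (restrict_space borel Y)"
    unfolding M_def volume_def using k by (intro sets_SUP sN) auto
  have "N \<le> M" unfolding M_def N_def volume_def using k by (rule SUP_upper)
  have I: "(\<integral>p. (cmod (\<phi> p))\<^sup>2 \<partial>M) = 1" using norm by (simp add: L2_norm_on_def M_def)
  \<comment> \<open>A function that is not integrable has integral 0 by convention; the value 1
    therefore proves integrability, and with it measurability.\<close>
  then have int: "integrable M (\<lambda>p. (cmod (\<phi> p))\<^sup>2)" using not_integrable_integral_eq by fastforce
  have "(\<integral>\<^sup>+p. ennreal ((cmod (\<phi> p))\<^sup>2) \<partial>M) = 1"
    using nn_integral_eq_integral[OF int] I by simp
  then have le: "(\<integral>\<^sup>+p. ennreal ((cmod (\<phi> p))\<^sup>2) \<partial>N) \<le> 1"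
    using nn_integral_mono_measure[OF _ \<open>N \<le> M\<close>, of "\<lambda>p. ennreal ((cmod (\<phi> p))\<^sup>2)"] sN sM by (simp add: N_def)
  have hm: "(\<lambda>p. ennreal ((cmod (\<phi> p))\<^sup>2)) \<in> borel_measurable (restrict_space borel Y)"
  proof -
    have "(\<lambda>p. (cmod (\<phi> p))\<^sup>2) \<in> borel_measurable M" using int by auto
    then have "(\<lambda>p. (cmod (\<phi> p))\<^sup>2) \<in> borel_measurable (restrict_space borel Y)"
      using measurable_cong_sets[OF sM refl] by blast
    then show ?thesis by (rule measurable_compose[OF _ measurable_ennreal])
  qed
  have om: "chart_img \<kappa> \<in> sets borel" using img_open[OF k] by simp
  have pm: "param \<kappa> \<in> measurable (restrict_space borel (chart_img \<kappa>)) (restrict_space borel Y)"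
    by (intro measurable_restrict_space2 borel_measurable_continuous_on_restrict chart_maps(6)[OF k])
      (use chart_maps(3)[OF k] chart_dom_subset[OF k] in \<open>auto simp: space_restrict_space\<close>)
  have sl: "sets (restrict_space lborel (chart_img \<kappa>)) = sets (restrict_space borel (chart_img \<kappa>))"
    by (intro sets_restrict_space_cong) simp
  have rm: "(\<lambda>z. ennreal ((conf_factor \<kappa> z)\<^sup>2)) \<in> borel_measurable (restrict_space lborel (chart_img \<kappa>))"
  proof -
    have "C_k_on 0 (chart_img \<kappa>) (conf_factor \<kappa>)" using conf_factor_smooth[OF k] unfolding smooth_on_def by blast
    then have "continuous_on (chart_img \<kappa>) (\<lambda>z. (conf_factor \<kappa> z)\<^sup>2)" by (auto intro: continuous_intros)
    from borel_measurable_continuous_on_restrict[OF this]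
    have "(\<lambda>z. ennreal ((conf_factor \<kappa> z)\<^sup>2)) \<in> borel_measurable (restrict_space borel (chart_img \<kappa>))"
      by (rule measurable_compose[OF _ measurable_ennreal])
    then show ?thesis using measurable_cong_sets[OF sl refl] by blast
  qed
  have pm': "param \<kappa> \<in> measurable (restrict_space lborel (chart_img \<kappa>)) (restrict_space borel Y)"
    using pm measurable_cong_sets[OF sl refl] by blast
  then have pm'': "param \<kappa> \<in> measurable (density (restrict_space lborel (chart_img \<kappa>)) (\<lambda>z. ennreal ((conf_factor \<kappa> z)\<^sup>2))) (restrict_space borel Y)"
    by simp
  have "(\<integral>\<^sup>+p. ennreal ((cmod (\<phi> p))\<^sup>2) \<partial>N) =
     (\<integral>\<^sup>+z. ennreal ((conf_factor \<kappa> z)\<^sup>2) * ennreal ((cmod (\<phi> (param \<kappa> z)))\<^sup>2) \<partial>restrict_space lborel (chart_img \<kappa>))"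
  proof -
    have "(\<lambda>p. ennreal ((cmod (\<phi> p))\<^sup>2)) \<in> borel_measurable (distr (density (restrict_space lborel (chart_img \<kappa>))
        (\<lambda>z. ennreal ((conf_factor \<kappa> z)\<^sup>2))) (restrict_space borel Y) (param \<kappa>))" using hm by simp
    then show ?thesis unfolding N_def chart_volume_def
      by (subst nn_integral_distr[OF pm'']) (auto intro: nn_integral_density[OF rm measurable_compose[OF pm' hm]])
  qed
  also have "\<dots> = (\<integral>\<^sup>+z\<in>chart_img \<kappa>. ennreal ((cmod (\<phi> (param \<kappa> z)))\<^sup>2 * (conf_factor \<kappa> z)\<^sup>2) \<partial>lborel)"
    using om by (subst nn_integral_restrict_space) (simp_all add: ennreal_mult mult.commute)
  finally show ?thesis using le by simp
qed

lemma eigenfunction_chart: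
  assumes "eigenfunction A \<phi> \<mu>" "\<kappa> \<in> A"
  shows "C_k_on n (chart_img \<kappa>) (\<lambda>z. \<phi> (param \<kappa> z))"
    "z \<in> chart_img \<kappa> \<Longrightarrow> flat_laplacian (\<lambda>z. \<phi> (param \<kappa> z)) z = - complex_of_real (\<mu> * (conf_factor \<kappa> z)\<^sup>2) * \<phi> (param \<kappa> z)"
proof -
  show "C_k_on n (chart_img \<kappa>) (\<lambda>z. \<phi> (param \<kappa> z))"
    using assms by (simp add: eigenfunction_def smooth_on_def o_def)
  assume z: "z \<in> chart_img \<kappa>"
  have "laplace_beltrami \<kappa> \<phi> (param \<kappa> z) = complex_of_real \<mu> * \<phi> (param \<kappa> z)"
    using assms chart_maps(3)[OF assms(2) z] by (simp add: eigenfunction_def)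
  then have "- flat_laplacian (\<lambda>z. \<phi> (param \<kappa> z)) z = complex_of_real (\<mu> * (conf_factor \<kappa> z)\<^sup>2) * \<phi> (param \<kappa> z)"
    using conf_factor_pos[OF assms(2) z] chart_maps(4)[OF assms(2) z]
    by (simp add: laplace_beltrami_def o_def field_simps)
  then show "flat_laplacian (\<lambda>z. \<phi> (param \<kappa> z)) z = - complex_of_real (\<mu> * (conf_factor \<kappa> z)\<^sup>2) * \<phi> (param \<kappa> z)"
    by (metis minus_minus mult_minus_left)
qed

text \<open>The strip charts glued to one map on \<open>|Re w| < r\<close>. No injectivity is
  demanded: the geodesic may cross itself and \<open>L\<close> need not be its least period, so mass
  will be controlled only on discs centred on the axis, where \<open>H\<close> comes from a single
  chart.\<close>

definition cylinder_map :: "(real \<Rightarrow> 'a) \<Rightarrow> real \<Rightarrow> real \<Rightarrow> (complex \<Rightarrow> 'a) \<Rightarrow> bool" where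
  "cylinder_map \<gamma> L r H \<longleftrightarrow> 0 < r \<and> r \<le> 1 \<and> (\<forall>t. H (\<i> * complex_of_real t) = \<gamma> t) \<and>
     (\<forall>w. \<bar>Re w\<bar> < r \<longrightarrow> H (w + \<i> * complex_of_real L) = H w) \<and>
     (\<forall>t. \<exists>\<kappa> F. strip_chart \<gamma> t r \<kappa> F \<and> (\<forall>w\<in>ball (\<i> * complex_of_real t) r. H w = param \<kappa> (F w)))"

text \<open>At \<open>w\<close> the chart centred at the same height is used. By
  \<open>strip_chart_agree\<close> every other strip chart covering \<open>w\<close> gives the same
  point, so the choices do not matter; periodicity follows by comparison with a chart translated by
  \<open>\<i> * L\<close>.\<close>

lemma exists_cylinder_map:
  assumes geo: "closed_geodesic Y A \<gamma> L"
  shows "\<exists>r H. cylinder_map \<gamma> L r H"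
proof -
  have per: "\<gamma> (t + L) = \<gamma> t" for t using geo by (auto simp: closed_geodesic_def)
  obtain r K F where r: "r > 0" and KF: "\<And>t. strip_chart \<gamma> t r (K t) (F t)"
    using uniform_strip_chart[OF geo] by metis
  define H where "H w = param (K (Im w)) (F (Im w) w)" for w
  have own: "w \<in> ball (\<i> * complex_of_real (Im w)) r" if "\<bar>Re w\<bar> < r" for w
  proof -
    have "w - \<i> * complex_of_real (Im w) = complex_of_real (Re w)" by (simp add: complex_eq_iff)
    then show ?thesis using that by (simp add: dist_norm norm_minus_commute)
  qed
  have Re_ball: "\<bar>Re w\<bar> < r" if "w \<in> ball (\<i> * complex_of_real t) r" for w t
    using that abs_Re_le_cmod[of "w - \<i> * complex_of_real t"] by (simp add: dist_norm norm_minus_commute)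
  have H: "H w = param \<kappa> (G w)" if "strip_chart \<gamma> t r \<kappa> G" "w \<in> ball (\<i> * complex_of_real t) r" for t \<kappa> G w
    unfolding H_def by (rule strip_chart_agree[OF KF that(1) own[OF Re_ball[OF that(2)]] that(2)])
  have r1: "r \<le> 1" using KF[of 0] by (simp add: strip_chart_def)
  have "H (\<i> * complex_of_real t) = \<gamma> t" for t
  proof -
    have "\<gamma> t \<in> chart_dom (K t)" "F t (\<i> * complex_of_real t) = coord (K t) (\<gamma> t)" "K t \<in> A"
      using KF[of t] r by (auto simp: strip_chart_def)
    then show ?thesis by (simp add: H_def chart_maps(2))
  qed
  moreover have "H (w + \<i> * complex_of_real L) = H w" if w: "\<bar>Re w\<bar> < r" for w
  proof -
    have "H (w + \<i> * complex_of_real L) = param (K (Im w)) (F (Im w) (w + \<i> * complex_of_real L - \<i> * complex_of_real L))"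
    proof (rule H[OF strip_chart_periodic[OF per KF[of "Im w"]]])
      show "w + \<i> * complex_of_real L \<in> ball (\<i> * complex_of_real (Im w + L)) r"
        using own[OF w] by (simp add: dist_norm algebra_simps)
    qed
    then show ?thesis by (simp add: H_def)
  qed
  moreover have "\<exists>\<kappa> F. strip_chart \<gamma> t r \<kappa> F \<and> (\<forall>w\<in>ball (\<i> * complex_of_real t) r. H w = param \<kappa> (F w))" for t
    using KF[of t] H by blast
  ultimately show ?thesis using r r1 unfolding cylinder_map_def by blast
qed

text \<open>Locally \<open>H\<close> is \<open>param \<kappa>\<close> after \<open>F\<close>, and
  conformal covariance multiplies the weight \<open>\<rho>^2\<close> by \<open>|F'|^2\<close>, which
  leaves \<open>1 / cos^2\<close>. The same relation compares areas: \<open>F\<close> is injective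
  on the disc, and the mass in the chart is at most 1.\<close>

lemma cylinder_function:
  assumes H: "cylinder_map \<gamma> L r H" and \<phi>: "eigenfunction A \<phi> \<mu>"
  shows "C_k_on 2 {w. \<bar>Re w\<bar> < r} (\<lambda>w. \<phi> (H w))"
    "\<bar>Re w\<bar> < r \<Longrightarrow> flat_laplacian (\<lambda>w. \<phi> (H w)) w = complex_of_real (- \<mu> * (1 / (cos (Re w))\<^sup>2)) * \<phi> (H w)"
    "L2_norm_on Y A \<phi> = 1 \<Longrightarrow> (\<integral>\<^sup>+w\<in>ball (\<i> * complex_of_real t) r. ennreal ((cmod (\<phi> (H w)))\<^sup>2) \<partial>lborel) \<le> 1"
proof -
  have r: "0 < r" "r \<le> 1" using H by (auto simp: cylinder_map_def)
  define S where "S = {w. \<bar>Re w\<bar> < r}"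
  have S: "open S" unfolding S_def by (intro open_Collect_less continuous_intros)
  have own: "w \<in> ball (\<i> * complex_of_real (Im w)) r" if "\<bar>Re w\<bar> < r" for w
  proof -
    have "w - \<i> * complex_of_real (Im w) = complex_of_real (Re w)" by (simp add: complex_eq_iff)
    then show ?thesis using that by (simp add: dist_norm norm_minus_commute)
  qed
  have loc: "\<exists>\<kappa> F. \<kappa> \<in> A \<and> F holomorphic_on ball (\<i> * complex_of_real t) r \<and> inj_on F (ball (\<i> * complex_of_real t) r) \<and>
      F ` ball (\<i> * complex_of_real t) r \<subseteq> chart_img \<kappa> \<and>
      (\<forall>w\<in>ball (\<i> * complex_of_real t) r. conf_factor \<kappa> (F w) * cmod (deriv F w) = 1 / cos (Re w) \<and> H w = param \<kappa> (F w))" for t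
    using H unfolding cylinder_map_def strip_chart_def by metis
  have C2: "C_k_on 2 (ball (\<i> * complex_of_real t) r) (\<lambda>w. \<phi> (H w)) \<and>
    (\<forall>w\<in>ball (\<i> * complex_of_real t) r. flat_laplacian (\<lambda>w. \<phi> (H w)) w = complex_of_real (- \<mu> * (1 / (cos (Re w))\<^sup>2)) * \<phi> (H w))" for t
  proof -
    let ?B = "ball (\<i> * complex_of_real t) r"
    obtain \<kappa> F where k: "\<kappa> \<in> A" and F: "F holomorphic_on ?B" "F ` ?B \<subseteq> chart_img \<kappa>"
      and iso: "\<And>w. w \<in> ?B \<Longrightarrow> conf_factor \<kappa> (F w) * cmod (deriv F w) = 1 / cos (Re w)"
      and Hw: "\<And>w. w \<in> ?B \<Longrightarrow> H w = param \<kappa> (F w)" using loc[of t] by metis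
    have "C_k_on 2 ?B (\<lambda>w. \<phi> (param \<kappa> (F w)))"
      by (rule C_k_on_compose_holomorphic[OF open_ball img_open[OF k] F eigenfunction_chart(1)[OF \<phi> k]])
    then have "C_k_on 2 ?B (\<lambda>w. \<phi> (H w))"
      by (rule C_k_on_cong[OF open_ball, rotated]) (simp add: Hw)
    moreover have "flat_laplacian (\<lambda>w. \<phi> (H w)) w = complex_of_real (- \<mu> * (1 / (cos (Re w))\<^sup>2)) * \<phi> (H w)" if w: "w \<in> ?B" for w
    proof -
      have "flat_laplacian (\<lambda>w. \<phi> (H w)) w = flat_laplacian (\<lambda>w. \<phi> (param \<kappa> (F w))) w"
        by (rule flat_laplacian_cong[OF open_ball w]) (simp add: Hw)
      also have "\<dots> = (cmod (deriv F w))\<^sup>2 *\<^sub>R flat_laplacian (\<lambda>z. \<phi> (param \<kappa> z)) (F w)"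
        by (rule flat_laplacian_compose_holomorphic[OF open_ball img_open[OF k] F eigenfunction_chart(1)[OF \<phi> k] w])
      also have "flat_laplacian (\<lambda>z. \<phi> (param \<kappa> z)) (F w) = - complex_of_real (\<mu> * (conf_factor \<kappa> (F w))\<^sup>2) * \<phi> (param \<kappa> (F w))"
        using F(2) w by (intro eigenfunction_chart(2)[OF \<phi> k]) auto
      also have "(cmod (deriv F w))\<^sup>2 *\<^sub>R (- complex_of_real (\<mu> * (conf_factor \<kappa> (F w))\<^sup>2) * \<phi> (param \<kappa> (F w)))
         = complex_of_real (- \<mu> * (conf_factor \<kappa> (F w) * cmod (deriv F w))\<^sup>2) * \<phi> (param \<kappa> (F w))"
        by (simp add: scaleR_conv_of_real power_mult_distrib)
      finally show ?thesis unfolding iso[OF w] using Hw[OF w] by (simp add: power_divide)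
    qed
    ultimately show ?thesis by blast
  qed
  show "C_k_on 2 {w. \<bar>Re w\<bar> < r} (\<lambda>w. \<phi> (H w))"
    unfolding S_def[symmetric]
  proof (rule C_k_on_local[OF S])
    fix z assume "z \<in> S"
    then show "\<exists>T. open T \<and> z \<in> T \<and> C_k_on 2 T (\<lambda>w. \<phi> (H w))"
      using own[of z] C2[of "Im z"] by (intro exI[of _ "ball (\<i> * complex_of_real (Im z)) r"]) (auto simp: S_def)
  qed
  show "\<bar>Re w\<bar> < r \<Longrightarrow> flat_laplacian (\<lambda>w. \<phi> (H w)) w = complex_of_real (- \<mu> * (1 / (cos (Re w))\<^sup>2)) * \<phi> (H w)"
    using own[of w] C2[of "Im w"] by blast
  assume norm: "L2_norm_on Y A \<phi> = 1"
  let ?B = "ball (\<i> * complex_of_real t) r"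
  obtain \<kappa> F where k: "\<kappa> \<in> A" and F: "F holomorphic_on ?B" "inj_on F ?B" "F ` ?B \<subseteq> chart_img \<kappa>"
    and iso: "\<And>w. w \<in> ?B \<Longrightarrow> conf_factor \<kappa> (F w) * cmod (deriv F w) = 1 / cos (Re w)"
    and Hw: "\<And>w. w \<in> ?B \<Longrightarrow> H w = param \<kappa> (F w)" using loc[of t] by metis
  define q where "q z = (cmod (\<phi> (param \<kappa> z)))\<^sup>2 * (conf_factor \<kappa> z)\<^sup>2" for z
  define h where "h z = ennreal (q z) * indicator (chart_img \<kappa>) z" for z
  have "C_k_on 0 (chart_img \<kappa>) (\<lambda>z. \<phi> (param \<kappa> z))" "C_k_on 0 (chart_img \<kappa>) (conf_factor \<kappa>)"
    using eigenfunction_chart(1)[OF \<phi> k, of 0] conf_factor_smooth[OF k] unfolding smooth_on_def by blast+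
  then have "continuous_on (chart_img \<kappa>) q" unfolding q_def by (auto intro!: continuous_intros)
  from borel_measurable_continuous_on_indicator[OF borel_open[OF img_open[OF k]] this]
  have "(\<lambda>z. ennreal (indicator (chart_img \<kappa>) z *\<^sub>R q z)) \<in> borel_measurable borel"
    by (rule measurable_compose[OF _ measurable_ennreal])
  then have hm: "h \<in> borel_measurable borel"
    by (rule measurable_cong[THEN iffD1, rotated]) (auto simp: h_def indicator_def)
  have "(\<integral>\<^sup>+w\<in>?B. ennreal ((cmod (\<phi> (H w)))\<^sup>2) \<partial>lborel) \<le> (\<integral>\<^sup>+w\<in>?B. ennreal ((cmod (deriv F w))\<^sup>2) * h (F w) \<partial>lborel)"
  proof (rule nn_integral_mono)
    fix w
    show "ennreal ((cmod (\<phi> (H w)))\<^sup>2) * indicator ?B w \<le> ennreal ((cmod (deriv F w))\<^sup>2) * h (F w) * indicator ?B w"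
    proof (cases "w \<in> ?B")
      case True
      have "\<bar>Re w\<bar> < 1" using True abs_Re_le_cmod[of "w - \<i> * complex_of_real t"] r by (simp add: dist_norm norm_minus_commute)
      then have "0 < cos (Re w)" using pi_gt3 by (intro cos_gt_zero_pi) auto
      then have "1 \<le> 1 / cos (Re w)" by (simp add: field_simps)
      then have "1 \<le> (conf_factor \<kappa> (F w) * cmod (deriv F w))\<^sup>2" unfolding iso[OF True] by simp
      then have "(cmod (\<phi> (H w)))\<^sup>2 * 1 \<le> (cmod (\<phi> (H w)))\<^sup>2 * (conf_factor \<kappa> (F w) * cmod (deriv F w))\<^sup>2"
        by (intro mult_left_mono) auto
      then have "ennreal ((cmod (\<phi> (H w)))\<^sup>2) \<le> ennreal ((cmod (deriv F w))\<^sup>2 * q (F w))"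
        unfolding q_def Hw[OF True] by (intro ennreal_leI) (simp add: power_mult_distrib mult_ac)
      also have "\<dots> = ennreal ((cmod (deriv F w))\<^sup>2) * h (F w)"
      proof -
        have "F w \<in> chart_img \<kappa>" using F(3) True by blast
        then show ?thesis by (subst ennreal_mult) (auto simp: q_def h_def)
      qed
      finally show ?thesis using True by simp
    qed simp
  qed
  also have "\<dots> = (\<integral>\<^sup>+z\<in>F ` ?B. h z \<partial>lborel)"
    by (rule nn_integral_holomorphic_image[OF open_ball F(1,2) hm, symmetric])
  also have "\<dots> \<le> (\<integral>\<^sup>+z\<in>chart_img \<kappa>. ennreal (q z) \<partial>lborel)"
    by (intro nn_integral_mono) (use F(3) in \<open>auto simp: h_def indicator_def\<close>)
  also have "\<dots> \<le> 1" unfolding q_def by (rule chart_L2_bound[OF k norm])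
  finally show "(\<integral>\<^sup>+w\<in>?B. ennreal ((cmod (\<phi> (H w)))\<^sup>2) \<partial>lborel) \<le> 1" .
qed

text \<open>\<open>strip_restriction_bound\<close> leaves the mass of the rectangle
  \<open>|Re w| \<le> 2 * h\<close>, \<open>0 \<le> Im w \<le> L\<close>. It is cut into
  \<open>n\<close> pieces of height \<open>\<delta>\<close>, each inside a disc of mass at most 1;
  hence the constant \<open>n\<close>.\<close>

lemma geodesic_period_scaled_bound:
  assumes geo: "closed_geodesic Y A \<gamma> L"
  shows "\<exists>h0>0. \<exists>C>0. \<forall>\<phi> \<mu> h. eigenfunction A \<phi> \<mu> \<longrightarrow> 0 \<le> \<mu> \<longrightarrow> L2_norm_on Y A \<phi> = 1 \<longrightarrow> 0 < h \<longrightarrow> h \<le> h0 \<longrightarrow>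
    h * geodesic_period \<gamma> L \<phi> \<le> (5 + 32 * \<mu> * h ^ 4) * C"
proof -
  obtain r H where H: "cylinder_map \<gamma> L r H" using exists_cylinder_map[OF geo] by blast
  have r: "0 < r" "r \<le> 1" and line: "\<And>t. H (\<i> * complex_of_real t) = \<gamma> t"
    and per: "\<And>w. \<bar>Re w\<bar> < r \<Longrightarrow> H (w + \<i> * complex_of_real L) = H w" using H by (auto simp: cylinder_map_def)
  have L: "L > 0" using geo by (auto simp: closed_geodesic_def)
  \<comment> \<open>Chosen so that \<open>\<delta> = L / n \<le> r / 2\<close>. With
    \<open>h \<le> r / 8\<close> every point of a piece is within \<open>r / 4 + r / 2 < r\<close>
    of the axis point at its lower edge.\<close>
  define n where "n = nat \<lceil>2 * L / r\<rceil>"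
  have n_ge: "real n \<ge> 2 * L / r" unfolding n_def by linarith
  have n: "real n > 0" using n_ge L r by (smt (verit) divide_pos_pos)
  define \<delta> where "\<delta> = L / real n"
  have \<delta>: "0 < \<delta>" "\<delta> \<le> r / 2" using n_ge n L r by (auto simp: \<delta>_def field_simps)
  show ?thesis
  proof (rule exI[of _ "r / 8"], rule conjI[rotated], rule exI[of _ "real n"], rule conjI[rotated], intro allI impI)
    fix \<phi> \<mu> h
    assume \<phi>: "eigenfunction A \<phi> \<mu>" and \<mu>: "0 \<le> \<mu>" and norm: "L2_norm_on Y A \<phi> = 1" and h: "0 < h" "h \<le> r / 8"
    define \<Phi> where "\<Phi> w = \<phi> (H w)" for w
    define S where "S = {w. \<bar>Re w\<bar> < r}"
    have S: "open S" unfolding S_def by (intro open_Collect_less continuous_intros)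
    have C2: "C_k_on 2 S \<Phi>" using cylinder_function(1)[OF H \<phi>] by (simp add: S_def \<Phi>_def[abs_def])
    have lap: "flat_laplacian \<Phi> w = complex_of_real (- \<mu> * (1 / (cos (Re w))\<^sup>2)) * \<Phi> w" if "w \<in> S" for w
      using cylinder_function(2)[OF H \<phi>] that by (simp add: S_def \<Phi>_def[abs_def])
    have cont: "continuous_on S \<Phi>" using C_k_on_mono[OF C2, of 0] by simp
    have inS: "Complex x t \<in> S" if "\<bar>x\<bar> < r" for x t using that by (simp add: S_def)
    \<comment> \<open>The strip estimate is for real functions; \<open>B\<close> will be
      \<open>Re\<close> and \<open>Im\<close>, whose squares add up to the squared modulus.\<close>
    have key: "h * integral {0..L} (\<lambda>t. (B (\<Phi> (Complex 0 t)))\<^sup>2) \<le>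
        (5 + 32 * \<mu> * h ^ 4) * integral {-2*h..2*h} (\<lambda>x. integral {0..L} (\<lambda>t. (B (\<Phi> (Complex x t)))\<^sup>2))"
      if B: "bounded_linear B" "\<And>c z. B (complex_of_real c * z) = c * B z" for B :: "complex \<Rightarrow> real"
    proof (rule strip_restriction_bound[where e = r])
      show "C_k_on 2 {w. \<bar>Re w\<bar> < r} (\<lambda>w. B (\<Phi> w))"
        using bounded_linear.C_k_on_bounded_linear[OF B(1) S C2] by (simp add: S_def)
      show "flat_laplacian (\<lambda>w. B (\<Phi> w)) w = - \<mu> * (1 / (cos (Re w))\<^sup>2) * B (\<Phi> w)" if "\<bar>Re w\<bar> < r" for w
        using flat_laplacian_bounded_linear[OF B(1) S _ C2, of w] lap[of w] that by (simp add: S_def B(2) del: of_real_mult of_real_minus of_real_divide)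
    qed (use h r L \<mu> per in \<open>auto simp: \<Phi>_def\<close>)
    have cC: "continuous_on T (\<lambda>p. \<Phi> (Complex (f p) (g p)))" if "continuous_on T f" "continuous_on T g" "\<And>p. p \<in> T \<Longrightarrow> \<bar>f p\<bar> < r"
      for T and f g :: "'z::topological_space \<Rightarrow> real"
      by (rule continuous_on_compose2[OF cont]) (use that in \<open>auto intro!: continuous_intros inS\<close>)
    have cN: "continuous_on {-2*h..2*h} (\<lambda>x. integral {0..L} (\<lambda>t. (B (\<Phi> (Complex x t)))\<^sup>2))" if B: "bounded_linear B" for B :: "complex \<Rightarrow> real"
    proof -
      have "continuous_on {-2*h..2*h} (\<lambda>x. integral (cbox 0 L) (\<lambda>t. (B (\<Phi> (Complex x t)))\<^sup>2))"
        by (rule integral_continuous_on_param)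
          (use h r in \<open>auto simp: case_prod_unfold intro!: continuous_intros bounded_linear.continuous_on[OF B] cC\<close>)
      then show ?thesis by simp
    qed
    have i1: "(\<lambda>t. (B (\<Phi> (Complex x t)))\<^sup>2) integrable_on {0..L}" if "bounded_linear B" "\<bar>x\<bar> < r" for x and B :: "complex \<Rightarrow> real"
      by (intro integrable_continuous_real continuous_intros bounded_linear.continuous_on[OF that(1)] cC) (use that in auto)
    have sum0: "integral {0..L} (\<lambda>t. (Re (\<Phi> (Complex x t)))\<^sup>2) + integral {0..L} (\<lambda>t. (Im (\<Phi> (Complex x t)))\<^sup>2)
        = integral {0..L} (\<lambda>t. (cmod (\<Phi> (Complex x t)))\<^sup>2)" if "\<bar>x\<bar> < r" for x
      unfolding cmod_power2 by (rule integral_add[symmetric]) (intro i1 that bounded_linear_Re bounded_linear_Im)+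
    have a: "h * integral {0..L} (\<lambda>t. (cmod (\<Phi> (Complex 0 t)))\<^sup>2) \<le>
        (5 + 32 * \<mu> * h ^ 4) * integral {-2*h..2*h} (\<lambda>x. integral {0..L} (\<lambda>t. (cmod (\<Phi> (Complex x t)))\<^sup>2))"
    proof -
      have "integral {-2*h..2*h} (\<lambda>x. integral {0..L} (\<lambda>t. (Re (\<Phi> (Complex x t)))\<^sup>2))
          + integral {-2*h..2*h} (\<lambda>x. integral {0..L} (\<lambda>t. (Im (\<Phi> (Complex x t)))\<^sup>2))
          = integral {-2*h..2*h} (\<lambda>x. integral {0..L} (\<lambda>t. (Re (\<Phi> (Complex x t)))\<^sup>2) + integral {0..L} (\<lambda>t. (Im (\<Phi> (Complex x t)))\<^sup>2))"
        by (rule integral_add[symmetric]) (intro integrable_continuous_real cN bounded_linear_Re bounded_linear_Im)+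
      also have "\<dots> = integral {-2*h..2*h} (\<lambda>x. integral {0..L} (\<lambda>t. (cmod (\<Phi> (Complex x t)))\<^sup>2))"
        by (intro integral_cong sum0) (use h r in auto)
      finally have e: "integral {-2*h..2*h} (\<lambda>x. integral {0..L} (\<lambda>t. (Re (\<Phi> (Complex x t)))\<^sup>2))
          + integral {-2*h..2*h} (\<lambda>x. integral {0..L} (\<lambda>t. (Im (\<Phi> (Complex x t)))\<^sup>2))
          = integral {-2*h..2*h} (\<lambda>x. integral {0..L} (\<lambda>t. (cmod (\<Phi> (Complex x t)))\<^sup>2))" .
      have s0: "integral {0..L} (\<lambda>t. (Re (\<Phi> (Complex 0 t)))\<^sup>2) + integral {0..L} (\<lambda>t. (Im (\<Phi> (Complex 0 t)))\<^sup>2)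
        = integral {0..L} (\<lambda>t. (cmod (\<Phi> (Complex 0 t)))\<^sup>2)" using sum0[of 0] r by simp
      have kR: "Re (complex_of_real c * z) = c * Re z" and kI: "Im (complex_of_real c * z) = c * Im z" for c z by simp_all
      show ?thesis using add_mono[OF key[OF bounded_linear_Re kR] key[OF bounded_linear_Im kI]]
        unfolding distrib_left[symmetric] s0 e .
    qed
    have b: "integral {0..L} (\<lambda>t. (cmod (\<Phi> (Complex 0 t)))\<^sup>2) = geodesic_period \<gamma> L \<phi>"
    proof -
      have "Complex 0 t = \<i> * complex_of_real t" for t by (simp add: complex_eq_iff)
      then show ?thesis by (simp add: geodesic_period_def \<Phi>_def line)
    qed
    have "integral {-2*h..2*h} (\<lambda>x. integral {0..L} (\<lambda>t. (cmod (\<Phi> (Complex x t)))\<^sup>2)) \<le> real n"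
    proof -
      define J where "J t = integral {-2*h..2*h} (\<lambda>x. (cmod (\<Phi> (Complex x t)))\<^sup>2)" for t
      have "continuous_on (cbox (-2*h, 0) (2*h, L)) (\<lambda>(x, t). (cmod (\<Phi> (Complex x t)))\<^sup>2)"
        unfolding case_prod_unfold by (intro continuous_intros cC) (use h r in \<open>auto simp: cbox_Pair_eq\<close>)
      from integral_swap_continuous[OF this]
      have sw: "integral {-2*h..2*h} (\<lambda>x. integral {0..L} (\<lambda>t. (cmod (\<Phi> (Complex x t)))\<^sup>2)) = integral {0..L} J"
        by (simp add: J_def[abs_def])
      have cJ: "continuous_on UNIV J"
      proof -
        have "continuous_on UNIV (\<lambda>t. integral (cbox (-2*h) (2*h)) (\<lambda>x. (cmod (\<Phi> (Complex x t)))\<^sup>2))"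
          by (rule integral_continuous_on_param)
            (use h r in \<open>auto simp: case_prod_unfold intro!: continuous_intros cC\<close>)
        then show ?thesis by (simp add: J_def[abs_def])
      qed
      have intJ: "J integrable_on {a..b}" for a b
        using cJ by (intro integrable_continuous_real) (auto intro: continuous_on_subset)
      have piece: "integral {t..t + \<delta>} J \<le> 1" for t
      proof -
        have B: "Complex x s \<in> ball (\<i> * complex_of_real t) r" if "x \<in> {-2*h..2*h}" "s \<in> {t..t + \<delta>}" for x s
        proof -
          have "Complex x s - \<i> * complex_of_real t = Complex x (s - t)" by (simp add: complex_eq_iff)
          moreover have "cmod (Complex x (s - t)) \<le> \<bar>x\<bar> + \<bar>s - t\<bar>" using cmod_le[of "Complex x (s - t)"] by simp
          moreover have "\<bar>x\<bar> + \<bar>s - t\<bar> < r" using that h \<delta> r by auto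
          ultimately show ?thesis by (simp add: dist_norm norm_minus_commute)
        qed
        have sub: "ball (\<i> * complex_of_real t) r \<subseteq> S"
        proof
          fix w assume "w \<in> ball (\<i> * complex_of_real t) r"
          then show "w \<in> S" using abs_Re_le_cmod[of "w - \<i> * complex_of_real t"] by (simp add: S_def dist_norm norm_minus_commute)
        qed
        have "ennreal (integral {t..t + \<delta>} J) \<le> (\<integral>\<^sup>+w\<in>ball (\<i> * complex_of_real t) r. ennreal ((cmod (\<Phi> w))\<^sup>2) \<partial>lborel)"
          unfolding J_def using B
          by (intro iterated_integral_le_nn_integral) (auto intro!: continuous_intros continuous_on_subset[OF cont sub])
        also have "\<dots> \<le> 1" unfolding \<Phi>_def by (rule cylinder_function(3)[OF H \<phi> norm])
        finally show ?thesis by (simp add: ennreal_le_1)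
      qed
      have "integral {0..real k * \<delta>} J \<le> real k" for k
      proof (induction k)
        case (Suc k)
        have "integral {0..real k * \<delta>} J + integral {real k * \<delta>..real k * \<delta> + \<delta>} J = integral {0..real k * \<delta> + \<delta>} J"
          using \<delta> intJ by (intro Henstock_Kurzweil_Integration.integral_combine) auto
        then show ?case using Suc piece[of "real k * \<delta>"] by (simp add: algebra_simps)
      qed simp
      from this[of n] show ?thesis unfolding sw using n by (simp add: \<delta>_def)
    qed
    then have "(5 + 32 * \<mu> * h ^ 4) * integral {-2*h..2*h} (\<lambda>x. integral {0..L} (\<lambda>t. (cmod (\<Phi> (Complex x t)))\<^sup>2))
        \<le> (5 + 32 * \<mu> * h ^ 4) * real n"
      using \<mu> h by (intro mult_left_mono) auto
    with a show "h * geodesic_period \<gamma> L \<phi> \<le> (5 + 32 * \<mu> * h ^ 4) * real n"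
      unfolding b by (rule order_trans)
  qed (use r n in auto)
qed

end

section \<open>Harnack inequality\<close>

lemma angular_mean_derivative:
  fixes V :: "complex \<Rightarrow> real"
  assumes V: "C_k_on 1 {w. Re w < X} V" and x: "x < X"
  shows "((\<lambda>x. integral {0..T} (\<lambda>t. V (Complex x t))) has_real_derivative integral {0..T} (\<lambda>t. partial_x V (Complex x t))) (at x)"
proof -
  let ?S = "{w. Re w < X}"
  have S: "open ?S" by (intro open_Collect_less continuous_intros)
  have c: "continuous_on ?S V" "continuous_on ?S (partial_x V)"
    using V differentiable_imp_continuous_on by auto
  have CX: "Complex x t = \<i> * complex_of_real t + complex_of_real x" for x t by (simp add: complex_eq_iff)
  have "((\<lambda>x. integral (cbox 0 T) (\<lambda>t. V (Complex x t))) has_field_derivative integral (cbox 0 T) (\<lambda>t. partial_x V (Complex x t))) (at x within {..<X})"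
  proof (rule leibniz_rule_field_derivative)
    fix x t assume "x \<in> {..<X}"
    then have "V differentiable (at (Complex x t))"
      by (intro differentiable_on_openD[OF _ S]) (use V in auto)
    then show "((\<lambda>x. V (Complex x t)) has_field_derivative partial_x V (Complex x t)) (at x within {..<X})"
      unfolding CX has_real_derivative_iff_has_vector_derivative by (rule has_vector_derivative_horizontal)
    show "(\<lambda>t. V (Complex x t)) integrable_on cbox 0 T"
      using \<open>x \<in> {..<X}\<close> by (intro integrable_continuous continuous_on_compose2[OF c(1)]) (auto intro!: continuous_intros)
  next
    show "continuous_on ({..<X} \<times> cbox 0 T) (\<lambda>(x, t). partial_x V (Complex x t))"
      unfolding case_prod_unfold by (rule continuous_on_compose2[OF c(2)]) (auto intro!: continuous_intros)
  qed (use x in auto)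
  then show ?thesis using at_within_open[of x "{..<X}"] x by simp
qed

text \<open>In logarithmic polar coordinates \<open>z = z0 + exp (x + \<i> t)\<close> the angular mean \<open>m\<close> of \<open>v\<close>
  satisfies \<open>\<bar>m''\<bar> \<le> 2 \<pi> K exp (2 x)\<close>; integrate twice from \<open>x = -\<infinity>\<close>.\<close>

lemma circle_mean_bound:
  fixes v :: "complex \<Rightarrow> real"
  assumes U: "open U" "cball z0 r \<subseteq> U" and r: "0 < r" and v: "C_k_on 2 U v"
    and K: "\<And>z. z \<in> ball z0 r \<Longrightarrow> \<bar>flat_laplacian v z\<bar> \<le> K" and x: "x < ln r"
  shows "\<bar>integral {0..2*pi} (\<lambda>t. v (z0 + exp (Complex x t))) - 2 * pi * v z0\<bar> \<le> pi * K * exp (2 * x) / 2"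
proof -
  let ?S = "{w. Re w < ln r}"
  define E where "E w = z0 + exp w" for w
  define V where "V w = v (E w)" for w
  have S: "open ?S" by (intro open_Collect_less continuous_intros)
  have E: "E holomorphic_on ?S" unfolding E_def by (intro holomorphic_intros)
  have dE: "deriv E w = exp w" for w unfolding E_def by (intro DERIV_imp_deriv) (auto intro!: derivative_eq_intros)
  have Eb: "E w \<in> ball z0 r" if "w \<in> ?S" for w
  proof -
    have "exp (Re w) < exp (ln r)" using that by (subst exp_less_cancel_iff) simp
    then have "exp (Re w) < r" using r by simp
    then show ?thesis by (simp add: E_def dist_norm)
  qed
  have EU: "E ` ?S \<subseteq> U" using Eb U(2) by force
  have V2: "C_k_on 2 ?S V" unfolding V_def by (rule C_k_on_compose_holomorphic[OF S U(1) E EU v])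
  have lapV: "flat_laplacian V w = exp (2 * Re w) * flat_laplacian v (E w)" if w: "w \<in> ?S" for w
    unfolding V_def flat_laplacian_compose_holomorphic[OF S U(1) E EU v w] dE
    by (simp add: exp_double)
  have V1: "C_k_on 1 ?S V" "C_k_on 1 ?S (partial_x V)" "C_k_on 1 ?S (partial_y V)" using V2 C_k_on_Suc_D[of 1 ?S V] by (simp_all add: numeral_2_eq_2)
  define m where "m x = integral {0..2*pi} (\<lambda>t. V (Complex x t))" for x
  define m1 where "m1 x = integral {0..2*pi} (\<lambda>t. partial_x V (Complex x t))" for x
  define m2 where "m2 x = integral {0..2*pi} (\<lambda>t. partial_x (partial_x V) (Complex x t))" for x
  have dm: "(m has_real_derivative m1 x) (at x)" "(m1 has_real_derivative m2 x) (at x)" if "x < ln r" for x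
    unfolding m_def[abs_def] m1_def[abs_def] m2_def by (rule angular_mean_derivative[OF V1(1) that], rule angular_mean_derivative[OF V1(2) that])
  have K0: "K \<ge> 0" using K[of z0] r by (simp add: order_trans[OF abs_ge_zero])
  have CY: "Complex x t = complex_of_real x + \<i> * complex_of_real t" for x t by (simp add: complex_eq_iff)
  have m2b: "\<bar>m2 x\<bar> \<le> 2 * pi * K * exp (2 * x)" if x: "x < ln r" for x
  proof -
    have inS: "Complex x t \<in> ?S" for t using x by simp
    have perV: "V (Complex x (2 * pi + t)) = V (Complex x t)" for t
    proof -
      have "Complex x (2 * pi + t) = Complex x t + of_real (2 * pi) * \<i>" by (simp add: complex_eq_iff)
      then show ?thesis by (simp only: V_def E_def exp_plus_2pin[of _ 1, simplified] exp_add) simp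
    qed
    have dV: "((\<lambda>t. V (Complex x t)) has_vector_derivative partial_y V (Complex x t)) (at t)"
      "((\<lambda>t. partial_y V (Complex x t)) has_vector_derivative partial_y (partial_y V) (Complex x t)) (at t)" for t
      unfolding CY by (rule has_vector_derivative_vertical, rule differentiable_on_openD[OF _ S]; use V1 x in auto)+
    \<comment> \<open>Over a full turn the second angular derivative integrates to 0, so
      \<open>m2\<close> is the integral of the whole Laplacian and inherits its bound.\<close>
    have "((\<lambda>t. partial_y (partial_y V) (Complex x t)) has_integral partial_y V (Complex x (2*pi)) - partial_y V (Complex x 0)) {0..2*pi}"
      by (rule fundamental_theorem_of_calculus) (use dV(2) in \<open>auto intro: has_vector_derivative_at_within\<close>)
    moreover have "partial_y V (Complex x (2*pi)) = partial_y V (Complex x 0)"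
    proof -
      have "((\<lambda>t. V (Complex x (2 * pi + t))) has_vector_derivative partial_y V (Complex x (2 * pi))) (at 0)"
      proof -
        have "((\<lambda>t. 2 * pi + t) has_vector_derivative 1) (at (0::real))" by (auto intro!: derivative_eq_intros)
        from vector_diff_chain_at[OF this, of "\<lambda>t. V (Complex x t)"] dV(1)[of "2 * pi"] show ?thesis by (simp add: o_def)
      qed
      then show ?thesis unfolding perV using vector_derivative_unique_at dV(1)[of 0] by blast
    qed
    ultimately have yy: "((\<lambda>t. partial_y (partial_y V) (Complex x t)) has_integral 0) {0..2*pi}" by simp
    have cxx: "continuous_on {0..2*pi} (\<lambda>t. partial_x (partial_x V) (Complex x t))"
      by (rule continuous_on_compose2[where t = ?S]) (use V1 x in \<open>auto intro!: continuous_intros\<close>)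
    then have "((\<lambda>t. partial_x (partial_x V) (Complex x t)) has_integral m2 x) {0..2*pi}"
      unfolding m2_def by (intro integrable_integral integrable_continuous_real)
    from has_integral_add[OF this yy] have lap: "((\<lambda>t. flat_laplacian V (Complex x t)) has_integral m2 x) {0..2*pi}"
      by (simp add: flat_laplacian_def)
    have "norm (m2 x) \<le> (K * exp (2 * x)) * measure lborel (cbox 0 (2*pi))"
    proof (rule has_integral_bound)
      show "((\<lambda>t. flat_laplacian V (Complex x t)) has_integral m2 x) (cbox 0 (2*pi))" using lap by simp
      show "norm (flat_laplacian V (Complex x t)) \<le> K * exp (2 * x)" for t
        unfolding lapV[OF inS] using K[OF Eb[OF inS]] by (simp add: abs_mult mult.commute)
    qed (use K0 in auto)
    then show ?thesis by (simp add: mult_ac)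
  qed
  \<comment> \<open>By the chain rule \<open>partial_x V\<close> carries the factor
    \<open>exp (Re w)\<close>, so \<open>m1\<close> tends to 0 at \<open>-\<infinity>\<close>; this
    fixes the first constant of integration.\<close>
  obtain C where C: "\<And>w. w \<in> ?S \<Longrightarrow> \<bar>partial_x V w\<bar> \<le> C * exp (Re w)" "C \<ge> 0"
  proof -
    have c: "continuous_on (cball z0 r) (\<lambda>z. \<bar>partial_x v z\<bar> + \<bar>partial_y v z\<bar>)"
      using v differentiable_imp_continuous_on by (intro continuous_intros continuous_on_subset[OF _ U(2)]) (auto simp: numeral_2_eq_2)
    then have "bounded ((\<lambda>z. \<bar>partial_x v z\<bar> + \<bar>partial_y v z\<bar>) ` cball z0 r)"
      by (intro compact_imp_bounded compact_continuous_image) auto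
    then obtain C where C: "C > 0" "\<And>z. z \<in> cball z0 r \<Longrightarrow> \<bar>partial_x v z\<bar> + \<bar>partial_y v z\<bar> \<le> C"
      unfolding bounded_pos by fastforce
    have "\<bar>partial_x V w\<bar> \<le> C * exp (Re w)" if w: "w \<in> ?S" for w
    proof -
      have "v differentiable (at (E w))" by (rule differentiable_on_openD[OF _ U(1)]) (use v EU w in \<open>auto simp: numeral_2_eq_2\<close>)
      from partial_derivativesI(2)[OF has_derivative_compose_holomorphic[OF E S w this]]
      have e: "partial_x V w = Re (exp w) * partial_x v (E w) + Im (exp w) * partial_y v (E w)" by (simp add: V_def[abs_def] dE)
      have "\<bar>partial_x V w\<bar> \<le> \<bar>Re (exp w)\<bar> * \<bar>partial_x v (E w)\<bar> + \<bar>Im (exp w)\<bar> * \<bar>partial_y v (E w)\<bar>"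
        unfolding e abs_mult[symmetric] by (rule abs_triangle_ineq)
      also have "\<dots> \<le> exp (Re w) * \<bar>partial_x v (E w)\<bar> + exp (Re w) * \<bar>partial_y v (E w)\<bar>"
        using abs_Re_le_cmod[of "exp w"] abs_Im_le_cmod[of "exp w"] by (intro add_mono mult_right_mono) auto
      also have "\<dots> = exp (Re w) * (\<bar>partial_x v (E w)\<bar> + \<bar>partial_y v (E w)\<bar>)" by (simp only: distrib_left)
      also have "\<dots> \<le> exp (Re w) * C" using C(2)[of "E w"] Eb[OF w] by (intro mult_left_mono) auto
      finally show ?thesis by (simp add: mult.commute)
    qed
    then show thesis using that C(1) by (meson less_imp_le)
  qed
  have m1_small: "\<bar>m1 x\<bar> \<le> 2 * pi * C * exp x" if x: "x < ln r" for x
  proof -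
    have "continuous_on {0..2*pi} (\<lambda>t. partial_x V (Complex x t))"
      by (rule continuous_on_compose2[where t = ?S]) (use C_k_on_mono[OF V1(2), of 0] x in \<open>auto intro!: continuous_intros\<close>)
    then have I: "((\<lambda>t. partial_x V (Complex x t)) has_integral m1 x) (cbox 0 (2*pi))"
      unfolding m1_def by (simp add: integrable_continuous_real integrable_integral)
    have "norm (m1 x) \<le> (C * exp x) * measure lborel (cbox 0 (2*pi))"
    proof (rule has_integral_bound[OF _ I])
      show "norm (partial_x V (Complex x t)) \<le> C * exp x" for t using C(1)[of "Complex x t"] x by simp
    qed (use C in auto)
    then show ?thesis by (simp add: mult_ac)
  qed
  have exp0: "((\<lambda>y::real. c * exp y + d * exp (2 * y)) \<longlongrightarrow> 0) at_bot" for c d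
  proof -
    have "((\<lambda>y::real. exp y) \<longlongrightarrow> 0) at_bot" by (rule exp_at_bot)
    then have "((\<lambda>y::real. c * exp y + d * (exp y * exp y)) \<longlongrightarrow> c * 0 + d * (0 * 0)) at_bot" by (intro tendsto_intros)
    then show ?thesis by (simp add: exp_double power2_eq_square)
  qed
  \<comment> \<open>Integration from \<open>-\<infinity>\<close> without improper integrals: a
    nonincreasing function is bounded above by its limit there.\<close>
  have limit_le: "f x \<le> l" if x: "x < ln r" and mono: "\<And>y. y < x \<Longrightarrow> f x \<le> f y" and lim: "\<And>y. y < ln r \<Longrightarrow> f y \<le> l + (c * exp y + d * exp (2 * y))"
    for f :: "real \<Rightarrow> real" and x l c d
  proof (rule tendsto_lowerbound)
    show "((\<lambda>y. l + (c * exp y + d * exp (2 * y))) \<longlongrightarrow> l) at_bot" using tendsto_add[OF tendsto_const exp0] by simp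
    show "eventually (\<lambda>y. f x \<le> l + (c * exp y + d * exp (2 * y))) at_bot"
      using eventually_gt_at_bot[of x] by eventually_elim (use mono lim x in \<open>meson less_trans order_trans\<close>)
  qed simp
  have decreasing: "f b \<le> f a" if "a < b" "b < ln r" "\<And>x. x < ln r \<Longrightarrow> (f has_real_derivative f' x) (at x)" "\<And>x. x < ln r \<Longrightarrow> f' x \<le> 0" for f f' :: "real \<Rightarrow> real" and a b
  proof (rule DERIV_nonpos_imp_nonincreasing[of a b f])
    show "\<exists>y. (f has_real_derivative y) (at x) \<and> y \<le> 0" if "a \<le> x" "x \<le> b" for x
      using that \<open>b < ln r\<close> \<open>\<And>x. x < ln r \<Longrightarrow> (f has_real_derivative f' x) (at x)\<close> \<open>\<And>x. x < ln r \<Longrightarrow> f' x \<le> 0\<close>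
      by (intro exI[of _ "f' x"]) auto
  qed (use that in simp)
  have dexp: "((\<lambda>x. c * exp (2 * x)) has_real_derivative 2 * c * exp (2 * x)) (at x)" for c x :: real
    by (auto intro!: derivative_eq_intros)
  have e0: "0 \<le> pi * K * exp (2 * y)" and e1: "0 \<le> pi * K / 2 * exp (2 * y)" for y using K0 by simp_all
  \<comment> \<open>\<open>m1 x - pi * K * exp (2 * x)\<close> has derivative
    \<open>m2 x - 2 * pi * K * exp (2 * x) \<le> 0\<close>, and likewise with \<open>- m1\<close>. A
    second round, from \<open>m1\<close> to \<open>m\<close>, halves the constant again.\<close>
  have m1b: "\<bar>m1 x\<bar> \<le> pi * K * exp (2 * x)" if x: "x < ln r" for x
  proof -
    have "m1 x - pi * K * exp (2 * x) \<le> 0"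
    proof (rule limit_le[OF x, where f = "\<lambda>x. m1 x - pi * K * exp (2 * x)" and c = "2 * pi * C" and d = 0])
      show "m1 x - pi * K * exp (2 * x) \<le> m1 y - pi * K * exp (2 * y)" if "y < x" for y
        by (rule decreasing[OF that x DERIV_diff[OF dm(2) dexp]]) (use m2b in \<open>auto simp: abs_le_iff mult.assoc\<close>)
      show "m1 y - pi * K * exp (2 * y) \<le> 0 + (2 * pi * C * exp y + 0 * exp (2 * y))" if "y < ln r" for y
        using m1_small[OF that] e0[of y] unfolding abs_le_iff by linarith
    qed
    moreover have "- m1 x - pi * K * exp (2 * x) \<le> 0"
    proof (rule limit_le[OF x, where f = "\<lambda>x. - m1 x - pi * K * exp (2 * x)" and c = "2 * pi * C" and d = 0])
      show "- m1 x - pi * K * exp (2 * x) \<le> - m1 y - pi * K * exp (2 * y)" if "y < x" for y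
        by (rule decreasing[OF that x DERIV_diff[OF DERIV_minus[OF dm(2)] dexp]]) (use m2b in \<open>auto simp: abs_le_iff mult.assoc\<close>)
      show "- m1 y - pi * K * exp (2 * y) \<le> 0 + (2 * pi * C * exp y + 0 * exp (2 * y))" if "y < ln r" for y
        using m1_small[OF that] e0[of y] unfolding abs_le_iff by linarith
    qed
    ultimately show ?thesis by (simp add: abs_le_iff)
  qed
  \<comment> \<open>Lipschitz continuity of \<open>v\<close> identifies the limit of
    \<open>m\<close> at \<open>-\<infinity>\<close>, the second constant of integration.\<close>
  have lipV: "\<exists>B\<ge>0. \<forall>y<ln r. \<bar>m y - 2 * pi * v z0\<bar> \<le> B * exp y"
  proof -
    obtain B where B: "B \<ge> 0" "\<And>x y. x \<in> cball z0 r \<Longrightarrow> y \<in> cball z0 r \<Longrightarrow> norm (v x - v y) \<le> B * norm (x - y)"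
      using C1_lipschitz_on_cball[OF U, of v] C_k_on_mono[OF v, of 1] by auto
    have "\<bar>m y - 2 * pi * v z0\<bar> \<le> (2 * pi * B) * exp y" if y: "y < ln r" for y
    proof -
      have inS: "Complex y t \<in> ?S" for t using y by simp
      have "continuous_on {0..2*pi} (\<lambda>t. V (Complex y t))"
        by (rule continuous_on_compose2[where t = ?S]) (use C_k_on_mono[OF V1(1), of 0] y in \<open>auto intro!: continuous_intros\<close>)
      then have I1: "((\<lambda>t. V (Complex y t)) has_integral m y) {0..2*pi}"
        unfolding m_def by (simp add: integrable_continuous_real integrable_integral)
      have I2: "((\<lambda>t. v z0) has_integral 2 * pi * v z0) {0..2*pi}" using has_integral_const_real[of "v z0" 0 "2*pi"] by simp
      have I: "((\<lambda>t. V (Complex y t) - v z0) has_integral m y - 2 * pi * v z0) (cbox 0 (2*pi))"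
        using has_integral_diff[OF I1 I2] by simp
      have "norm (m y - 2 * pi * v z0) \<le> (B * exp y) * measure lborel (cbox 0 (2*pi))"
      proof (rule has_integral_bound[OF _ I])
        show "norm (V (Complex y t) - v z0) \<le> B * exp y" for t
          using B(2)[of "E (Complex y t)" z0] Eb[OF inS, of t] r by (simp add: V_def E_def)
      qed (use B in auto)
      then show ?thesis by (simp add: mult_ac)
    qed
    then show ?thesis using B(1) by (intro exI[of _ "2 * pi * B"]) auto
  qed
  then obtain B where B: "B \<ge> 0" "\<And>y. y < ln r \<Longrightarrow> \<bar>m y - 2 * pi * v z0\<bar> \<le> B * exp y" by blast
  have "m x - pi * K / 2 * exp (2 * x) \<le> 2 * pi * v z0"
  proof (rule limit_le[OF x, where f = "\<lambda>x. m x - pi * K / 2 * exp (2 * x)" and c = B and d = 0])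
    show "m x - pi * K / 2 * exp (2 * x) \<le> m y - pi * K / 2 * exp (2 * y)" if "y < x" for y
      by (rule decreasing[OF that x DERIV_diff[OF dm(1) dexp]]) (use m1b in \<open>auto simp: abs_le_iff mult.assoc\<close>)
    show "m y - pi * K / 2 * exp (2 * y) \<le> 2 * pi * v z0 + (B * exp y + 0 * exp (2 * y))" if "y < ln r" for y
      using B(2)[OF that] e1[of y] unfolding abs_le_iff by linarith
  qed
  moreover have "- m x - pi * K / 2 * exp (2 * x) \<le> - (2 * pi * v z0)"
  proof (rule limit_le[OF x, where f = "\<lambda>x. - m x - pi * K / 2 * exp (2 * x)" and c = B and d = 0])
    show "- m x - pi * K / 2 * exp (2 * x) \<le> - m y - pi * K / 2 * exp (2 * y)" if "y < x" for y
      by (rule decreasing[OF that x DERIV_diff[OF DERIV_minus[OF dm(1)] dexp]]) (use m1b in \<open>auto simp: abs_le_iff mult.assoc\<close>)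
    show "- m y - pi * K / 2 * exp (2 * y) \<le> - (2 * pi * v z0) + (B * exp y + 0 * exp (2 * y))" if "y < ln r" for y
      using B(2)[OF that] e1[of y] unfolding abs_le_iff by linarith
  qed
  ultimately have "\<bar>m x - 2 * pi * v z0\<bar> \<le> pi * K / 2 * exp (2 * x)" unfolding abs_le_iff by linarith
  then show ?thesis unfolding m_def V_def E_def by simp
qed

text \<open>\<open>exp\<close> maps the half-strip \<open>W\<close> injectively onto the disc cut
  along a radius, with Jacobian \<open>exp (2 * x)\<close>. The cut lies on the horizontal line
  \<open>N\<close> through \<open>z0\<close>, a null set.\<close>

lemma polar_nn_integral:
  fixes h :: "complex \<Rightarrow> ennreal"
  assumes h: "h \<in> borel_measurable borel" and r: "0 < r"
  shows "(\<integral>\<^sup>+z\<in>ball z0 r. h z \<partial>lborel) =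
    (\<integral>\<^sup>+x. (\<integral>\<^sup>+t. ennreal (exp (2 * x)) * h (z0 + exp (Complex x t)) * indicator {0..2*pi} t * indicator {..<ln r} x \<partial>lborel) \<partial>lborel)"
proof -
  define W where "W = {w. Re w < ln r \<and> 0 < Im w \<and> Im w < 2 * pi}"
  define F where "F w = z0 + exp w" for w
  have W: "open W" unfolding W_def by (intro open_Collect_conj open_Collect_less continuous_intros)
  have Wm [measurable]: "W \<in> sets borel" using W by simp
  have F: "F holomorphic_on W" unfolding F_def by (intro holomorphic_intros)
  have dF: "deriv F w = exp w" for w unfolding F_def by (intro DERIV_imp_deriv) (auto intro!: derivative_eq_intros)
  have inj: "inj_on F W"
  proof (rule inj_onI)
    fix a b assume "a \<in> W" "b \<in> W" "F a = F b"
    then have "exp a = exp b" "\<bar>Im a - Im b\<bar> < 2 * pi" unfolding F_def W_def mem_Collect_eq by (simp, linarith)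
    then show "a = b" using exp_complex_eqI[of a b] by simp
  qed
  define N where "N = {z::complex. \<i> \<bullet> z = \<i> \<bullet> z0}"
  have N: "N \<in> null_sets lborel"
  proof -
    have "negligible N" unfolding N_def by (rule negligible_hyperplane) simp
    moreover have "N \<in> sets borel" unfolding N_def by (intro borel_closed closed_hyperplane)
    ultimately show ?thesis by (simp add: negligible_iff_null_sets null_sets_completion_iff)
  qed
  have img: "F ` W \<subseteq> ball z0 r" "ball z0 r - N \<subseteq> F ` W"
  proof -
    have "exp (Re w) < r" if "w \<in> W" for w
    proof -
      have "exp (Re w) < exp (ln r)" using that unfolding W_def mem_Collect_eq by (subst exp_less_cancel_iff) (rule conjunct1)
      then show ?thesis using r by simp
    qed
    then show "F ` W \<subseteq> ball z0 r" by (auto simp: F_def dist_norm)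
    show "ball z0 r - N \<subseteq> F ` W"
    proof
      fix z assume z: "z \<in> ball z0 r - N"
      define \<zeta> where "\<zeta> = z - z0"
      have im: "Im \<zeta> \<noteq> 0" using z by (auto simp: N_def \<zeta>_def)
      then have nz: "\<zeta> \<noteq> 0" by auto
      define w where "w = Complex (ln (cmod \<zeta>)) (Arg2pi \<zeta>)"
      have "exp w = complex_of_real (cmod \<zeta>) * exp (\<i> * complex_of_real (Arg2pi \<zeta>))"
      proof -
        have "w = complex_of_real (ln (cmod \<zeta>)) + \<i> * complex_of_real (Arg2pi \<zeta>)" by (simp add: w_def complex_eq_iff)
        then show ?thesis using nz by (simp add: exp_add exp_of_real)
      qed
      also have "\<dots> = \<zeta>" using Arg2pi_eq[of \<zeta>] by simp
      finally have e: "F w = z" by (simp add: F_def \<zeta>_def)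
      have "Arg2pi \<zeta> \<noteq> 0" using im Arg2pi_eq_0[of \<zeta>] by (auto simp: complex_is_Real_iff)
      moreover have "cmod \<zeta> < r" using z by (simp add: \<zeta>_def dist_norm norm_minus_commute)
      ultimately have "w \<in> W" using Arg2pi_ge_0[of \<zeta>] Arg2pi_lt_2pi[of \<zeta>] nz r by (simp add: W_def w_def)
      then show "z \<in> F ` W" using e by blast
    qed
  qed
  have "(\<integral>\<^sup>+z\<in>ball z0 r. h z \<partial>lborel) = (\<integral>\<^sup>+z\<in>F ` W. h z \<partial>lborel)"
    by (rule nn_integral_cong_AE, rule AE_I'[OF N]) (use img in \<open>auto simp: indicator_def split: if_splits\<close>)
  also have "\<dots> = (\<integral>\<^sup>+w\<in>W. ennreal ((cmod (exp w))\<^sup>2) * h (z0 + exp w) \<partial>lborel)"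
    using nn_integral_holomorphic_image[OF W F inj h] unfolding dF by (simp add: F_def)
  also have "\<dots> = (\<integral>\<^sup>+w. ennreal (exp (2 * Re w)) * h (z0 + exp w) * indicator W w \<partial>lborel)"
    by (intro nn_integral_cong) (simp add: exp_double)
  also have "\<dots> = (\<integral>\<^sup>+p. ennreal (exp (2 * snd p)) * h (z0 + exp (Complex (snd p) (fst p))) * indicator W (Complex (snd p) (fst p)) \<partial>(lborel \<Otimes>\<^sub>M lborel))"
  proof -
    have m: "(\<lambda>p::real \<times> real. Complex (snd p) (fst p)) \<in> borel_measurable borel"
      by (intro borel_measurable_continuous_onI continuous_intros)
    have em: "(\<lambda>w::complex. z0 + exp w) \<in> borel_measurable borel" "(\<lambda>w. exp (2 * Re w)) \<in> borel_measurable borel"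
      by (intro borel_measurable_continuous_onI continuous_intros)+
    have g: "(\<lambda>w. ennreal (exp (2 * Re w)) * h (z0 + exp w) * indicator W w) \<in> borel_measurable borel"
      using measurable_compose[OF em(1) h] measurable_compose[OF em(2) measurable_ennreal] W by measurable
    have "(\<integral>\<^sup>+w. ennreal (exp (2 * Re w)) * h (z0 + exp w) * indicator W w \<partial>lborel)
       = (\<integral>\<^sup>+w. ennreal (exp (2 * Re w)) * h (z0 + exp w) * indicator W w \<partial>distr lborel borel (\<lambda>p. Complex (snd p) (fst p)))"
      by (simp only: lborel_distr_Complex)
    also have "\<dots> = (\<integral>\<^sup>+p. ennreal (exp (2 * snd p)) * h (z0 + exp (Complex (snd p) (fst p))) * indicator W (Complex (snd p) (fst p)) \<partial>lborel)"
      using m g by (subst nn_integral_distr) auto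
    finally show ?thesis by (simp only: lborel_prod)
  qed
  also have "\<dots> = (\<integral>\<^sup>+x. (\<integral>\<^sup>+t. ennreal (exp (2 * x)) * h (z0 + exp (Complex x t)) * indicator W (Complex x t) \<partial>lborel) \<partial>lborel)"
  proof (subst lborel_pair.nn_integral_snd[symmetric])
    have m: "(\<lambda>p::real \<times> real. z0 + exp (Complex (snd p) (fst p))) \<in> borel_measurable borel" "(\<lambda>p::real \<times> real. exp (2 * snd p)) \<in> borel_measurable borel"
       "(\<lambda>p::real \<times> real. Complex (snd p) (fst p)) \<in> borel_measurable borel"
      by (intro borel_measurable_continuous_onI continuous_intros)+
    have "(\<lambda>p. ennreal (exp (2 * snd p)) * h (z0 + exp (Complex (snd p) (fst p))) * indicator W (Complex (snd p) (fst p))) \<in> borel_measurable (borel :: (real \<times> real) measure)"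
      using measurable_compose[OF m(1) h] measurable_compose[OF m(2) measurable_ennreal]
        measurable_compose[OF m(3) borel_measurable_indicator[OF borel_open[OF W]]] by measurable
    then show "(\<lambda>p. ennreal (exp (2 * snd p)) * h (z0 + exp (Complex (snd p) (fst p))) * indicator W (Complex (snd p) (fst p))) \<in> borel_measurable (lborel \<Otimes>\<^sub>M lborel)"
      by (simp add: lborel_prod)
  qed simp
  also have "\<dots> = (\<integral>\<^sup>+x. (\<integral>\<^sup>+t. ennreal (exp (2 * x)) * h (z0 + exp (Complex x t)) * indicator {0..2*pi} t * indicator {..<ln r} x \<partial>lborel) \<partial>lborel)"
  proof (rule nn_integral_cong, rule nn_integral_cong_AE)
    fix x
    have "AE t in lborel. t \<noteq> 0 \<and> t \<noteq> 2 * pi" using AE_lborel_singleton by (intro AE_conjI)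
    then show "AE t in lborel. ennreal (exp (2 * x)) * h (z0 + exp (Complex x t)) * indicator W (Complex x t)
        = ennreal (exp (2 * x)) * h (z0 + exp (Complex x t)) * indicator {0..2*pi} t * indicator {..<ln r} x"
      by eventually_elim (auto simp: W_def indicator_def)
  qed
  finally show ?thesis .
qed

text \<open>By \<open>circle_mean_bound\<close> every angular integral differs from
  \<open>2 * pi * v z0\<close> by at most \<open>pi * K * r^2 / 2\<close>, which is
  \<open>2 * pi\<close> times \<open>K * r^2 / 4\<close>. The area of the disc is written with the
  same polar formula, so the integrands are compared circle by circle.\<close>

lemma ball_mean_bounds:
  fixes v :: "complex \<Rightarrow> real"
  assumes U: "open U" "cball z0 r \<subseteq> U" and r: "0 < r" and v: "C_k_on 2 U v"
    and nonneg: "\<And>z. z \<in> ball z0 r \<Longrightarrow> 0 \<le> v z"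
    and K: "\<And>z. z \<in> ball z0 r \<Longrightarrow> \<bar>flat_laplacian v z\<bar> \<le> K"
  shows "(\<integral>\<^sup>+z\<in>ball z0 r. ennreal (v z) \<partial>lborel) \<le> ennreal (v z0 + K * r\<^sup>2 / 4) * emeasure lborel (ball z0 r)"
    "ennreal (v z0 - K * r\<^sup>2 / 4) * emeasure lborel (ball z0 r) \<le> (\<integral>\<^sup>+z\<in>ball z0 r. ennreal (v z) \<partial>lborel)"
proof -
  define h where "h z = ennreal (v z) * indicator (ball z0 r) z" for z
  define m where "m x = integral {0..2*pi} (\<lambda>t. v (z0 + exp (Complex x t)))" for x
  have cv: "continuous_on (ball z0 r) v"
  proof -
    have "continuous_on U v" using C_k_on_mono[OF v, of 0] by simp
    then show ?thesis by (rule continuous_on_subset) (use U(2) in auto)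
  qed
  have K0: "K \<ge> 0" using K[of z0] r by (simp add: order_trans[OF abs_ge_zero])
  have hm: "h \<in> borel_measurable borel"
  proof -
    have "(\<lambda>z. ennreal (indicator (ball z0 r) z *\<^sub>R v z)) \<in> borel_measurable borel"
      by (rule measurable_compose[OF borel_measurable_continuous_on_indicator[OF borel_open[OF open_ball] cv] measurable_ennreal])
    then show ?thesis by (rule measurable_cong[THEN iffD1, rotated]) (auto simp: h_def indicator_def)
  qed
  have inb: "z0 + exp (Complex x t) \<in> ball z0 r" if "x < ln r" for x t
  proof -
    have "exp x < exp (ln r)" using that by (subst exp_less_cancel_iff)
    then show ?thesis using r by (simp add: dist_norm)
  qed
  define I where "I h x = (\<integral>\<^sup>+t. ennreal (exp (2 * x)) * h (z0 + exp (Complex x t)) * indicator {0..2*pi} t * indicator {..<ln r} x \<partial>lborel)"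
    for h :: "complex \<Rightarrow> ennreal" and x
  have set_int: "(\<integral>\<^sup>+t. ennreal (f t) * indicator {0..2*pi} t \<partial>lborel) = ennreal (integral {0..2*pi} f)"
    if "continuous_on {0..2*pi} f" "\<And>t. 0 \<le> f t" for f :: "real \<Rightarrow> real"
  proof -
    have "(f has_integral integral {0..2*pi} f) {0..2*pi}" using that(1) by (intro integrable_integral integrable_continuous_real)
    then have "((\<lambda>t. if t \<in> {0..2*pi} then f t else 0) has_integral integral {0..2*pi} f) UNIV"
      by (simp only: has_integral_restrict_UNIV)
    then have "(\<integral>\<^sup>+t. ennreal (if t \<in> {0..2*pi} then f t else 0) \<partial>lborel) = ennreal (integral {0..2*pi} f)"
      by (subst (asm) has_integral_iff_nn_integral_lebesgue) (auto simp: that(2) nn_integral_completion)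
    moreover have "(\<integral>\<^sup>+t. ennreal (if t \<in> {0..2*pi} then f t else 0) \<partial>lborel) = (\<integral>\<^sup>+t. ennreal (f t) * indicator {0..2*pi} t \<partial>lborel)"
      by (intro nn_integral_cong) (auto simp: indicator_def)
    ultimately show ?thesis by simp
  qed
  have Iv: "I h x = ennreal (exp (2 * x) * m x)" if x: "x < ln r" for x
  proof -
    have c: "continuous_on {0..2*pi} (\<lambda>t. exp (2 * x) * v (z0 + exp (Complex x t)))"
      by (intro continuous_intros continuous_on_compose2[OF cv]) (use inb[OF x] in auto)
    have "I h x = (\<integral>\<^sup>+t. ennreal (exp (2 * x) * v (z0 + exp (Complex x t))) * indicator {0..2*pi} t \<partial>lborel)"
      unfolding I_def h_def using x inb[OF x] nonneg by (intro nn_integral_cong) (simp add: ennreal_mult del: mem_ball)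
    then show ?thesis using set_int[OF c] nonneg[OF inb[OF x]] by (simp add: m_def)
  qed
  have I1: "I (indicator (ball z0 r)) x = ennreal (exp (2 * x) * (2 * pi))" if x: "x < ln r" for x
  proof -
    have "I (indicator (ball z0 r)) x = (\<integral>\<^sup>+t. ennreal (exp (2 * x)) * indicator {0..2*pi} t \<partial>lborel)"
      unfolding I_def using x inb[OF x] by (intro nn_integral_cong) (simp del: mem_ball)
    then show ?thesis using set_int[of "\<lambda>t. exp (2 * x)"] by (simp add: mult.commute)
  qed
  have I0: "I g x = 0" if "\<not> x < ln r" for g x unfolding I_def using that by simp
  have A: "(\<integral>\<^sup>+z\<in>ball z0 r. ennreal (v z) \<partial>lborel) = (\<integral>\<^sup>+x. I h x \<partial>lborel)"
  proof -
    have "(\<integral>\<^sup>+z\<in>ball z0 r. ennreal (v z) \<partial>lborel) = (\<integral>\<^sup>+z\<in>ball z0 r. h z \<partial>lborel)"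
      by (intro nn_integral_cong) (simp add: h_def indicator_def)
    then show ?thesis unfolding polar_nn_integral[OF hm r] I_def .
  qed
  have B: "emeasure lborel (ball z0 r) = (\<integral>\<^sup>+x. I (indicator (ball z0 r)) x \<partial>lborel)"
  proof -
    have "(\<integral>\<^sup>+z\<in>ball z0 r. indicator (ball z0 r) z \<partial>lborel) = (\<integral>\<^sup>+z. indicator (ball z0 r) z \<partial>lborel)"
      by (intro nn_integral_cong) (simp split: split_indicator)
    also have "\<dots> = emeasure lborel (ball z0 r)" by (rule nn_integral_indicator) simp
    finally have e: "emeasure lborel (ball z0 r) = (\<integral>\<^sup>+z\<in>ball z0 r. indicator (ball z0 r) z \<partial>lborel)" by simp
    have M: "(indicator (ball z0 r) :: complex \<Rightarrow> ennreal) \<in> borel_measurable borel" by (intro borel_measurable_indicator) auto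
    show ?thesis unfolding I_def e by (rule polar_nn_integral[OF M r])
  qed
  have B': "I (indicator (ball z0 r)) = (\<lambda>x. ennreal (exp (2 * x) * (2 * pi)) * indicator {..<ln r} x)"
    using I1 I0 by (auto simp: fun_eq_iff indicator_def)
  have Bm: "I (indicator (ball z0 r)) \<in> borel_measurable lborel" unfolding B' by measurable
  have mb: "2 * pi * (v z0 - K * r\<^sup>2 / 4) \<le> m x" "m x \<le> 2 * pi * (v z0 + K * r\<^sup>2 / 4)" if x: "x < ln r" for x
  proof -
    have "exp x < exp (ln r)" using x by (subst exp_less_cancel_iff)
    then have "(exp x)\<^sup>2 \<le> r\<^sup>2" using r by (intro power_mono) auto
    then have o: "pi * K * exp (2 * x) / 2 \<le> pi * K * r\<^sup>2 / 2" using K0 by (simp add: exp_double mult_left_mono)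
    have ab: "\<bar>m x - 2 * pi * v z0\<bar> \<le> pi * K * exp (2 * x) / 2"
      unfolding m_def by (rule circle_mean_bound[OF U r v K x])
    have e: "2 * pi * (v z0 - K * r\<^sup>2 / 4) = 2 * pi * v z0 - pi * K * r\<^sup>2 / 2"
      "2 * pi * (v z0 + K * r\<^sup>2 / 4) = 2 * pi * v z0 + pi * K * r\<^sup>2 / 2" by (simp_all add: algebra_simps)
    show "2 * pi * (v z0 - K * r\<^sup>2 / 4) \<le> m x" unfolding e using ab o unfolding abs_le_iff by linarith
    show "m x \<le> 2 * pi * (v z0 + K * r\<^sup>2 / 4)" unfolding e using ab o unfolding abs_le_iff by linarith
  qed
  have c0: "0 \<le> v z0 + K * r\<^sup>2 / 4" using K0 nonneg[of z0] r by simp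
  have "(\<integral>\<^sup>+x. I h x \<partial>lborel) \<le> (\<integral>\<^sup>+x. ennreal (v z0 + K * r\<^sup>2 / 4) * I (indicator (ball z0 r)) x \<partial>lborel)"
  proof (rule nn_integral_mono)
    fix x
    show "I h x \<le> ennreal (v z0 + K * r\<^sup>2 / 4) * I (indicator (ball z0 r)) x"
    proof (cases "x < ln r")
      case True
      have "exp (2 * x) * m x \<le> exp (2 * x) * (2 * pi * (v z0 + K * r\<^sup>2 / 4))" using mb[OF True] by (intro mult_left_mono) auto
      then show ?thesis unfolding Iv[OF True] I1[OF True] using c0 by (subst ennreal_mult[symmetric]) (auto intro!: ennreal_leI simp: mult_ac)
    qed (simp add: I0)
  qed
  then show "(\<integral>\<^sup>+z\<in>ball z0 r. ennreal (v z) \<partial>lborel) \<le> ennreal (v z0 + K * r\<^sup>2 / 4) * emeasure lborel (ball z0 r)"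
    unfolding A B by (simp only: nn_integral_cmult[OF Bm])
  have "(\<integral>\<^sup>+x. ennreal (v z0 - K * r\<^sup>2 / 4) * I (indicator (ball z0 r)) x \<partial>lborel) \<le> (\<integral>\<^sup>+x. I h x \<partial>lborel)"
  proof (rule nn_integral_mono)
    fix x
    show "ennreal (v z0 - K * r\<^sup>2 / 4) * I (indicator (ball z0 r)) x \<le> I h x"
    proof (cases "x < ln r \<and> 0 \<le> v z0 - K * r\<^sup>2 / 4")
      case True
      have "exp (2 * x) * (2 * pi * (v z0 - K * r\<^sup>2 / 4)) \<le> exp (2 * x) * m x" using mb[of x] True by (intro mult_left_mono) auto
      then show ?thesis using True unfolding Iv[OF conjunct1[OF True]] I1[OF conjunct1[OF True]]
        by (subst ennreal_mult[symmetric]) (auto intro!: ennreal_leI simp: mult_ac)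
    next
      \<comment> \<open>Outside the range of radii both sides are 0; inside it a negative factor
        becomes 0 under \<open>ennreal\<close>, and the lower bound is trivial.\<close>
      case False
      then show ?thesis by (cases "x < ln r") (auto simp: I0 ennreal_neg)
    qed
  qed
  then show "ennreal (v z0 - K * r\<^sup>2 / 4) * emeasure lborel (ball z0 r) \<le> (\<integral>\<^sup>+z\<in>ball z0 r. ennreal (v z) \<partial>lborel)"
    unfolding A B by (simp only: nn_integral_cmult[OF Bm])
qed

text \<open>The disc of radius \<open>r\<close> at \<open>a\<close> lies in that of radius
  \<open>3 * r\<close> at \<open>b\<close>, and this in that of radius \<open>4 * r\<close> at
  \<open>z0\<close>. As \<open>v\<close> is nonnegative, its integral grows from the first disc to
  the second, and 9 is the ratio of their areas. The errors \<open>81/4\<close> and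
  \<open>1/4\<close> times \<open>K * r^2\<close> are rounded up to 21.\<close>

lemma flat_harnack:
  fixes v :: "complex \<Rightarrow> real"
  assumes U: "open U" "cball z0 (4 * r) \<subseteq> U" and r: "0 < r" and v: "C_k_on 2 U v"
    and nonneg: "\<And>z. z \<in> U \<Longrightarrow> 0 \<le> v z"
    and K: "\<And>z. z \<in> cball z0 (4 * r) \<Longrightarrow> \<bar>flat_laplacian v z\<bar> \<le> K"
    and ab: "a \<in> ball z0 r" "b \<in> ball z0 r"
  shows "v a \<le> 9 * v b + 21 * K * r\<^sup>2"
proof -
  have sa: "cball a r \<subseteq> cball z0 (4 * r)" and sb: "cball b (3 * r) \<subseteq> cball z0 (4 * r)" and sab: "ball a r \<subseteq> ball b (3 * r)"
  proof -
    show "cball a r \<subseteq> cball z0 (4 * r)"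
    proof
      fix z assume "z \<in> cball a r"
      then show "z \<in> cball z0 (4 * r)" using dist_triangle[of z0 z a] ab r by simp
    qed
    show "cball b (3 * r) \<subseteq> cball z0 (4 * r)"
    proof
      fix z assume "z \<in> cball b (3 * r)"
      then show "z \<in> cball z0 (4 * r)" using dist_triangle[of z0 z b] ab r by simp
    qed
    show "ball a r \<subseteq> ball b (3 * r)"
    proof
      fix z assume "z \<in> ball a r"
      then show "z \<in> ball b (3 * r)"
        using dist_triangle[of b z a] dist_triangle[of b a z0] ab by (simp add: dist_commute)
    qed
  qed
  have K0: "K \<ge> 0" using K[of z0] r by (simp add: order_trans[OF abs_ge_zero])
  have em: "emeasure lborel (ball c s) = ennreal (unit_ball_vol 2 * s\<^sup>2)" if "0 < s" for c :: complex and s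
    using emeasure_ball[of s c] that by simp
  define \<beta> where "\<beta> = unit_ball_vol 2"
  have \<beta>: "\<beta> > 0" by (simp add: \<beta>_def)
  have "ennreal (v a - K * r\<^sup>2 / 4) * emeasure lborel (ball a r) \<le> (\<integral>\<^sup>+z\<in>ball a r. ennreal (v z) \<partial>lborel)"
    by (rule ball_mean_bounds(2)[OF U(1) _ r v]) (use sa U(2) nonneg K in \<open>auto simp: subset_iff\<close>)
  also have "\<dots> \<le> (\<integral>\<^sup>+z\<in>ball b (3 * r). ennreal (v z) \<partial>lborel)"
    using sab by (intro nn_integral_mono) (auto simp: indicator_def)
  also have "\<dots> \<le> ennreal (v b + K * (3 * r)\<^sup>2 / 4) * emeasure lborel (ball b (3 * r))"
    by (rule ball_mean_bounds(1)[OF U(1) _ _ v]) (use r sb U(2) nonneg K in \<open>auto simp: subset_iff\<close>)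
  finally have main: "ennreal (v a - K * r\<^sup>2 / 4) * ennreal (\<beta> * r\<^sup>2) \<le> ennreal (v b + K * (3 * r)\<^sup>2 / 4) * ennreal (\<beta> * (3 * r)\<^sup>2)"
    using r by (simp add: em \<beta>_def)
  have "b \<in> cball b (3 * r)" using r by simp
  then have bU: "b \<in> U" using sb U(2) by blast
  have vb: "0 \<le> v b" using nonneg[OF bU] .
  have Kr: "0 \<le> K * r\<^sup>2" using K0 by simp
  show ?thesis
  proof (cases "v a - K * r\<^sup>2 / 4 \<ge> 0")
    case True
    have "ennreal ((v a - K * r\<^sup>2 / 4) * (\<beta> * r\<^sup>2)) \<le> ennreal ((v b + K * (3 * r)\<^sup>2 / 4) * (\<beta> * (3 * r)\<^sup>2))"
      using main True vb K0 \<beta> by (simp add: ennreal_mult)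
    then have "(v a - K * r\<^sup>2 / 4) * (\<beta> * r\<^sup>2) \<le> (v b + K * (3 * r)\<^sup>2 / 4) * (\<beta> * (3 * r)\<^sup>2)"
      using vb K0 \<beta> by (subst (asm) ennreal_le_iff) auto
    then have "(v a - K * r\<^sup>2 / 4) * (\<beta> * r\<^sup>2) \<le> (9 * v b + 81 * (K * r\<^sup>2) / 4) * (\<beta> * r\<^sup>2)"
      by (simp add: power_mult_distrib algebra_simps)
    then have "v a - K * r\<^sup>2 / 4 \<le> 9 * v b + 81 * (K * r\<^sup>2) / 4"
      using \<beta> r by (subst (asm) mult_le_cancel_right) auto
    then show ?thesis using Kr by (simp add: mult.assoc)
  next
    case False
    then show ?thesis using vb Kr by (simp add: mult.assoc)
  qed
qed

lemma flat_laplacian_const_minus: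
  fixes g :: "complex \<Rightarrow> real"
  assumes U: "open U" "z \<in> U" and g: "C_k_on 2 U g"
  shows "flat_laplacian (\<lambda>z. M - g z) z = - flat_laplacian g z"
proof -
  have d: "g differentiable (at w)" "partial_x g differentiable (at w)" "partial_y g differentiable (at w)" if "w \<in> U" for w
    using g unfolding numeral_2_eq_2 C_k_on.simps by (auto intro!: differentiable_on_openD[OF _ U(1) that])
  have p: "((\<lambda>z. M - g z) has_derivative (\<lambda>h. Re h *\<^sub>R (- partial_x g w) + Im h *\<^sub>R (- partial_y g w))) (at w)" if "w \<in> U" for w
    using has_derivative_diff[OF has_derivative_const[of M] has_derivative_partials[OF d(1)[OF that]]] by (simp add: algebra_simps)
  have m: "bounded_linear (\<lambda>x::real. - x)" by (rule bounded_linear_minus[OF bounded_linear_ident])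
  have x: "partial_x (partial_x (\<lambda>z. M - g z)) z = partial_x (\<lambda>w. - partial_x g w) z"
    by (rule partials_cong(1)[OF U partial_derivativesI(2)[OF p]])
  have y: "partial_y (partial_y (\<lambda>z. M - g z)) z = partial_y (\<lambda>w. - partial_y g w) z"
    by (rule partials_cong(2)[OF U partial_derivativesI(3)[OF p]])
  show ?thesis unfolding flat_laplacian_def x y
    using bounded_linear.partials_bounded_linear[OF m d(2)[OF U(2)]] bounded_linear.partials_bounded_linear[OF m d(3)[OF U(2)]] by simp
qed

text \<open>A negative \<open>c\<close> would make \<open>f'\<close> negative immediately to the
  right of the critical point 0, and the mean value theorem would produce a smaller value of
  \<open>f\<close>.\<close>

lemma second_derivative_nonneg_at_min:
  fixes f f' :: "real \<Rightarrow> real"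
  assumes d: "d > 0" and f: "\<And>s. \<bar>s\<bar> < d \<Longrightarrow> (f has_real_derivative f' s) (at s)" and f2: "(f' has_real_derivative c) (at 0)"
    and min: "\<And>s. \<bar>s\<bar> < d \<Longrightarrow> f 0 \<le> f s"
  shows "0 \<le> c"
proof (rule ccontr)
  assume "\<not> 0 \<le> c"
  then have c: "c < 0" by simp
  have f0: "f' 0 = 0" using DERIV_local_min[OF f[of 0] d] min d by auto
  obtain e where e: "e > 0" "\<And>h. 0 < h \<Longrightarrow> h < e \<Longrightarrow> f' (0 + h) < f' 0" using DERIV_neg_dec_right[OF f2 c] by blast
  define s where "s = min d e / 2"
  have s: "0 < s" "s < d" "s < e" using d e by (auto simp: s_def)
  have "\<exists>z. 0 < z \<and> z < s \<and> f s - f 0 = (s - 0) * f' z"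
    by (rule MVT2) (use s f in auto)
  then obtain z where z: "0 < z" "z < s" "f s - f 0 = s * f' z" by auto
  have "f' z < 0" using e(2)[of z] z s f0 by simp
  then have "s * f' z < 0" using s by (simp add: mult_pos_neg)
  then show False using z(3) min[of s] s by simp
qed

lemma flat_laplacian_nonneg_at_min:
  fixes g :: "complex \<Rightarrow> real"
  assumes U: "open U" "z \<in> U" and g: "C_k_on 2 U g" and min: "\<And>w. w \<in> U \<Longrightarrow> g z \<le> g w"
  shows "0 \<le> flat_laplacian g z"
proof -
  obtain d where d: "d > 0" "ball z d \<subseteq> U" using U openE by blast
  have D: "g differentiable (at w)" "partial_x g differentiable (at w)" "partial_y g differentiable (at w)" if "w \<in> U" for w
    using g unfolding numeral_2_eq_2 C_k_on.simps by (auto intro!: differentiable_on_openD[OF _ U(1) that])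
  have b: "z + complex_of_real s \<in> U" "z + \<i> * complex_of_real s \<in> U" if "\<bar>s\<bar> < d" for s
    using that by (auto intro!: subsetD[OF d(2)] simp: dist_norm norm_mult)
  have "0 \<le> partial_x (partial_x g) z"
  proof (rule second_derivative_nonneg_at_min[OF d(1), of "\<lambda>s. g (z + complex_of_real s)" "\<lambda>s. partial_x g (z + complex_of_real s)"])
    show "((\<lambda>s. g (z + complex_of_real s)) has_real_derivative partial_x g (z + complex_of_real s)) (at s)" if "\<bar>s\<bar> < d" for s
      unfolding has_real_derivative_iff_has_vector_derivative by (rule has_vector_derivative_horizontal[OF D(1)[OF b(1)[OF that]]])
    show "((\<lambda>s. partial_x g (z + complex_of_real s)) has_real_derivative partial_x (partial_x g) z) (at 0)"
      using has_vector_derivative_horizontal[of "partial_x g" z 0 UNIV] D(2)[OF U(2)] by (simp add: has_real_derivative_iff_has_vector_derivative)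
  qed (use min b in auto)
  moreover have "0 \<le> partial_y (partial_y g) z"
  proof (rule second_derivative_nonneg_at_min[OF d(1), of "\<lambda>s. g (z + \<i> * complex_of_real s)" "\<lambda>s. partial_y g (z + \<i> * complex_of_real s)"])
    show "((\<lambda>s. g (z + \<i> * complex_of_real s)) has_real_derivative partial_y g (z + \<i> * complex_of_real s)) (at s)" if "\<bar>s\<bar> < d" for s
      unfolding has_real_derivative_iff_has_vector_derivative by (rule has_vector_derivative_vertical[OF D(1)[OF b(2)[OF that]]])
    show "((\<lambda>s. partial_y g (z + \<i> * complex_of_real s)) has_real_derivative partial_y (partial_y g) z) (at 0)"
      using has_vector_derivative_vertical[of "partial_y g" z 0 UNIV] D(3)[OF U(2)] by (simp add: has_real_derivative_iff_has_vector_derivative)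
  qed (use min b in auto)
  ultimately show ?thesis by (simp add: flat_laplacian_def)
qed

section \<open>Harnack inequality on the surface and the spectral gap\<close>

context compact_hyperbolic_surface
begin

text \<open>\<open>M\<close> is any bound of \<open>|f|\<close>; it serves to form the nonnegative
  function \<open>M - f\<close>, whose Laplacian is of size \<open>\<mu> * M\<close>.\<close>

definition real_eigenfunction :: "('a \<Rightarrow> real) \<Rightarrow> real \<Rightarrow> real \<Rightarrow> bool" where
  "real_eigenfunction f \<mu> M \<longleftrightarrow> 0 \<le> \<mu> \<and> (\<forall>p\<in>Y. \<bar>f p\<bar> \<le> M) \<and>
     (\<forall>\<kappa>\<in>A. C_k_on 2 (chart_img \<kappa>) (\<lambda>z. f (param \<kappa> z)) \<and>
       (\<forall>z\<in>chart_img \<kappa>. flat_laplacian (\<lambda>z. f (param \<kappa> z)) z = - \<mu> * (conf_factor \<kappa> z)\<^sup>2 * f (param \<kappa> z)))"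

text \<open>The constant is uniform in \<open>f\<close>, \<open>\<mu>\<close> and \<open>M\<close>.
  The comparison goes in both directions to make the relation between points symmetric, as the
  connectedness argument requires.\<close>

definition harnack_on :: "'a \<Rightarrow> 'a set \<Rightarrow> real \<Rightarrow> bool" where
  "harnack_on q V C \<longleftrightarrow> 0 \<le> C \<and> (\<forall>f \<mu> M. real_eigenfunction f \<mu> M \<longrightarrow> (\<forall>p\<in>V.
     M - f p \<le> C * (M - f q + \<mu> * M) \<and> M - f q \<le> C * (M - f p + \<mu> * M)))"

text \<open>On a compact disc in one chart the Laplacian of \<open>M - f\<close> is at most
  \<open>\<mu> * B * M\<close> in modulus, so \<open>flat_harnack\<close> applies; its constants 9
  and \<open>21 * B * r^2\<close> are merged in \<open>C\<close>.\<close>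

lemma local_harnack:
  assumes q: "q \<in> Y"
  shows "\<exists>V C. openin (top_of_set Y) V \<and> q \<in> V \<and> harnack_on q V C"
proof -
  obtain \<kappa> where k: "\<kappa> \<in> A" "q \<in> chart_dom \<kappa>" using cover q by blast
  define z0 where "z0 = coord \<kappa> q"
  have "z0 \<in> chart_img \<kappa>" unfolding z0_def by (rule chart_maps(1)[OF k])
  then obtain R where R: "R > 0" "cball z0 R \<subseteq> chart_img \<kappa>" using img_open[OF k(1)] open_contains_cball by blast
  define r where "r = R / 4"
  have r: "r > 0" "cball z0 (4 * r) \<subseteq> chart_img \<kappa>" using R by (auto simp: r_def)
  have "C_k_on 0 (chart_img \<kappa>) (conf_factor \<kappa>)" using conf_factor_smooth[OF k(1)] unfolding smooth_on_def by blast
  then have "continuous_on (cball z0 (4 * r)) (\<lambda>z. (conf_factor \<kappa> z)\<^sup>2)"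
    by (intro continuous_intros continuous_on_subset[OF _ r(2)]) simp
  then have "bounded ((\<lambda>z. (conf_factor \<kappa> z)\<^sup>2) ` cball z0 (4 * r))" by (intro compact_imp_bounded compact_continuous_image) auto
  then obtain B where B: "B > 0" "\<And>z. z \<in> cball z0 (4 * r) \<Longrightarrow> (conf_factor \<kappa> z)\<^sup>2 \<le> B"
    unfolding bounded_pos by fastforce
  define C where "C = 9 + 21 * B * r\<^sup>2"
  have Br: "0 \<le> 21 * B * r\<^sup>2" using B by simp
  have est: "M - f (param \<kappa> a) \<le> C * (M - f (param \<kappa> b) + \<mu> * M)"
    if f: "real_eigenfunction f \<mu> M" and ab: "a \<in> ball z0 r" "b \<in> ball z0 r" for f \<mu> M a b
  proof -
    define v where "v z = M - f (param \<kappa> z)" for z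
    have \<mu>: "0 \<le> \<mu>" and M: "\<And>p. p \<in> Y \<Longrightarrow> \<bar>f p\<bar> \<le> M" and C2: "C_k_on 2 (chart_img \<kappa>) (\<lambda>z. f (param \<kappa> z))"
      and lap: "\<And>z. z \<in> chart_img \<kappa> \<Longrightarrow> flat_laplacian (\<lambda>z. f (param \<kappa> z)) z = - \<mu> * (conf_factor \<kappa> z)\<^sup>2 * f (param \<kappa> z)"
      using f k(1) by (auto simp: real_eigenfunction_def)
    have inY: "param \<kappa> z \<in> Y" if "z \<in> chart_img \<kappa>" for z using chart_maps(3)[OF k(1) that] chart_dom_subset[OF k(1)] by blast
    have M0: "0 \<le> M" using M[OF q] by (simp add: order_trans[OF abs_ge_zero])
    have bb: "b \<in> chart_img \<kappa>" using ab(2) r by (intro subsetD[OF r(2)]) auto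
    have nn: "0 \<le> v z" if "z \<in> chart_img \<kappa>" for z using M[OF inY[OF that]] by (simp add: v_def abs_le_iff)
    have "v a \<le> 9 * v b + 21 * (\<mu> * B * M) * r\<^sup>2"
    proof (rule flat_harnack[OF img_open[OF k(1)] r(2,1) _ nn _ ab])
      show "C_k_on 2 (chart_img \<kappa>) v" unfolding v_def by (intro C_k_on_diff C_k_on_const img_open[OF k(1)] C2)
      fix z assume z: "z \<in> cball z0 (4 * r)"
      then have zi: "z \<in> chart_img \<kappa>" using r by blast
      have "\<bar>flat_laplacian v z\<bar> = \<mu> * (conf_factor \<kappa> z)\<^sup>2 * \<bar>f (param \<kappa> z)\<bar>"
        unfolding v_def flat_laplacian_const_minus[OF img_open[OF k(1)] zi C2] lap[OF zi] using \<mu> by (simp add: abs_mult)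
      also have "\<dots> \<le> \<mu> * B * M" using B(1) B(2)[OF z] M[OF inY[OF zi]] \<mu> by (intro mult_mono mult_nonneg_nonneg) auto
      finally show "\<bar>flat_laplacian v z\<bar> \<le> \<mu> * B * M" .
    qed
    also have "9 * v b + 21 * (\<mu> * B * M) * r\<^sup>2 = 9 * v b + (21 * B * r\<^sup>2) * (\<mu> * M)" by simp
    also have "\<dots> \<le> C * v b + C * (\<mu> * M)"
      unfolding C_def using nn[OF bb] Br \<mu> M0 by (intro add_mono mult_right_mono) auto
    finally show ?thesis unfolding v_def by (simp add: distrib_left)
  qed
  define V where "V = param \<kappa> ` ball z0 r"
  have bs: "ball z0 r \<subseteq> chart_img \<kappa>" using r by (intro order_trans[OF _ r(2)]) auto
  have "openin (top_of_set Y) V" unfolding V_def by (rule openin_param_image[OF k(1) open_ball bs])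
  moreover have qz: "q = param \<kappa> z0" unfolding z0_def by (rule chart_maps(2)[OF k, symmetric])
  then have "q \<in> V" unfolding V_def using r by (intro image_eqI[of _ _ z0]) auto
  moreover have "harnack_on q V C" unfolding harnack_on_def
  proof (intro conjI allI impI ballI)
    show "0 \<le> C" using Br by (simp add: C_def)
    fix f \<mu> M p assume f: "real_eigenfunction f \<mu> M" and "p \<in> V"
    then obtain a where a: "a \<in> ball z0 r" "p = param \<kappa> a" unfolding V_def by blast
    have z: "z0 \<in> ball z0 r" using r by simp
    show "M - f p \<le> C * (M - f q + \<mu> * M)" unfolding a(2) qz by (rule est[OF f a(1) z])
    show "M - f q \<le> C * (M - f p + \<mu> * M)" unfolding a(2) qz by (rule est[OF f z a(1)])
  qed
  ultimately show ?thesis by blast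
qed

text \<open>Chaining two comparisons does not accumulate the additive error: the second
  \<open>e\<close> is absorbed by adding \<open>C\<close> to the product of the constants.\<close>

lemma harnack_step:
  fixes x y z e C D :: real
  assumes "x \<le> C * (y + e)" "y \<le> D * (z + e)" "0 \<le> C" "0 \<le> D" "0 \<le> z" "0 \<le> e"
  shows "x \<le> (C * D + C) * (z + e)"
proof -
  have "C * y \<le> C * (D * (z + e))" using assms by (intro mult_left_mono) auto
  moreover have "C * e \<le> C * (z + e)" using assms by (intro mult_left_mono) auto
  ultimately show ?thesis using assms(1) by (simp add: algebra_simps)
qed

text \<open>The constant is the sum of those that \<open>harnack_step\<close> gives in the two
  directions, \<open>D * C + D\<close> and \<open>C * D + C\<close>, so it dominates both.\<close>

lemma harnack_on_trans:
  assumes "harnack_on q {s} C" "harnack_on s V D" "q \<in> Y" "s \<in> Y" "V \<subseteq> Y"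
  shows "harnack_on q V (C * D + D + C * D + C)"
  unfolding harnack_on_def
proof (intro conjI allI impI ballI)
  have CD: "0 \<le> C" "0 \<le> D" using assms by (auto simp: harnack_on_def)
  then have CD': "0 \<le> C * D" by simp
  then show "0 \<le> C * D + D + C * D + C" using CD by simp
  fix f \<mu> M p assume f: "real_eigenfunction f \<mu> M" and p: "p \<in> V"
  have nn: "0 \<le> M - f x" if "x \<in> Y" for x using f that by (auto simp: real_eigenfunction_def abs_le_iff)
  have e: "0 \<le> \<mu> * M"
  proof -
    have "0 \<le> M" using f assms(3) abs_ge_zero order_trans unfolding real_eigenfunction_def by meson
    then show ?thesis using f by (simp add: real_eigenfunction_def)
  qed
  have pY: "p \<in> Y" using p assms by blast
  have 1: "M - f s \<le> C * (M - f q + \<mu> * M)" "M - f q \<le> C * (M - f s + \<mu> * M)"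
    and 2: "M - f p \<le> D * (M - f s + \<mu> * M)" "M - f s \<le> D * (M - f p + \<mu> * M)"
    using assms(1,2) f p by (auto simp: harnack_on_def)
  have mono: "k * (z + \<mu> * M) \<le> (C * D + D + C * D + C) * (z + \<mu> * M)" if "k \<le> C * D + D + C * D + C" "0 \<le> z" for k z
    using that e by (intro mult_right_mono) auto
  show "M - f p \<le> (C * D + D + C * D + C) * (M - f q + \<mu> * M)"
    by (rule order_trans[OF harnack_step[OF 2(1) 1(1) CD(2,1) nn[OF assms(3)] e] mono[OF _ nn[OF assms(3)]]]) (use CD CD' in \<open>simp add: mult.commute\<close>)
  show "M - f q \<le> (C * D + D + C * D + C) * (M - f p + \<mu> * M)"
    by (rule order_trans[OF harnack_step[OF 1(2) 2(2) CD nn[OF pY] e] mono[OF _ nn[OF pY]]]) (use CD CD' in simp)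
qed

text \<open>Being comparable with some constant is an equivalence relation on \<open>Y\<close> with
  open classes, so connectedness leaves a single class. For a uniform constant, each point has a
  neighbourhood that is compared with \<open>q\<close> by one constant, and compactness leaves
  finitely many of them.\<close>

lemma global_harnack:
  assumes q: "q \<in> Y"
  shows "\<exists>C. harnack_on q Y C"
proof -
  have sym: "harnack_on s {p} C" if "harnack_on p {s} C" for p s C using that by (auto simp: harnack_on_def)
  have sub: "harnack_on p {s} C" if "harnack_on p V C" "s \<in> V" for p s V C using that by (auto simp: harnack_on_def)
  have pt: "\<exists>C. harnack_on q {s} C" if s: "s \<in> Y" for s
  proof (rule connected_equivalence_relation[OF connected q s, of "\<lambda>p s. \<exists>C. harnack_on p {s} C"])
    show "\<exists>C. harnack_on x {y} C \<Longrightarrow> x \<in> Y \<Longrightarrow> y \<in> Y \<Longrightarrow> \<exists>C. harnack_on y {x} C" for x y using sym by blast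
    show "\<exists>C. harnack_on x {z} C" if "\<exists>C. harnack_on x {y} C" "\<exists>C. harnack_on y {z} C" "x \<in> Y" "y \<in> Y" "z \<in> Y" for x y z
      using that harnack_on_trans[of x y _ "{z}"] by auto
    show "\<exists>T. openin (top_of_set Y) T \<and> a \<in> T \<and> (\<forall>x\<in>T. \<exists>C. harnack_on a {x} C)" if "a \<in> Y" for a
      using local_harnack[OF that] sub by blast
  qed
  have nb: "\<exists>T. open T \<and> s \<in> T \<and> (\<exists>C. harnack_on q (Y \<inter> T) C)" if s: "s \<in> Y" for s
  proof -
    obtain V C where V: "openin (top_of_set Y) V" "s \<in> V" "harnack_on s V C" using local_harnack[OF s] by blast
    obtain T where T: "open T" "V = Y \<inter> T" using V(1) by (auto simp: openin_open)
    obtain D where "harnack_on q {s} D" using pt[OF s] by blast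
    from harnack_on_trans[OF this V(3) q s] T V(2) show ?thesis by blast
  qed
  then obtain T where T: "\<And>s. s \<in> Y \<Longrightarrow> open (T s) \<and> s \<in> T s \<and> (\<exists>C. harnack_on q (Y \<inter> T s) C)" by metis
  obtain S where S: "S \<subseteq> Y" "finite S" "Y \<subseteq> (\<Union>s\<in>S. T s)"
    using compactE_image[OF compact, of Y T] T by blast
  have "\<exists>C. harnack_on q (\<Union>s\<in>S'. Y \<inter> T s) C" if "finite S'" "S' \<subseteq> Y" for S'
    using that
  proof (induction S')
    case empty
    then show ?case by (intro exI[of _ 0]) (simp add: harnack_on_def)
  next
    case (insert s S')
    then obtain C D where CD: "harnack_on q (\<Union>s\<in>S'. Y \<inter> T s) C" "harnack_on q (Y \<inter> T s) D" using T[of s] by auto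
    have mono: "harnack_on q V (C + D)" if "harnack_on q V k" "V \<subseteq> Y" "k = C \<or> k = D" for V k
      unfolding harnack_on_def
    proof (intro conjI allI impI ballI)
      have C0: "0 \<le> C" "0 \<le> D" using CD by (auto simp: harnack_on_def)
      then show "0 \<le> C + D" by simp
      fix f \<mu> M p assume f: "real_eigenfunction f \<mu> M" and p: "p \<in> V"
      have nn: "0 \<le> M - f x" if "x \<in> Y" for x using f that by (auto simp: real_eigenfunction_def abs_le_iff)
      have "0 \<le> M" using f q abs_ge_zero order_trans unfolding real_eigenfunction_def by meson
      then have e: "0 \<le> \<mu> * M" using f by (simp add: real_eigenfunction_def)
      have k: "k * (z + \<mu> * M) \<le> (C + D) * (z + \<mu> * M)" if "0 \<le> z" for z
        using \<open>k = C \<or> k = D\<close> C0 that e by (intro mult_right_mono) auto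
      have 1: "M - f p \<le> k * (M - f q + \<mu> * M)" "M - f q \<le> k * (M - f p + \<mu> * M)"
        using \<open>harnack_on q V k\<close> f p by (auto simp: harnack_on_def)
      have pY: "p \<in> Y" using p \<open>V \<subseteq> Y\<close> by blast
      show "M - f p \<le> (C + D) * (M - f q + \<mu> * M)" by (rule order_trans[OF 1(1) k[OF nn[OF q]]])
      show "M - f q \<le> (C + D) * (M - f p + \<mu> * M)" by (rule order_trans[OF 1(2) k[OF nn[OF pY]]])
    qed
    have "harnack_on q (\<Union>s\<in>S'. Y \<inter> T s) (C + D)" "harnack_on q (Y \<inter> T s) (C + D)"
      by (rule mono[OF CD(1)]; blast) (rule mono[OF CD(2)]; blast)
    then have "harnack_on q (\<Union>s\<in>insert s S'. Y \<inter> T s) (C + D)" unfolding harnack_on_def by blast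
    then show ?case by blast
  qed
  from this[OF S(2,1)] obtain C where "harnack_on q (\<Union>s\<in>S. Y \<inter> T s) C" by blast
  moreover have "(\<Union>s\<in>S. Y \<inter> T s) = Y" using S(3) by blast
  ultimately show ?thesis by auto
qed

lemma real_eigenfunction_continuous:
  assumes f: "\<And>\<kappa>. \<kappa> \<in> A \<Longrightarrow> C_k_on 2 (chart_img \<kappa>) (\<lambda>z. f (param \<kappa> z) :: real)"
  shows "continuous_on Y f"
  unfolding continuous_on_eq_continuous_within
proof
  fix p assume "p \<in> Y"
  then obtain \<kappa> where k: "\<kappa> \<in> A" "p \<in> chart_dom \<kappa>" using cover by blast
  have "continuous_on (chart_img \<kappa>) (\<lambda>z. f (param \<kappa> z))" using C_k_on_mono[OF f[OF k(1)], of 0] by simp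
  then have "continuous_on (chart_dom \<kappa>) (\<lambda>p. f (param \<kappa> (coord \<kappa> p)))"
    by (rule continuous_on_compose2[OF _ chart_maps(5)[OF k(1)]]) (use chart_maps(1)[OF k(1)] in blast)
  then have "continuous_on (chart_dom \<kappa>) f"
    by (rule continuous_on_eq) (simp add: chart_maps(2)[OF k(1)])
  then have c: "continuous (at p within chart_dom \<kappa>) f" using k(2) by (simp add: continuous_on_eq_continuous_within)
  obtain T where T: "open T" "chart_dom \<kappa> = Y \<inter> T" using dom_open[OF k(1)] by (auto simp: openin_open)
  have "at p within chart_dom \<kappa> = at p within Y"
    by (rule at_within_nhd[of p T]) (use T k in auto)
  then show "continuous (at p within Y) f" using c by simp
qed

lemma spectral_gap: "\<exists>c>0. \<forall>\<phi> \<mu>. eigenfunction A \<phi> \<mu> \<longrightarrow> 0 < \<mu> \<longrightarrow> c \<le> \<mu>"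
proof -
  obtain q where q: "q \<in> Y" using nonempty by blast
  obtain C where C: "harnack_on q Y C" using global_harnack[OF q] by blast
  have C0: "C \<ge> 0" using C by (simp add: harnack_on_def)
  \<comment> \<open>The summand 1 keeps the denominator positive when \<open>C = 0\<close>.\<close>
  define c where "c = 1 / (C * C + C + 1)"
  have den: "C * C + C + 1 > 0" using C0 by (simp add: add_nonneg_pos)
  have main: "c \<le> \<mu>" if \<mu>: "0 < \<mu>" and f: "\<And>\<kappa>. \<kappa> \<in> A \<Longrightarrow> C_k_on 2 (chart_img \<kappa>) (\<lambda>z. f (param \<kappa> z))"
     and lap: "\<And>\<kappa> z. \<kappa> \<in> A \<Longrightarrow> z \<in> chart_img \<kappa> \<Longrightarrow> flat_laplacian (\<lambda>z. f (param \<kappa> z)) z = - \<mu> * (conf_factor \<kappa> z)\<^sup>2 * f (param \<kappa> z)"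
     and p: "p \<in> Y" "f p > 0" "\<And>x. x \<in> Y \<Longrightarrow> \<bar>f x\<bar> \<le> f p" for f :: "'a \<Rightarrow> real" and \<mu> p
  proof -
    have re: "real_eigenfunction f \<mu> (f p)" using \<mu> f lap p by (simp add: real_eigenfunction_def)
    obtain a where a: "a \<in> Y" "\<And>x. x \<in> Y \<Longrightarrow> f a \<le> f x"
      using continuous_attains_inf[OF compact nonempty real_eigenfunction_continuous[OF f]] by blast
    \<comment> \<open>At a minimum the Laplacian is nonnegative, and it equals
      \<open>- \<mu> * \<rho>^2 * f a\<close>.\<close>
    have "f a \<le> 0"
    proof -
      obtain \<kappa> where k: "\<kappa> \<in> A" "a \<in> chart_dom \<kappa>" using cover a(1) by blast
      define z where "z = coord \<kappa> a"
      have z: "z \<in> chart_img \<kappa>" "param \<kappa> z = a" unfolding z_def using chart_maps(1,2)[OF k] by auto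
      have "0 \<le> flat_laplacian (\<lambda>z. f (param \<kappa> z)) z"
        by (rule flat_laplacian_nonneg_at_min[OF img_open[OF k(1)] z(1) f[OF k(1)]])
          (use a z chart_maps(3)[OF k(1)] chart_dom_subset[OF k(1)] in auto)
      then have "(\<mu> * (conf_factor \<kappa> z)\<^sup>2) * f a \<le> 0" unfolding lap[OF k(1) z(1)] z(2) by simp
      moreover have "\<mu> * (conf_factor \<kappa> z)\<^sup>2 > 0" using \<mu> conf_factor_pos[OF k(1) z(1)] by simp
      ultimately show ?thesis by (metis mult_pos_pos not_le)
    qed
    \<comment> \<open>Two comparisons lead from \<open>p\<close> through \<open>q\<close> to
      \<open>a\<close>. With \<open>M = f p\<close> the main term at \<open>p\<close> is
      \<open>f p - f p = 0\<close>, so only the error \<open>\<mu> * f p\<close> survives.\<close>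
    have 1: "f p - f a \<le> C * (f p - f q + \<mu> * f p)" and 2: "f p - f q \<le> C * (f p - f p + \<mu> * f p)"
      using C re a(1) p(1) unfolding harnack_on_def by blast+
    have "f p - f a \<le> (C * C + C) * (f p - f p + \<mu> * f p)"
      by (rule harnack_step[OF 1 2 C0 C0]) (use \<mu> p in auto)
    then have "f p * 1 \<le> f p * ((C * C + C) * \<mu>)" using \<open>f a \<le> 0\<close> by (simp add: mult_ac)
    then have "1 \<le> (C * C + C) * \<mu>" using p(2) by (subst (asm) mult_le_cancel_left_pos)
    then have "1 \<le> (C * C + C + 1) * \<mu>" using \<mu> by (simp add: algebra_simps)
    then show ?thesis using den by (simp add: c_def divide_le_eq mult.commute)
  qed
  have "c \<le> \<mu>" if \<phi>: "eigenfunction A \<phi> \<mu>" and \<mu>: "0 < \<mu>" for \<phi> \<mu>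
  proof -
    obtain \<kappa> p0 where p0: "\<kappa> \<in> A" "p0 \<in> chart_dom \<kappa>" "\<phi> p0 \<noteq> 0" using \<phi> by (auto simp: eigenfunction_def)
    have p0Y: "p0 \<in> Y" using p0 chart_dom_subset by blast
    \<comment> \<open>A nonzero complex eigenfunction has a nonzero real or imaginary part;
      \<open>B\<close> selects it.\<close>
    have "\<exists>B. bounded_linear B \<and> (\<forall>c z. B (complex_of_real c * z) = c * B z) \<and> B (\<phi> p0) \<noteq> (0::real)"
    proof (cases "Re (\<phi> p0) = 0")
      case True
      then have "Im (\<phi> p0) \<noteq> 0" using p0(3) by (simp add: complex_eq_iff)
      then show ?thesis using bounded_linear_Im by (intro exI[of _ Im]) auto
    next
      case False
      then show ?thesis using bounded_linear_Re by (intro exI[of _ Re]) auto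
    qed
    then obtain B where B: "bounded_linear B" "\<And>c z. B (complex_of_real c * z) = c * B z" "B (\<phi> p0) \<noteq> (0::real)" by blast
    have f: "C_k_on 2 (chart_img \<kappa>) (\<lambda>z. B (\<phi> (param \<kappa> z)))" if "\<kappa> \<in> A" for \<kappa>
      by (rule bounded_linear.C_k_on_bounded_linear[OF B(1) img_open[OF that] eigenfunction_chart(1)[OF \<phi> that]])
    have lap: "flat_laplacian (\<lambda>z. B (\<phi> (param \<kappa> z))) z = - \<mu> * (conf_factor \<kappa> z)\<^sup>2 * B (\<phi> (param \<kappa> z))"
      if "\<kappa> \<in> A" "z \<in> chart_img \<kappa>" for \<kappa> z
    proof -
      have "flat_laplacian (\<lambda>z. B (\<phi> (param \<kappa> z))) z = B (complex_of_real (- (\<mu> * (conf_factor \<kappa> z)\<^sup>2)) * \<phi> (param \<kappa> z))"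
        unfolding flat_laplacian_bounded_linear[OF B(1) img_open[OF that(1)] that(2) eigenfunction_chart(1)[OF \<phi> that(1)]]
          eigenfunction_chart(2)[OF \<phi> that] by simp
      then show ?thesis unfolding B(2) by simp
    qed
    have "continuous_on Y (\<lambda>p. \<bar>B (\<phi> p)\<bar>)" by (intro continuous_intros real_eigenfunction_continuous f)
    then obtain p where p: "p \<in> Y" "\<And>x. x \<in> Y \<Longrightarrow> \<bar>B (\<phi> x)\<bar> \<le> \<bar>B (\<phi> p)\<bar>"
      using continuous_attains_sup[OF compact nonempty] by blast
    have pos: "\<bar>B (\<phi> p)\<bar> > 0" using p(2)[OF p0Y] B(3) by linarith
    show ?thesis
    \<comment> \<open>\<open>main\<close> asks that the largest modulus be attained with a positive
      value; otherwise the sign is changed.\<close>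
    proof (cases "B (\<phi> p) > 0")
      case True
      show ?thesis by (rule main[OF \<mu> f lap p(1)]) (use True p(2) in auto)
    next
      case False
      have nB: "bounded_linear (\<lambda>x::real. - x)" by (rule bounded_linear_minus[OF bounded_linear_ident])
      have f': "C_k_on 2 (chart_img \<kappa>) (\<lambda>z. - B (\<phi> (param \<kappa> z)))" if "\<kappa> \<in> A" for \<kappa>
        by (rule bounded_linear.C_k_on_bounded_linear[OF nB img_open[OF that] f[OF that]])
      have lap': "flat_laplacian (\<lambda>z. - B (\<phi> (param \<kappa> z))) z = - \<mu> * (conf_factor \<kappa> z)\<^sup>2 * - B (\<phi> (param \<kappa> z))"
        if "\<kappa> \<in> A" "z \<in> chart_img \<kappa>" for \<kappa> z
        unfolding flat_laplacian_bounded_linear[OF nB img_open[OF that(1)] that(2) f[OF that(1)]] lap[OF that] by simp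
      show ?thesis by (rule main[OF \<mu>, of "\<lambda>p. - B (\<phi> p)", OF f' lap' p(1)]) (use False pos p(2) in auto)
    qed
  qed
  then show ?thesis using den by (intro exI[of _ c]) (auto simp: c_def)
qed

end

theorem corollaryB:
  fixes Y :: "'a::t2_space set" and A :: "'a metric_chart set"
    and \<gamma> :: "real \<Rightarrow> 'a" and L :: real
  assumes "compact_hyperbolic_surface Y A"
    and "closed_geodesic Y A \<gamma> L"
  shows "\<exists>C::real. C > 0 \<and>
    (\<forall>(\<phi>::'a \<Rightarrow> complex) (\<mu>::real).
       eigenfunction A \<phi> \<mu> \<longrightarrow> \<mu> > 0 \<longrightarrow> L2_norm_on Y A \<phi> = 1 \<longrightarrow>
       geodesic_period \<gamma> L \<phi> \<le> C * \<mu> powr (1/4))"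
proof -
  interpret compact_hyperbolic_surface Y A by (rule assms(1))
  obtain c where c: "c > 0" "\<And>\<phi> \<mu>. eigenfunction A \<phi> \<mu> \<Longrightarrow> 0 < \<mu> \<Longrightarrow> c \<le> \<mu>" using spectral_gap by blast
  obtain h0 C0 where h0: "h0 > 0" "C0 > 0"
    and est: "\<And>\<phi> \<mu> h. eigenfunction A \<phi> \<mu> \<Longrightarrow> 0 \<le> \<mu> \<Longrightarrow> L2_norm_on Y A \<phi> = 1 \<Longrightarrow> 0 < h \<Longrightarrow> h \<le> h0 \<Longrightarrow>
      h * geodesic_period \<gamma> L \<phi> \<le> (5 + 32 * \<mu> * h ^ 4) * C0"
    using geodesic_period_scaled_bound[OF assms(2)] by blast
  \<comment> \<open>The right-hand side of \<open>est\<close> at the scale chosen below, for which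
    \<open>\<mu> * h^4 = c * h0^4\<close>.\<close>
  define B where "B = (5 + 32 * (c * h0 ^ 4)) * C0"
  have B: "B > 0" unfolding B_def using c h0 by (intro mult_pos_pos add_pos_nonneg) auto
  define C where "C = B / (h0 * c powr (1/4))"
  show ?thesis
  proof (intro exI[of _ C] conjI allI impI)
    show "C > 0" unfolding C_def using B h0 c by simp
    fix \<phi> \<mu> assume \<phi>: "eigenfunction A \<phi> \<mu>" and \<mu>: "\<mu> > 0" and norm: "L2_norm_on Y A \<phi> = 1"
    \<comment> \<open>The gap \<open>c \<le> \<mu>\<close> gives \<open>s \<le> 1\<close>, hence
      \<open>h \<le> h0\<close>, while \<open>s^4 = c / \<mu>\<close> removes \<open>\<mu>\<close>
      from the right-hand side of \<open>est\<close>. Dividing by \<open>h\<close> then produces the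
      power 1/4.\<close>
    define s where "s = (c / \<mu>) powr (1/4)"
    define h where "h = h0 * s"
    have s0: "s > 0" unfolding s_def using c \<mu> by simp
    have "s \<le> 1" unfolding s_def using c(1) c(2)[OF \<phi> \<mu>] \<mu> by (intro powr_le1) auto
    then have h: "0 < h" "h \<le> h0" using h0 s0 by (auto simp: h_def mult_left_le)
    have s4: "s ^ 4 = c / \<mu>"
    proof -
      have "s ^ 4 = s powr 4" using s0 by (simp add: powr_numeral)
      also have "\<dots> = c / \<mu>" unfolding s_def powr_powr using c \<mu> by simp
      finally show ?thesis .
    qed
    have "\<mu> * h ^ 4 = c * h0 ^ 4" using \<mu> by (simp add: h_def power_mult_distrib s4)
    then have "h * geodesic_period \<gamma> L \<phi> \<le> B"
      using est[OF \<phi> _ norm h] \<mu> by (simp add: B_def mult.assoc)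
    then have "geodesic_period \<gamma> L \<phi> \<le> B / h" using h by (simp add: pos_le_divide_eq mult.commute)
    also have "\<dots> = C * \<mu> powr (1/4)"
      using c \<mu> h0 by (simp add: C_def h_def s_def powr_divide)
    finally show "geodesic_period \<gamma> L \<phi> \<le> C * \<mu> powr (1/4)" .
  qed
qed

end
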